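(* Let $a<b$ be real numbers. For every flow $(X,\mathbb{R})$ with $\mathrm{mdim}(X,\mathbb{R})<b-a$ there is a flow $(Y,\mathbb{R})$ which is an extension of $(X,\mathbb{R})$, satisfies $\mathrm{mdim}(Y,\mathbb{R})=\mathrm{mdim}(X,\mathbb{R})$, and can be embedded in the flow $(B_1(V[a,b]),\mathbb{R})$.
   Context: A flow $(X,\mathbb{R})$ is a compact metric space $X$ with a continuous map $\mathbb{R}\times X\to X$, $(r,x)\mapsto rx$, such that $0x=x$ and $r_1(r_2x)=(r_1+r_2)x$. A flow $(Y,\mathbb{R})$ can be embedded in a flow $(X,\mathbb{R})$ if there is an $\mathbb{R}$-equivariant homeomorphism of $Y$ onto a subspace of $X$. A flow $(Y,\mathbb{R})$ is an extension of a flow $(X,\mathbb{R})$ if there is a continuous surjective map $\psi:Y\to X$ with $\psi(ry)=r\psi(y)$ for all $r\in\mathbb{R}$, $y\in Y$. Mean dimension: for a compact metric space $(X,d)$ and $\epsilon>0$, a continuous map $f:X\to K$ is a $(d,\epsilon)$-embedding if $f(x_1)=f(x_2)$ implies $d(x_1,x_2)<\epsilon$. $\mathrm{Widim}_\epsilon(X,d)$ is the minimum of the Lebesgue covering dimension $\dim(K)$ over compact metrizable spaces $K$ admitting a $(d,\epsilon)$-embedding $X\to K$. For a flow and $N>0$ put $d_N(x,y)=\sup_{r\in[0,N]}d(rx,ry)$ and $\mathrm{mdim}(X,\mathbb{R})=\lim_{\epsilon\to0}\lim_{N\to\infty}\mathrm{Widim}_\epsilon(X,d_N)/N\in[0,+\infty]$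 (the limits exist, and the value does not depend on the compatible metric $d$). Function space: for real $a<b$, $V[a,b]$ is the space of bounded continuous functions $f:\mathbb{R}\to\mathbb{C}$ whose Fourier transform $\mathcal{F}(f)$ (in the sense of tempered distributions, extending $\mathcal{F}(f)(\xi)=\int_{-\infty}^\infty e^{-2\pi it\xi}f(t)\,dt$) has support in $[a,b]$. $B_1(V[a,b])=\{f\in V[a,b]:\|f\|_\infty\le1\}$ is a compact metric space under $\boldsymbol{d}(f_1,f_2)=\sum_{n\ge1}2^{-n}\|f_1-f_2\|_{L^\infty([-n,n])}$, and $\mathbb{R}$ acts on it by the shift $(\tau_rf)(t)=f(t+r)$, making it a flow. *)

theory Defs
  imports "HOL-Analysis.Analysis"
begin

section \<open>Flows\<close>

definition flow :: "'a metric \<Rightarrow> (real \<Rightarrow> 'a \<Rightarrow> 'a) \<Rightarrow> bool" where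
  "flow X \<phi> \<longleftrightarrow>
     compact_space (mtopology_of X) \<and>
     continuous_map (prod_topology euclideanreal (mtopology_of X)) (mtopology_of X)
       (\<lambda>(r, x). \<phi> r x) \<and>
     (\<forall>x\<in>mspace X. \<phi> 0 x = x) \<and>
     (\<forall>r s. \<forall>x\<in>mspace X. \<phi> r (\<phi> s x) = \<phi> (r + s) x)"

definition equivariant ::
  "'b metric \<Rightarrow> (real \<Rightarrow> 'b \<Rightarrow> 'b) \<Rightarrow> (real \<Rightarrow> 'a \<Rightarrow> 'a) \<Rightarrow> ('b \<Rightarrow> 'a) \<Rightarrow> bool" where
  "equivariant Y \<eta> \<phi> h \<longleftrightarrow> (\<forall>r. \<forall>y\<in>mspace Y. h (\<eta> r y) = \<phi> r (h y))"

definition flow_embeds ::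
  "'b metric \<Rightarrow> (real \<Rightarrow> 'b \<Rightarrow> 'b) \<Rightarrow> 'a metric \<Rightarrow> (real \<Rightarrow> 'a \<Rightarrow> 'a) \<Rightarrow> bool" where
  "flow_embeds Y \<eta> X \<phi> \<longleftrightarrow>
     (\<exists>h. embedding_map (mtopology_of Y) (mtopology_of X) h \<and> equivariant Y \<eta> \<phi> h)"

definition flow_extension ::
  "'b metric \<Rightarrow> (real \<Rightarrow> 'b \<Rightarrow> 'b) \<Rightarrow> 'a metric \<Rightarrow> (real \<Rightarrow> 'a \<Rightarrow> 'a) \<Rightarrow> bool" where
  "flow_extension Y \<eta> X \<phi> \<longleftrightarrow>
     (\<exists>\<psi>. continuous_map (mtopology_of Y) (mtopology_of X) \<psi> \<and>
          \<psi> ` mspace Y = mspace X \<and> equivariant Y \<eta> \<phi> \<psi>)"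


section \<open>Mean dimension\<close>

text \<open>
  Every finite open cover has a finite open refinement no point of which lies in more than
  \<open>n + 1\<close> members. The range \<open>n \<ge> -1\<close> gives the empty space dimension \<open>-1\<close>.
\<close>

definition covering_dim_le :: "'a topology \<Rightarrow> int \<Rightarrow> bool" where
  "covering_dim_le K n \<longleftrightarrow> -1 \<le> n \<and>
     (\<forall>\<U>. finite \<U> \<and> (\<forall>U\<in>\<U>. openin K U) \<and> \<Union>\<U> = topspace K \<longrightarrow>
        (\<exists>\<V>. finite \<V> \<and> (\<forall>V\<in>\<V>. openin K V) \<and> \<Union>\<V> = topspace K \<and>
             (\<forall>V\<in>\<V>. \<exists>U\<in>\<U>. V \<subseteq> U) \<and>
             (\<forall>x\<in>topspace K. int (card {V\<in>\<V>. x \<in> V}) \<le> n + 1)))"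

definition covering_dim :: "'a topology \<Rightarrow> ereal" where
  "covering_dim K = (INF n\<in>{n. covering_dim_le K n}. ereal (of_int n))"

definition eps_embedding ::
  "'a set \<Rightarrow> ('a \<Rightarrow> 'a \<Rightarrow> real) \<Rightarrow> real \<Rightarrow> 'b topology \<Rightarrow> ('a \<Rightarrow> 'b) \<Rightarrow> bool" where
  "eps_embedding M d \<epsilon> K f \<longleftrightarrow>
     continuous_map (Metric_space.mtopology M d) K f \<and>
     (\<forall>x\<in>M. \<forall>y\<in>M. f x = f y \<longrightarrow> d x y < \<epsilon>)"

text \<open>
  A definition cannot quantify over all types, so \<open>K\<close> ranges over the compact metrizable
  topologies whose points are elements of \<^typ>\<open>nat \<Rightarrow> real\<close>. Every compact metrizable space is
  homeomorphic to one of these, since it embeds in the Hilbert cube. The dimensions lie in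
  \<open>{-1, 0, 1, \<dots>} \<union> {\<infinity>}\<close>, so the infimum is attained.
\<close>

definition Widim :: "real \<Rightarrow> 'a set \<Rightarrow> ('a \<Rightarrow> 'a \<Rightarrow> real) \<Rightarrow> ereal" where
  "Widim \<epsilon> M d =
     Inf {covering_dim K | K :: (nat \<Rightarrow> real) topology.
            compact_space K \<and> metrizable_space K \<and> (\<exists>f. eps_embedding M d \<epsilon> K f)}"

text \<open>
  The value \<open>0\<close> off the carrier is there because \<^const>\<open>Metric_space\<close> requires distances to be
  nonnegative everywhere.
\<close>

definition flow_dist ::
  "'a metric \<Rightarrow> (real \<Rightarrow> 'a \<Rightarrow> 'a) \<Rightarrow> real \<Rightarrow> 'a \<Rightarrow> 'a \<Rightarrow> real" where
  "flow_dist X \<phi> N x y =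
     (if x \<in> mspace X \<and> y \<in> mspace X
      then SUP r\<in>{0..N}. mdist X (\<phi> r x) (\<phi> r y) else 0)"

lemma flow_in_mspace:
  assumes "flow X \<phi>" "x \<in> mspace X"
  shows "\<phi> r x \<in> mspace X"
proof -
  have "(\<lambda>(r, x). \<phi> r x) \<in> UNIV \<times> mspace X \<rightarrow> mspace X"
    using assms(1) by (simp add: flow_def continuous_map_def)
  then have "(case (r, x) of (r, x) \<Rightarrow> \<phi> r x) \<in> mspace X"
    using assms(2) by (rule_tac funcset_mem) auto
  then show ?thesis by simp
qed

lemma Metric_space_flow_dist:
  assumes fl: "flow X \<phi>" and "0 \<le> N"
  shows "Metric_space (mspace X) (flow_dist X \<phi> N)"
proof -
  interpret M: Metric_space "mspace X" "mdist X" by simp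
  have "compactin M.mtopology (mspace X)"
    using fl by (simp add: flow_def mtopology_of_def compact_space_def)
  then have "M.mbounded (mspace X)" by (rule M.compactin_imp_mbounded)
  then obtain B where B: "\<And>x y. x \<in> mspace X \<Longrightarrow> y \<in> mspace X \<Longrightarrow> mdist X x y \<le> B"
    unfolding M.mbounded_alt by blast
  note mem = flow_in_mspace[OF fl]
  have bdd: "bdd_above ((\<lambda>r. mdist X (\<phi> r x) (\<phi> r y)) ` {0..N})"
    if "x \<in> mspace X" "y \<in> mspace X" for x y
    using B[OF mem[OF that(1)] mem[OF that(2)]] by (intro bdd_aboveI2)
  have up: "mdist X (\<phi> r x) (\<phi> r y) \<le> flow_dist X \<phi> N x y"
    if "x \<in> mspace X" "y \<in> mspace X" "r \<in> {0..N}" for x y r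
    using cSUP_upper[OF that(3) bdd[OF that(1,2)]] that by (simp add: flow_dist_def)
  have id0: "\<phi> 0 x = x" if "x \<in> mspace X" for x
    using fl that by (simp add: flow_def)
  show ?thesis
  proof
    fix x y
    show "0 \<le> flow_dist X \<phi> N x y"
    proof (cases "x \<in> mspace X \<and> y \<in> mspace X")
      case True
      then have "mdist X (\<phi> 0 x) (\<phi> 0 y) \<le> flow_dist X \<phi> N x y"
        using \<open>0 \<le> N\<close> by (intro up) auto
      then show ?thesis
        using M.nonneg[of "\<phi> 0 x" "\<phi> 0 y"] by linarith
    qed (auto simp: flow_dist_def)
    show "flow_dist X \<phi> N x y = flow_dist X \<phi> N y x"
      by (auto simp: flow_dist_def M.commute)
  next
    fix x y assume xy: "x \<in> mspace X" "y \<in> mspace X"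
    show "flow_dist X \<phi> N x y = 0 \<longleftrightarrow> x = y"
    proof
      assume "flow_dist X \<phi> N x y = 0"
      then have "mdist X x y \<le> 0"
        using up[OF xy, of 0] \<open>0 \<le> N\<close> id0 xy by simp
      then show "x = y" using xy M.zero[OF xy] M.nonneg[of x y] by linarith
    next
      assume "x = y"
      then show "flow_dist X \<phi> N x y = 0"
        using xy mem \<open>0 \<le> N\<close> by (simp add: flow_dist_def)
    qed
  next
    fix x y z assume xyz: "x \<in> mspace X" "y \<in> mspace X" "z \<in> mspace X"
    have "(SUP r\<in>{0..N}. mdist X (\<phi> r x) (\<phi> r z)) \<le> flow_dist X \<phi> N x y + flow_dist X \<phi> N y z"
    proof (rule cSUP_least)
      fix r assume r: "r \<in> {0..N}"
      show "mdist X (\<phi> r x) (\<phi> r z) \<le> flow_dist X \<phi> N x y + flow_dist X \<phi> N y z"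
        using M.triangle[OF mem[OF xyz(1)] mem[OF xyz(2)] mem[OF xyz(3)], of r r r]
          up[OF xyz(1,2) r] up[OF xyz(2,3) r] by linarith
    qed (use \<open>0 \<le> N\<close> in auto)
    then show "flow_dist X \<phi> N x z \<le> flow_dist X \<phi> N x y + flow_dist X \<phi> N y z"
      using xyz by (simp add: flow_dist_def)
  qed
qed

definition mdim :: "'a metric \<Rightarrow> (real \<Rightarrow> 'a \<Rightarrow> 'a) \<Rightarrow> ereal" where
  "mdim X \<phi> =
     Lim (at_right 0) (\<lambda>\<epsilon>::real.
       Lim at_top (\<lambda>N::real. Widim \<epsilon> (mspace X) (flow_dist X \<phi> N) / ereal N))"


section \<open>Band-limited functions\<close>

definition fourier :: "(real \<Rightarrow> complex) \<Rightarrow> real \<Rightarrow> complex" where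
  "fourier g \<xi> = (LINT t|lborel. exp (- 2 * of_real pi * \<i> * of_real t * of_real \<xi>) * g t)"

definition smooth :: "(real \<Rightarrow> complex) \<Rightarrow> bool" where
  "smooth g \<longleftrightarrow>
     (\<forall>n t. ((\<lambda>h s. vector_derivative h (at s)) ^^ n) g differentiable (at t))"

definition test_function_on :: "real set \<Rightarrow> (real \<Rightarrow> complex) \<Rightarrow> bool" where
  "test_function_on U g \<longleftrightarrow>
     smooth g \<and> compact (closure {t. g t \<noteq> 0}) \<and> closure {t. g t \<noteq> 0} \<subseteq> U"

text \<open>
  A tempered distribution is represented as a functional on all functions; only its values on
  Schwartz functions matter. A bounded continuous \<open>f\<close> acts by integration, the Fourier transform
  is defined by duality, \<open>\<langle>\<F> T, g\<rangle> = \<langle>T, \<F> g\<rangle>\<close>, and the support is the complement of the largest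
  open set on which the distribution vanishes.
\<close>

type_synonym dist_functional = "(real \<Rightarrow> complex) \<Rightarrow> complex"

definition dist_of_fun :: "(real \<Rightarrow> complex) \<Rightarrow> dist_functional" where
  "dist_of_fun f = (\<lambda>g. LINT t|lborel. f t * g t)"

definition dist_fourier :: "dist_functional \<Rightarrow> dist_functional" where
  "dist_fourier T = (\<lambda>g. T (fourier g))"

definition dist_support :: "dist_functional \<Rightarrow> real set" where
  "dist_support T = - \<Union>{U. open U \<and> (\<forall>g. test_function_on U g \<longrightarrow> T g = 0)}"

definition V :: "real \<Rightarrow> real \<Rightarrow> (real \<Rightarrow>\<^sub>C complex) set" where
  "V a b = {f. dist_support (dist_fourier (dist_of_fun (apply_bcontfun f))) \<subseteq> {a..b}}"

text \<open>The norm on \<^typ>\<open>real \<Rightarrow>\<^sub>C complex\<close> is the supremum norm.\<close>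

definition B1V :: "real \<Rightarrow> real \<Rightarrow> (real \<Rightarrow>\<^sub>C complex) set" where
  "B1V a b = {f \<in> V a b. norm f \<le> 1}"

text \<open>For continuous functions the essential supremum over \<open>[-n, n]\<close> is the supremum.\<close>

definition sup_dist_on :: "nat \<Rightarrow> (real \<Rightarrow>\<^sub>C complex) \<Rightarrow> (real \<Rightarrow>\<^sub>C complex) \<Rightarrow> real" where
  "sup_dist_on n f g = (SUP t\<in>{- real n..real n}. norm (f t - g t))"

definition loc_unif_dist :: "(real \<Rightarrow>\<^sub>C complex) \<Rightarrow> (real \<Rightarrow>\<^sub>C complex) \<Rightarrow> real" where
  "loc_unif_dist f g = (\<Sum>n. (1/2) ^ Suc n * sup_dist_on (Suc n) f g)"

definition B1V_metric :: "real \<Rightarrow> real \<Rightarrow> (real \<Rightarrow>\<^sub>C complex) metric" where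
  "B1V_metric a b = metric (B1V a b, loc_unif_dist)"

definition translate :: "real \<Rightarrow> (real \<Rightarrow>\<^sub>C complex) \<Rightarrow> (real \<Rightarrow>\<^sub>C complex)" where
  "translate r f = Bcontfun (\<lambda>t. f (t + r))"

lemma apply_translate [simp]: "apply_bcontfun (translate r f) t = f (t + r)"
proof -
  have "bounded (range (\<lambda>t. f (t + r)))"
    by (rule bounded_subset[OF bounded_apply_bcontfun[of f]]) auto
  moreover have "continuous_on UNIV (\<lambda>t. f (t + r))"
    by (intro continuous_on_compose2[OF continuous_on_apply_bcontfun[of UNIV f]]
        continuous_intros) auto
  ultimately have "(\<lambda>t. f (t + r)) \<in> bcontfun"
    by (simp add: bcontfun_def)
  then show ?thesis
    by (simp add: translate_def Bcontfun_inverse)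
qed

lemma sup_dist_on_bounds:
  fixes f g :: "real \<Rightarrow>\<^sub>C complex"
  shows norm_le_sup_dist_on: "\<bar>t\<bar> \<le> real n \<Longrightarrow> norm (f t - g t) \<le> sup_dist_on n f g"
    and sup_dist_on_nonneg: "0 \<le> sup_dist_on n f g"
    and sup_dist_on_le: "sup_dist_on n f g \<le> dist f g"
proof -
  have le: "norm (f t - g t) \<le> dist f g" for t
    using dist_bounded[of f t g] by (simp add: dist_norm)
  then have bdd: "bdd_above ((\<lambda>t. norm (f t - g t)) ` {- real n..real n})"
    by (auto simp: bdd_above_def)
  show up: "norm (f t - g t) \<le> sup_dist_on n f g" if "\<bar>t\<bar> \<le> real n" for t
    unfolding sup_dist_on_def using that by (intro cSUP_upper[OF _ bdd]) auto
  show "0 \<le> sup_dist_on n f g"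
    using up[of 0] norm_ge_zero[of "f 0 - g 0"] by linarith
  show "sup_dist_on n f g \<le> dist f g"
    unfolding sup_dist_on_def by (intro cSUP_least le) auto
qed

lemma summable_loc_unif_dist: "summable (\<lambda>n. (1/2) ^ Suc n * sup_dist_on (Suc n) f g)"
proof (rule summable_comparison_test')
  show "summable (\<lambda>n. (1/2) ^ Suc n * dist f g)"
    by (intro summable_mult2) (simp add: summable_geometric)
  show "norm ((1/2) ^ Suc n * sup_dist_on (Suc n) f g) \<le> (1/2) ^ Suc n * dist f g" for n
    using sup_dist_on_nonneg[of "Suc n" f g] sup_dist_on_le[of "Suc n" f g] by simp
qed

text \<open>Hence \<^const>\<open>B1V_metric\<close> has the intended carrier and distance.\<close>

lemma Metric_space_B1V: "Metric_space (B1V a b) loc_unif_dist"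
proof
  fix f g h :: "real \<Rightarrow>\<^sub>C complex"
  note sm = summable_loc_unif_dist
  show "0 \<le> loc_unif_dist f g"
    unfolding loc_unif_dist_def using sm sup_dist_on_nonneg by (intro suminf_nonneg) auto
  show "loc_unif_dist f g = loc_unif_dist g f"
    by (simp add: loc_unif_dist_def sup_dist_on_def norm_minus_commute)
  show "loc_unif_dist f g = 0 \<longleftrightarrow> f = g"
  proof
    assume "loc_unif_dist f g = 0"
    then have "\<forall>n. (1/2) ^ Suc n * sup_dist_on (Suc n) f g = 0"
      unfolding loc_unif_dist_def using sm sup_dist_on_nonneg by (subst (asm) suminf_eq_zero_iff) auto
    then have z: "sup_dist_on (Suc n) f g = 0" for n by simp
    show "f = g"
    proof (rule bcontfun_eqI)
      fix t :: real
      obtain n where "\<bar>t\<bar> \<le> real n" using real_arch_simple by blast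
      then have "norm (f t - g t) \<le> sup_dist_on (Suc n) f g"
        by (intro norm_le_sup_dist_on) auto
      then show "f t = g t" using z by simp
    qed
  qed (simp add: loc_unif_dist_def sup_dist_on_def)
  have tri: "sup_dist_on n f h \<le> sup_dist_on n f g + sup_dist_on n g h" for n
  proof -
    have "norm (f t - h t) \<le> sup_dist_on n f g + sup_dist_on n g h"
      if "t \<in> {- real n..real n}" for t
    proof -
      have "\<bar>t\<bar> \<le> real n" using that by auto
      then show ?thesis
        using norm_le_sup_dist_on[of t n f g] norm_le_sup_dist_on[of t n g h]
          norm_triangle_ineq[of "f t - g t" "g t - h t"] by simp
    qed
    then show ?thesis
      unfolding sup_dist_on_def[of n f h] by (intro cSUP_least) auto
  qed
  have "loc_unif_dist f h \<le>
      (\<Sum>n. (1/2) ^ Suc n * sup_dist_on (Suc n) f g + (1/2) ^ Suc n * sup_dist_on (Suc n) g h)"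
    unfolding loc_unif_dist_def
  proof (rule suminf_le[OF _ sm summable_add[OF sm sm]])
    fix n
    show "(1/2) ^ Suc n * sup_dist_on (Suc n) f h \<le>
        (1/2) ^ Suc n * sup_dist_on (Suc n) f g + (1/2) ^ Suc n * sup_dist_on (Suc n) g h"
      unfolding distrib_left[symmetric] by (intro mult_left_mono tri) simp
  qed
  also have "\<dots> = loc_unif_dist f g + loc_unif_dist g h"
    unfolding loc_unif_dist_def by (rule suminf_add[OF sm sm, symmetric])
  finally show "loc_unif_dist f h \<le> loc_unif_dist f g + loc_unif_dist g h" .
qed

lemma mspace_B1V_metric [simp]: "mspace (B1V_metric a b) = B1V a b"
  by (simp add: B1V_metric_def Metric_space.mspace_metric[OF Metric_space_B1V])

lemma mdist_B1V_metric [simp]: "mdist (B1V_metric a b) = loc_unif_dist"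
  by (simp add: B1V_metric_def Metric_space.mdist_metric[OF Metric_space_B1V])

end

(* The extension is Y = X x S, where S is the dyadic solenoid with its translation flow. The flow on S
is isometric and S maps to a circle with small fibres, so passing to Y raises Widim by at most a
constant at every time scale, and mdim Y = mdim X.

Fix mdim X < c - a < b - a. The point of S is encoded by an almost periodic function whose isolated
frequencies lie in (c, b], which a Fejer kernel recovers from the sum with any function of spectrum
in [a, c]. To encode the point of X, start from the zero map into the functions of spectrum in [a, c]
and improve it by a convergent series of small corrections. The phase of S modulo L = 2^k marks the
times L Z - theta on an orbit. On each block of length L the current map is resampled at m = rho L
equally spaced times, mdim X < rho < c - a, and the m samples are changed slightly so that they
become an epsilon-embedding of X for the time-L distance; this is possible by general position,
because Widim < m and the samples lie in a real vector space of dimension 2 m. Since rho < c - a, the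
changed samples are interpolated by translates of a rapidly decaying kernel with spectrum in [a, c]. *)

theory Submission
  imports Defs "HOL-Probability.Sinc_Integral" "HOL-Real_Asymp.Real_Asymp"
begin

section \<open>Band-limited functions\<close>

text \<open>Two obstacles shape the proof. A flow with fixed or periodic points offers no continuous
  equivariant choice of block boundaries, so X alone cannot tell where to cut its orbits; the
  solenoid supplies the cuts from outside. Its clocks are nested: 2^k divides 2^k' for k \<le> k',
  hence a map built at one scale keeps its periodicity at all later ones. The second obstacle is the
  infinite series: a correction could undo an earlier separation. Each stage therefore records a
  positive margin, obtained from compactness, and all later corrections together stay within a third
  of it. The threshold b - a comes from a count: complex functions of bandwidth b - a carry 2 (b -
  a) real samples per unit of time, and separating a pair of points takes twice the width of the
  space. The strict gaps mdim X < c - a < b - a pay for rounding, for the decay of the kernel and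
  for the frequencies of the solenoid. Since the point of S is recovered from the sum by itself, the
  code of X only has to separate points over one and the same point of S.\<close>

abbreviation cexp :: "real \<Rightarrow> real \<Rightarrow> complex" where
  "cexp \<mu> t \<equiv> cis (2 * pi * \<mu> * t)"

lemma cexp_add: "cexp (\<mu> + \<nu>) t = cexp \<mu> t * cexp \<nu> t"
  and cexp_shift: "cexp \<mu> (s + t) = cexp \<mu> s * cexp \<mu> t"
  by (simp_all add: cis_mult algebra_simps)

text \<open>Unlike the distributional definition of \<^const>\<open>V\<close>, this notion of a band-limited function passes
  to bounded pointwise limits by dominated convergence.\<close>

definition kills :: "real \<Rightarrow> real \<Rightarrow> (real \<Rightarrow> complex) \<Rightarrow> bool" where
  "kills a b q \<longleftrightarrow> integrable lborel q \<and> (\<forall>\<mu>\<in>{a..b}. (LINT t|lborel. cexp \<mu> t * q t) = 0)"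

definition band_limited :: "real \<Rightarrow> real \<Rightarrow> (real \<Rightarrow> complex) \<Rightarrow> bool" where
  "band_limited a b f \<longleftrightarrow> f \<in> borel_measurable borel \<and> bounded (range f) \<and>
     (\<forall>q. kills a b q \<longrightarrow> (LINT t|lborel. f t * q t) = 0)"

lemma band_limited_cexp: "\<mu> \<in> {a..b} \<Longrightarrow> band_limited a b (cexp \<mu>)"
  unfolding band_limited_def kills_def
  by (auto intro!: borel_measurable_continuous_onI continuous_intros boundedI[where B=1])

lemma integrable_bounded_mult:
  fixes f q :: "real \<Rightarrow> complex"
  assumes "f \<in> borel_measurable borel" "bounded (range f)" "integrable lborel q"
  shows "integrable lborel (\<lambda>t. f t * q t)"
proof -
  obtain B where B: "\<And>t. norm (f t) \<le> B" using assms(2) by (auto simp: bounded_iff)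
  show ?thesis
  proof (rule Bochner_Integration.integrable_bound)
    show "integrable lborel (\<lambda>t. B *\<^sub>R q t)" using assms by auto
    show "(\<lambda>t. f t * q t) \<in> borel_measurable lborel" using assms by auto
    have "norm (f t * q t) \<le> norm (B *\<^sub>R q t)" for t
      using mult_right_mono[OF order_trans[OF B[of t] abs_ge_self] norm_ge_zero[of "q t"]]
      by (simp add: norm_mult)
    then show "AE t in lborel. norm (f t * q t) \<le> norm (B *\<^sub>R q t)" by simp
  qed
qed

lemma band_limited_add:
  assumes "band_limited a b f" "band_limited a b g"
  shows "band_limited a b (\<lambda>t. f t + g t)"
  using assms unfolding band_limited_def
  by (auto simp: ring_distribs Bochner_Integration.integral_add integrable_bounded_mult kills_def
      bounded_plus_comp)

lemma band_limited_cmult: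
  assumes "band_limited a b f"
  shows "band_limited a b (\<lambda>t. c * f t)"
proof -
  have "bounded ((\<lambda>z. c * z) ` range f)"
    using assms bounded_linear_image[OF _ bounded_linear_mult_right, of "range f" c]
    by (simp add: band_limited_def)
  then have "bounded (range (\<lambda>t. c * f t))" by (simp add: image_image)
  then show ?thesis
    using assms unfolding band_limited_def by (auto simp: mult.assoc)
qed

lemma band_limited_zero: "band_limited a b (\<lambda>t. 0)"
  by (auto simp: band_limited_def)

lemma band_limited_sum:
  assumes "\<And>i. i \<in> A \<Longrightarrow> band_limited a b (f i)"
  shows "band_limited a b (\<lambda>t. \<Sum>i\<in>A. f i t)"
  using assms
  by (induction A rule: infinite_finite_induct) (auto intro: band_limited_zero band_limited_add)

lemma bounded_pointwise_limit_integral: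
  fixes f :: "nat \<Rightarrow> real \<Rightarrow> complex"
  assumes "\<And>n. f n \<in> borel_measurable borel" "\<And>n t. norm (f n t) \<le> B" "\<And>t. (\<lambda>n. f n t) \<longlonglongrightarrow> g t" "integrable lborel q"
  shows "(\<lambda>n. LINT t|lborel. f n t * q t) \<longlonglongrightarrow> (LINT t|lborel. g t * q t)"
proof -
  have [measurable]: "f n \<in> borel_measurable borel" for n by fact
  have [measurable]: "g \<in> borel_measurable borel"
    using borel_measurable_LIMSEQ_metric[of f borel g] assms(3) by auto
  have [measurable]: "q \<in> borel_measurable borel" using assms(4) by auto
  show ?thesis
  proof (rule integral_dominated_convergence[where w="\<lambda>t. B * norm (q t)"])
    show "AE t in lborel. (\<lambda>n. f n t * q t) \<longlonglongrightarrow> g t * q t"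
      by (intro AE_I2 tendsto_intros assms(3))
    show "AE t in lborel. norm (f n t * q t) \<le> B * norm (q t)" for n
      by (intro AE_I2) (simp add: norm_mult mult_right_mono assms(2))
  qed (use assms(4) in auto)
qed

lemma band_limited_limit:
  assumes "\<And>n. band_limited a b (f n)" "\<And>n t. norm (f n t) \<le> B" "\<And>t. (\<lambda>n. f n t) \<longlonglongrightarrow> g t"
  shows "band_limited a b g"
proof -
  have [measurable]: "f n \<in> borel_measurable borel" for n
    using assms(1) by (auto simp: band_limited_def)
  have [measurable]: "g \<in> borel_measurable borel"
    using borel_measurable_LIMSEQ_metric[of f borel g] assms(3) by auto
  have "norm (g t) \<le> B" for t
    using LIMSEQ_le_const2[OF tendsto_norm[OF assms(3)[of t]]] assms(2) by blast
  then have "bounded (range g)" by (auto intro!: boundedI)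
  moreover have "(LINT t|lborel. g t * q t) = 0" if q: "kills a b q" for q
  proof -
    have "(\<lambda>n. LINT t|lborel. f n t * q t) \<longlonglongrightarrow> (LINT t|lborel. g t * q t)"
      by (rule bounded_pointwise_limit_integral[OF _ assms(2,3)]) (use q in \<open>auto simp: kills_def\<close>)
    moreover have "(LINT t|lborel. f n t * q t) = 0" for n
      using assms(1) q by (auto simp: band_limited_def)
    ultimately show ?thesis by (simp add: LIMSEQ_const_iff)
  qed
  ultimately show ?thesis by (auto simp: band_limited_def)
qed

lemma band_limited_mono:
  assumes "band_limited a b f" "a' \<le> a" "b \<le> b'"
  shows "band_limited a' b' f"
  using assms unfolding band_limited_def kills_def by (meson atLeastAtMost_iff order_trans)

section \<open>Translation, modulation and multiplication by \<open>sinc\<close>\<close>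

lemma integrable_translate:
  fixes q :: "real \<Rightarrow> complex"
  assumes "integrable lborel q"
  shows "integrable lborel (\<lambda>t. q (t + r))"
  using lborel_integrable_real_affine[OF assms, of 1 r] by (simp add: add.commute)

lemma integral_translate:
  fixes q :: "real \<Rightarrow> complex"
  shows "(LINT t|lborel. q (t + r)) = (LINT t|lborel. q t)"
  using lborel_integral_real_affine[of 1 q r] by (simp add: add.commute)

text \<open>The translation is moved onto the test function: translating \<open>q\<close> only
  multiplies its integral against \<open>cexp \<mu>\<close> by a phase, so the translate still kills
  the band.\<close>

lemma band_limited_shift:
  assumes "band_limited a b f"
  shows "band_limited a b (\<lambda>t. f (t + r))"
proof -
  have [measurable]: "f \<in> borel_measurable borel" and "bounded (range f)"
    using assms by (auto simp: band_limited_def)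
  moreover have "bounded (range (\<lambda>t. f (t + r)))"
    by (rule bounded_subset[OF \<open>bounded (range f)\<close>]) auto
  moreover have "(LINT t|lborel. f (t + r) * q t) = 0" if q: "kills a b q" for q
  proof -
    have "kills a b (\<lambda>t. q (t + (- r)))"
      unfolding kills_def
    proof safe
      show "integrable lborel (\<lambda>t. q (t + (- r)))"
        using q integrable_translate unfolding kills_def by blast
      fix \<mu> assume "\<mu> \<in> {a..b}"
      have "(LINT t|lborel. cexp \<mu> t * q (t + (- r)))
          = (LINT t|lborel. cexp \<mu> r * (cexp \<mu> (t + (- r)) * q (t + (- r))))"
        by (simp only: mult.assoc[symmetric] cis_mult distrib_left[symmetric]) simp
      also have "\<dots> = cexp \<mu> r * (LINT t|lborel. cexp \<mu> (t + (- r)) * q (t + (- r)))"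
        by simp
      also have "\<dots> = 0"
        using integral_translate[of "\<lambda>t. cexp \<mu> t * q t" "- r"] q \<open>\<mu> \<in> {a..b}\<close>
        unfolding kills_def by auto
      finally show "(LINT t|lborel. cexp \<mu> t * q (t + (- r))) = 0" .
    qed
    then have "(LINT t|lborel. f t * q (t + (- r))) = 0"
      using assms unfolding band_limited_def by blast
    then show ?thesis
      using integral_translate[of "\<lambda>t. f t * q (t + (- r))" r] by simp
  qed
  ultimately show ?thesis by (auto simp: band_limited_def)
qed

text \<open>If \<open>q\<close> kills the shifted band, then \<open>cexp \<nu> t * q t\<close> kills
  the original one, because the two exponentials multiply to one of the shifted frequency.\<close>

lemma band_limited_modulate:
  assumes "band_limited a b f"
  shows "band_limited (a + \<nu>) (b + \<nu>) (\<lambda>t. cexp \<nu> t * f t)"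
proof -
  have [measurable]: "f \<in> borel_measurable borel" and bf: "bounded (range f)"
    using assms by (auto simp: band_limited_def)
  have m: "cexp \<nu> \<in> borel_measurable borel"
    by (intro borel_measurable_continuous_onI continuous_intros)
  have "bounded (range (\<lambda>t. cexp \<nu> t * f t))"
    using bf by (auto simp: bounded_iff norm_mult)
  moreover have "(LINT t|lborel. (cexp \<nu> t * f t) * q t) = 0" if q: "kills (a + \<nu>) (b + \<nu>) q" for q
  proof -
    have "kills a b (\<lambda>t. cexp \<nu> t * q t)"
      unfolding kills_def
    proof safe
      show "integrable lborel (\<lambda>t. cexp \<nu> t * q t)"
        using q by (intro integrable_bounded_mult m) (auto simp: kills_def intro: boundedI[where B=1])
      fix \<mu> assume "\<mu> \<in> {a..b}"
      then have "(LINT t|lborel. cexp (\<mu> + \<nu>) t * q t) = 0" using q by (auto simp: kills_def)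
      then show "(LINT t|lborel. cexp \<mu> t * (cexp \<nu> t * q t)) = 0"
        unfolding cexp_add by (simp only: mult_ac)
    qed
    then have "(LINT t|lborel. f t * (cexp \<nu> t * q t)) = 0"
      using assms by (auto simp: band_limited_def)
    then show ?thesis by (simp add: ac_simps)
  qed
  moreover have "(\<lambda>t. cexp \<nu> t * f t) \<in> borel_measurable borel" using m by auto
  ultimately show ?thesis by (auto simp: band_limited_def)
qed

lemma band_limited_cos:
  assumes "band_limited a b f" "0 \<le> \<nu>"
  shows "band_limited (a - \<nu>) (b + \<nu>) (\<lambda>t. of_real (cos (2 * pi * \<nu> * t)) * f t)"
proof -
  have "band_limited (a - \<nu>) (b + \<nu>) (\<lambda>t. (1/2) * (cexp \<nu> t * f t + cexp (- \<nu>) t * f t))"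
    using band_limited_modulate[OF assms(1), of \<nu>] band_limited_modulate[OF assms(1), of "- \<nu>"] assms(2)
    by (intro band_limited_cmult band_limited_add) (auto intro: band_limited_mono)
  also have "(\<lambda>t. (1/2) * (cexp \<nu> t * f t + cexp (- \<nu>) t * f t))
      = (\<lambda>t. of_real (cos (2 * pi * \<nu> * t)) * f t)"
  proof
    fix t
    have "cexp \<nu> t + cexp (- \<nu>) t = 2 * of_real (cos (2 * pi * \<nu> * t))"
      by (simp add: complex_eq_iff)
    then show "(1/2) * (cexp \<nu> t * f t + cexp (- \<nu>) t * f t) = of_real (cos (2 * pi * \<nu> * t)) * f t"
      by (simp add: distrib_right[symmetric])
  qed
  finally show ?thesis .
qed

text \<open>Finite form of Viete's product, by iterating the double angle formula; dividing by
  \<open>x\<close> and letting n grow gives \<open>sinc\<close>.\<close>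

lemma sin_prod_cos: "sin x = 2 ^ n * sin (x / 2 ^ n) * (\<Prod>k=1..n. cos (x / 2 ^ k))" for x :: real
proof (induction n)
  case (Suc n)
  have "sin (x / 2 ^ n) = 2 * sin (x / 2 ^ Suc n) * cos (x / 2 ^ Suc n)"
    using sin_double[of "x / 2 ^ Suc n"] by simp
  then show ?case using Suc by (simp add: mult_ac)
qed simp

lemma prod_cos_tendsto_sinc: "(\<lambda>n. \<Prod>k=1..n. cos (x / 2 ^ k)) \<longlonglongrightarrow> sinc x"
proof (cases "x = 0")
  case False
  have l0: "(\<lambda>n. x / 2 ^ n) \<longlonglongrightarrow> 0"
    using LIMSEQ_inverse_realpow_zero[of 2] tendsto_mult_right_zero[of "\<lambda>n. inverse (2 ^ n)" sequentially x]
    by (simp add: divide_inverse)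
  have l: "(\<lambda>n. sinc (x / 2 ^ n)) \<longlonglongrightarrow> 1"
    using isCont_tendsto_compose[OF isCont_sinc l0] by simp
  have "(\<lambda>n. sinc x / sinc (x / 2 ^ n)) \<longlonglongrightarrow> sinc x / 1"
    by (intro tendsto_divide tendsto_const l) simp
  moreover have "\<forall>\<^sub>F n in sequentially. sinc (x / 2 ^ n) \<noteq> 0"
    using tendsto_imp_eventually_ne[OF l, of 0] by simp
  then have "\<forall>\<^sub>F n in sequentially. sinc x / sinc (x / 2 ^ n) = (\<Prod>k=1..n. cos (x / 2 ^ k))"
  proof eventually_elim
    case (elim n)
    then have "sin (x / 2 ^ n) \<noteq> 0" using False by auto
    then show ?case using sin_prod_cos[of x n] False by (simp add: field_simps)
  qed
  ultimately show ?thesis using Lim_transform_eventually by fastforce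
qed simp

lemma sum_half_powers: "(\<Sum>k=1..n. \<sigma> / 2 ^ Suc k) = \<sigma> / 2 - \<sigma> / 2 ^ Suc n" for \<sigma> :: real
  by (induction n) (auto simp: field_simps)

text \<open>Each factor of Viete's product for \<open>sinc\<close> shifts the spectrum by \<open>\<plusminus> \<sigma> / 2 ^ Suc k\<close>.\<close>

lemma band_limited_sinc:
  assumes "band_limited a b f" "0 \<le> \<sigma>"
  shows "band_limited (a - \<sigma> / 2) (b + \<sigma> / 2) (\<lambda>t. of_real (sinc (pi * \<sigma> * t)) * f t)"
proof -
  obtain B where B: "\<And>t. norm (f t) \<le> B"
    using assms(1) by (auto simp: band_limited_def bounded_iff)
  define P where "P n t = (\<Prod>k=1..n. cos (pi * \<sigma> * t / 2 ^ k))" for n :: nat and t :: real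
  have P1: "\<bar>P n t\<bar> \<le> 1" for n t
    unfolding P_def abs_prod by (intro prod_le_1) auto
  have bl: "band_limited (a - (\<Sum>k=1..n. \<sigma> / 2 ^ Suc k)) (b + (\<Sum>k=1..n. \<sigma> / 2 ^ Suc k)) (\<lambda>t. of_real (P n t) * f t)" for n
  proof (induction n)
    case 0
    then show ?case using assms by (simp add: P_def)
  next
    case (Suc n)
    \<comment> \<open>The new factor is a cosine of frequency \<sigma> / 2^(n+2), which widens the
      band by just the next term of the sum.\<close>
    have "2 * pi * (\<sigma> / 2 ^ Suc (Suc n)) * t = pi * \<sigma> * t / 2 ^ Suc n" for t by simp
    with band_limited_cos[OF Suc, of "\<sigma> / 2 ^ Suc (Suc n)"] assms(2)
    show ?case by (simp add: P_def algebra_simps)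
  qed
  have le: "(\<Sum>k=1..n. \<sigma> / 2 ^ Suc k) \<le> \<sigma> / 2" for n
    unfolding sum_half_powers using assms by simp
  show ?thesis
  proof (rule band_limited_limit)
    show "band_limited (a - \<sigma> / 2) (b + \<sigma> / 2) (\<lambda>t. of_real (P n t) * f t)" for n
      using bl[of n] by (rule band_limited_mono) (use le[of n] in linarith)+
    show "norm (of_real (P n t) * f t) \<le> B" for n t
      using mult_mono[OF P1[of n t] B[of t]] by (simp add: norm_mult)
    show "(\<lambda>n. of_real (P n t) * f t) \<longlonglongrightarrow> of_real (sinc (pi * \<sigma> * t)) * f t" for t
      unfolding P_def by (intro tendsto_intros prod_cos_tendsto_sinc)
  qed
qed

section \<open>The interpolation kernel\<close>

lemma abs_sinc_le: "\<bar>sinc x\<bar> \<le> 1" "\<bar>x * sinc x\<bar> \<le> 1"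
  using abs_sin_x_le_abs_x[of x] by (auto simp: divide_le_eq)

text \<open>The factor with \<rho> vanishes at the nonzero points of the lattice of step 1/\<rho>.
  The factor with \<sigma> improves the decay from 1/t to 1/t^2 at the cost of \<sigma> extra
  bandwidth, and \<open>cexp \<omega>\<close> centres the band at \<omega>.\<close>

definition kern :: "real \<Rightarrow> real \<Rightarrow> real \<Rightarrow> real \<Rightarrow> complex" where
  "kern \<omega> \<rho> \<sigma> t = of_real (sinc (pi * \<sigma> * t)) * (of_real (sinc (pi * \<rho> * t)) * cexp \<omega> t)"

lemma band_limited_kern:
  assumes "0 \<le> \<rho>" "0 \<le> \<sigma>"
  shows "band_limited (\<omega> - \<rho> / 2 - \<sigma> / 2) (\<omega> + \<rho> / 2 + \<sigma> / 2) (kern \<omega> \<rho> \<sigma>)"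
  unfolding kern_def[abs_def] using assms by (intro band_limited_sinc band_limited_cexp) auto

lemma kern_0 [simp]: "kern \<omega> \<rho> \<sigma> 0 = 1"
  by (simp add: kern_def)

lemma kern_lattice:
  assumes "0 < \<rho>" "n \<noteq> (0::int)"
  shows "kern \<omega> \<rho> \<sigma> (of_int n / \<rho>) = 0"
  using assms sin_integer_2pi[of n] by (simp add: kern_def sin_zero_iff_int2)

lemma continuous_kern: "continuous_on UNIV (kern \<omega> \<rho> \<sigma>)"
  unfolding kern_def[abs_def]
  by (intro continuous_intros continuous_on_compose2[OF continuous_on_sinc[OF continuous_on_id, of UNIV]]) auto

text \<open>Each \<open>sinc\<close> is bounded by 1 and decays like 1/|t|. Measuring time in
  lattice steps gives the bound the shape that is summed over the integers later.\<close>

lemma kern_bound: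
  assumes "0 < \<rho>" "0 < \<sigma>"
  shows "norm (kern \<omega> \<rho> \<sigma> t) \<le> (1 + \<rho> / \<sigma>) / (1 + (\<rho> * t)\<^sup>2)"
proof -
  have n: "norm (kern \<omega> \<rho> \<sigma> t) = \<bar>sinc (pi * \<sigma> * t)\<bar> * \<bar>sinc (pi * \<rho> * t)\<bar>"
    by (simp only: kern_def norm_mult norm_of_real norm_cis mult_1_right)
  have 1: "norm (kern \<omega> \<rho> \<sigma> t) \<le> 1"
    unfolding n by (intro mult_le_one abs_sinc_le abs_ge_zero)
  have "\<bar>(pi * \<sigma> * t) * sinc (pi * \<sigma> * t)\<bar> * \<bar>(pi * \<rho> * t) * sinc (pi * \<rho> * t)\<bar> \<le> 1 * 1"
    by (intro mult_mono abs_sinc_le) auto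
  moreover have "\<bar>(pi * \<sigma> * t) * sinc (pi * \<sigma> * t)\<bar> * \<bar>(pi * \<rho> * t) * sinc (pi * \<rho> * t)\<bar>
      = pi\<^sup>2 * (\<sigma> * \<rho> * t\<^sup>2) * norm (kern \<omega> \<rho> \<sigma> t)"
  proof -
    have "\<bar>(pi * \<sigma> * t) * u\<bar> * \<bar>(pi * \<rho> * t) * v\<bar> = pi\<^sup>2 * (\<sigma> * \<rho> * t\<^sup>2) * (\<bar>u\<bar> * \<bar>v\<bar>)" for u v
    proof -
      have t: "\<bar>t\<bar> * \<bar>t\<bar> = t\<^sup>2" by (simp add: power2_eq_square)
      have "\<bar>(pi * \<sigma> * t) * u\<bar> = pi * \<sigma> * \<bar>t\<bar> * \<bar>u\<bar>"
        using assms by (simp only: abs_mult) simp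
      moreover have "\<bar>(pi * \<rho> * t) * v\<bar> = pi * \<rho> * \<bar>t\<bar> * \<bar>v\<bar>"
        using assms by (simp only: abs_mult) simp
      ultimately have "\<bar>(pi * \<sigma> * t) * u\<bar> * \<bar>(pi * \<rho> * t) * v\<bar> =
          (pi * pi) * (\<sigma> * \<rho> * (\<bar>t\<bar> * \<bar>t\<bar>)) * (\<bar>u\<bar> * \<bar>v\<bar>)"
        by (simp only: mult_ac)
      then show ?thesis unfolding t power2_eq_square[of pi] .
    qed
    then show ?thesis unfolding n .
  qed
  moreover have "1 \<le> pi\<^sup>2" using pi_ge_two by (simp add: one_le_power)
  then have "1 * (\<sigma> * \<rho> * t\<^sup>2) * norm (kern \<omega> \<rho> \<sigma> t) \<le> pi\<^sup>2 * (\<sigma> * \<rho> * t\<^sup>2) * norm (kern \<omega> \<rho> \<sigma> t)"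
    using assms by (intro mult_right_mono) auto
  ultimately have "\<sigma> * \<rho> * t\<^sup>2 * norm (kern \<omega> \<rho> \<sigma> t) \<le> 1" by simp
  then have "(\<rho> * t)\<^sup>2 * norm (kern \<omega> \<rho> \<sigma> t) \<le> \<rho> / \<sigma>"
    using assms by (simp add: field_simps power2_eq_square)
  with 1 have "(1 + (\<rho> * t)\<^sup>2) * norm (kern \<omega> \<rho> \<sigma> t) \<le> 1 + \<rho> / \<sigma>"
    by (simp add: distrib_right)
  moreover have "0 < 1 + (\<rho> * t)\<^sup>2" by (simp add: add_pos_nonneg)
  ultimately show ?thesis by (simp add: pos_le_divide_eq mult.commute)
qed

text \<open>The primitives found below give integrals over compact intervals only; for an integrable
  function their symmetric limit is the Lebesgue integral over the line.\<close>

lemma lebesgue_integral_eq_0_if_symmetric_limit: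
  fixes q :: "real \<Rightarrow> complex"
  assumes q: "integrable lborel q"
    and J: "\<And>n::nat. (q has_integral J n) {- real n..real n}" "J \<longlonglongrightarrow> 0"
  shows "(LINT t|lborel. q t) = 0"
proof -
  have [measurable]: "q \<in> borel_measurable borel" using q by auto
  have "(\<lambda>n. LINT t|lborel. indicator {- real n..real n} t *\<^sub>R q t) \<longlonglongrightarrow> (LINT t|lborel. q t)"
  proof (rule integral_dominated_convergence[where w="\<lambda>t. norm (q t)"])
    show "AE t in lborel. (\<lambda>n. indicator {- real n..real n} t *\<^sub>R q t) \<longlonglongrightarrow> q t"
    proof (rule AE_I2)
      fix t :: real
      obtain N where "\<bar>t\<bar> \<le> real N" using real_arch_simple by blast
      then have "\<forall>\<^sub>F n in sequentially. q t = indicator {- real n..real n} t *\<^sub>R q t"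
        by (intro eventually_sequentiallyI[of N]) (auto simp: indicator_def abs_le_iff)
      then show "(\<lambda>n. indicator {- real n..real n} t *\<^sub>R q t) \<longlonglongrightarrow> q t"
        using Lim_transform_eventually tendsto_const by fast
    qed
    show "AE t in lborel. norm (indicator {- real n..real n} t *\<^sub>R q t) \<le> norm (q t)" for n
      by (auto simp: indicator_def)
  qed (use q in auto)
  moreover have "(LINT t|lborel. indicator {- real n..real n} t *\<^sub>R q t) = J n" for n
  proof -
    have "set_integrable lborel {- real n..real n} q"
      unfolding set_integrable_def by (intro integrable_mult_indicator q) auto
    then show ?thesis
      using set_borel_integral_eq_integral(2) integral_unique[OF J(1)]
      unfolding set_lebesgue_integral_def by metis
  qed
  ultimately show ?thesis using J(2) LIMSEQ_unique by auto
qed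

section \<open>Fourier transforms of test functions\<close>

lemma integrable_decay:
  fixes q :: "real \<Rightarrow> complex"
  assumes "q \<in> borel_measurable borel" "\<And>t. norm (q t) \<le> A" "\<And>t. t\<^sup>2 * norm (q t) \<le> B"
  shows "integrable lborel q"
proof (rule Bochner_Integration.integrable_bound)
  show "integrable lborel (\<lambda>t::real. (A + B) * inverse (1 + t\<^sup>2))"
    using integrable_inverse_1_plus_square by (intro integrable_mult_right) (simp add: set_integrable_def)
  have "norm (q t) \<le> norm ((A + B) * inverse (1 + t\<^sup>2))" for t
  proof -
    have p: "0 < 1 + t\<^sup>2" by (simp add: add_pos_nonneg)
    have "(1 + t\<^sup>2) * norm (q t) \<le> A + B" using assms(2,3)[of t] by (simp add: distrib_right)
    then have "norm (q t) \<le> (A + B) * inverse (1 + t\<^sup>2)" using p by (simp add: field_simps)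
    then show ?thesis by simp
  qed
  then show "AE t in lborel. norm (q t) \<le> norm ((A + B) * inverse (1 + t\<^sup>2))" by simp
qed (use assms in auto)

lemma cis_has_vector_derivative:
  "((\<lambda>x. cis (\<alpha> * x)) has_vector_derivative (of_real \<alpha> * \<i>) * cis (\<alpha> * x)) (at x within S)"
proof -
  have "((\<lambda>z. exp (\<i> * of_real \<alpha> * z)) has_field_derivative (of_real \<alpha> * \<i>) * exp (\<i> * of_real \<alpha> * of_real x))
    (at (of_real x))"
    by (auto intro!: derivative_eq_intros)
  from has_vector_derivative_real_field[OF this] show ?thesis
    by (simp add: cis_conv_exp mult.assoc o_def)
qed

lemma cexp_has_vector_derivative:
  "((\<lambda>\<xi>. cexp (c * \<xi>) t) has_vector_derivative (2 * pi * c * t * \<i>) * cexp (c * \<xi>) t) (at \<xi> within S)"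
  using cis_has_vector_derivative[of "2 * pi * c * t" \<xi> S] by (simp add: mult_ac)

lemma cexp_has_vector_derivative':
  "((\<lambda>t. cexp \<mu> t) has_vector_derivative (2 * pi * \<mu> * \<i>) * cexp \<mu> t) (at t within S)"
  using cis_has_vector_derivative[of "2 * pi * \<mu>" t S] by simp

text \<open>The boundary terms vanish. Each application trades a derivative of \<open>k\<close> for
  a factor t, which is the source of all decay estimates for transforms.\<close>

lemma fourier_integral_by_parts:
  fixes k k1 :: "real \<Rightarrow> complex"
  assumes k: "\<And>\<xi>. (k has_vector_derivative k1 \<xi>) (at \<xi>)"
    and k1: "continuous_on UNIV k1" and R: "0 \<le> R" "k (- R) = 0" "k R = 0"
  shows "integral {- R..R} (\<lambda>\<xi>. cexp (- \<xi>) t * k1 \<xi>) =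
    (2 * pi * t * \<i>) * integral {- R..R} (\<lambda>\<xi>. cexp (- \<xi>) t * k \<xi>)"
proof -
  have k': "continuous_on S k" for S
    using k by (meson continuous_at_imp_continuous_on has_vector_derivative_continuous)
  have k1': "continuous_on S k1" for S using k1 continuous_on_subset by blast
  have "((\<lambda>\<xi>. cexp (- \<xi>) t * k \<xi>) has_vector_derivative
      cexp (- \<xi>) t * k1 \<xi> + (2 * pi * (- 1) * t * \<i>) * cexp (- \<xi>) t * k \<xi>) (at \<xi> within {- R..R})" for \<xi>
    using has_vector_derivative_mult[OF cexp_has_vector_derivative[of "-1"] has_vector_derivative_at_within[OF k]]
    by simp
  then have "((\<lambda>\<xi>. cexp (- \<xi>) t * k1 \<xi> + (2 * pi * (- 1) * t * \<i>) * cexp (- \<xi>) t * k \<xi>) has_integral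
      cexp (- R) t * k R - cexp (- (- R)) t * k (- R)) {- R..R}"
    using R by (intro fundamental_theorem_of_calculus) auto
  then have "integral {- R..R} (\<lambda>\<xi>. cexp (- \<xi>) t * k1 \<xi> + (2 * pi * (- 1) * t * \<i>) * (cexp (- \<xi>) t * k \<xi>)) = 0"
    using R by (simp add: integral_unique mult.assoc)
  moreover have "integral {- R..R} (\<lambda>\<xi>. cexp (- \<xi>) t * k1 \<xi> + (2 * pi * (- 1) * t * \<i>) * (cexp (- \<xi>) t * k \<xi>))
    = integral {- R..R} (\<lambda>\<xi>. cexp (- \<xi>) t * k1 \<xi>) + (2 * pi * (- 1) * t * \<i>) * integral {- R..R} (\<lambda>\<xi>. cexp (- \<xi>) t * k \<xi>)"
    by (subst integral_add)
      (intro integrable_continuous_interval continuous_intros k' k1' | simp)+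
  ultimately show ?thesis by (simp add: add_eq_0_iff2)
qed

lemma norm_fourier_integral_le:
  assumes "continuous_on UNIV k" "0 \<le> R"
  shows "norm (integral {- R..R} (\<lambda>\<xi>. cexp (- \<xi>) t * k \<xi>)) \<le> integral {- R..R} (\<lambda>\<xi>. norm (k \<xi>))"
proof -
  have k': "continuous_on S k" for S using assms continuous_on_subset by blast
  show ?thesis
    by (intro integral_norm_bound_integral)
      (intro integrable_continuous_interval continuous_intros k' | simp add: norm_mult)+
qed

lemma test_function_derivatives:
  assumes "smooth g"
  obtains g1 g2 where "\<And>\<xi>. (g has_vector_derivative g1 \<xi>) (at \<xi>)"
    "\<And>\<xi>. (g1 has_vector_derivative g2 \<xi>) (at \<xi>)" "continuous_on UNIV g2"
proof -
  let ?D = "\<lambda>h s. vector_derivative h (at s)"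
  have *: "(?D ^^ n) g differentiable (at t)" for n t
    using assms by (simp add: smooth_def)
  have "continuous_on UNIV ((?D ^^ 2) g)"
    using *[of 2] by (meson continuous_at_imp_continuous_on differentiable_imp_continuous_within)
  then show thesis
    using that[of "?D g" "?D (?D g)"] *[of 0] *[of 1]
    by (simp add: vector_derivative_works numeral_2_eq_2)
qed

lemma has_vector_derivative_eq_0_outside:
  assumes "(g has_vector_derivative g1) (at \<xi>)" "closed C" "\<And>x. x \<notin> C \<Longrightarrow> g x = 0" "\<xi> \<notin> C"
  shows "g1 = 0"
proof -
  have "(g has_vector_derivative 0) (at \<xi>)"
    by (rule has_vector_derivative_transform_within_open[where f="\<lambda>_. 0" and S="- C"])
      (use assms in \<open>auto simp: open_Compl\<close>)
  then show ?thesis using assms(1) vector_derivative_unique_at by blast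
qed

text \<open>This is Fourier inversion at a point \<mu> where \<open>g\<close> vanishes: the integral
  ought to be g(\<mu>) = 0. It is proved with an explicit primitive. As \<open>g\<close> vanishes
  near \<mu>, the quotient k = g / (\<xi> - \<mu>) is still C^1 with compact support, and K(t), the
  integral of k against \<open>cexp (\<mu> - \<xi>) t\<close>, has derivative -2 pi i times the
  integrand and tends to 0 at both ends.\<close>

lemma kills_fourier:
  assumes g: "test_function_on U g" and U: "U \<inter> {a..b} = {}"
  shows "kills a b (fourier g)"
proof -
  define C where "C = closure {t. g t \<noteq> 0}"
  have C: "compact C" "closed C" "C \<subseteq> U" "\<And>x. x \<notin> C \<Longrightarrow> g x = 0"
    using g closure_subset[of "{t. g t \<noteq> 0}"] by (auto simp: test_function_on_def C_def)
  obtain g1 g2 where d: "\<And>\<xi>. (g has_vector_derivative g1 \<xi>) (at \<xi>)"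
    "\<And>\<xi>. (g1 has_vector_derivative g2 \<xi>) (at \<xi>)" "continuous_on UNIV g2"
    using g test_function_derivatives[of g] by (auto simp: test_function_on_def)
  have g1_0: "g1 \<xi> = 0" if "\<xi> \<notin> C" for \<xi>
    using has_vector_derivative_eq_0_outside[OF d(1) C(2,4) that] .
  obtain R0 where "\<forall>x\<in>C. norm x \<le> R0"
    using compact_imp_bounded[OF C(1)] by (auto simp: bounded_iff)
  \<comment> \<open>The extra 1 puts both end points strictly outside the support, so that
    \<open>g\<close> and its derivative vanish there.\<close>
  define R where "R = max R0 0 + 1"
  have R: "0 \<le> R" "R \<notin> C" "- R \<notin> C" "x \<in> {- R..R}" if "x \<in> C \<or> x = 0" for x
    using \<open>\<forall>x\<in>C. norm x \<le> R0\<close> that by (force simp: R_def)+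
  have R0: "0 \<le> R" "R \<notin> C" "- R \<notin> C" using R[of 0] by auto
  have cg: "continuous_on S g" "continuous_on S g1" for S
    using d by (meson continuous_at_imp_continuous_on has_vector_derivative_continuous)+
  have four: "fourier g t = integral {- R..R} (\<lambda>\<xi>. cexp (- \<xi>) t * g \<xi>)" for t
  proof -
    have si: "set_integrable lborel {- R..R} (\<lambda>\<xi>. cexp (- \<xi>) t * g \<xi>)"
      by (intro borel_integrable_atLeastAtMost' continuous_intros cg)
    have "exp (- 2 * of_real pi * \<i> * of_real \<xi> * of_real t) * g \<xi>
        = indicator {- R..R} \<xi> *\<^sub>R (cexp (- \<xi>) t * g \<xi>)" for \<xi>
    proof (cases "\<xi> \<in> {- R..R}")
      case True
      then show ?thesis by (simp add: cis_conv_exp mult_ac)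
    next
      case False
      then have "g \<xi> = 0" using R[of \<xi>] C by auto
      then show ?thesis by simp
    qed
    then show ?thesis
      using set_borel_integral_eq_integral(2)[OF si]
      by (simp only: fourier_def set_lebesgue_integral_def)
  qed
  have gR: "g (- R) = 0" "g R = 0" "g1 (- R) = 0" "g1 R = 0" using R0 C g1_0 by auto
  have p1: "integral {- R..R} (\<lambda>\<xi>. cexp (- \<xi>) t * g1 \<xi>) = (2 * pi * t * \<i>) * fourier g t" for t
    unfolding four by (rule fourier_integral_by_parts) (use d cg R0 gR in auto)
  \<comment> \<open>After two integrations by parts t^2 times the transform is bounded, which makes
    the transform integrable.\<close>
  have p2: "integral {- R..R} (\<lambda>\<xi>. cexp (- \<xi>) t * g2 \<xi>) = (2 * pi * t * \<i>) * ((2 * pi * t * \<i>) * fourier g t)" for t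
    unfolding p1[symmetric] by (rule fourier_integral_by_parts) (use d cg R0 gR in auto)
  have contF: "continuous_on UNIV (fourier g)"
  proof -
    have "continuous_on UNIV (\<lambda>t. integral (cbox (- R) R) (\<lambda>\<xi>. cexp (- \<xi>) t * g \<xi>))"
      by (rule integral_continuous_on_param)
        (auto simp: split_beta intro!: continuous_intros continuous_on_compose2[OF cg(1)[of UNIV]])
    then show ?thesis unfolding four[abs_def] by simp
  qed
  have int: "integrable lborel (fourier g)"
  proof (rule integrable_decay)
    show "fourier g \<in> borel_measurable borel" by (intro borel_measurable_continuous_onI contF)
    show "norm (fourier g t) \<le> integral {- R..R} (\<lambda>\<xi>. norm (g \<xi>))" for t
      unfolding four by (intro norm_fourier_integral_le cg R0)
    show "t\<^sup>2 * norm (fourier g t) \<le> integral {- R..R} (\<lambda>\<xi>. norm (g2 \<xi>))" for t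
    proof -
      have "1 \<le> (2 * pi)\<^sup>2" using pi_gt_zero pi_ge_two by (intro one_le_power) auto
      then have "1 * (t\<^sup>2 * norm (fourier g t)) \<le> (2 * pi)\<^sup>2 * (t\<^sup>2 * norm (fourier g t))"
        by (rule mult_right_mono) auto
      also have "\<dots> = norm ((2 * pi * t * \<i>) * ((2 * pi * t * \<i>) * fourier g t))"
      proof -
        have n: "norm (of_real (2 * pi * t) * \<i>) = 2 * pi * \<bar>t\<bar>" by (simp add: norm_mult abs_mult)
        have "(2 * pi * \<bar>t\<bar>) * ((2 * pi * \<bar>t\<bar>) * x) = (2 * pi)\<^sup>2 * ((\<bar>t\<bar> * \<bar>t\<bar>) * x)" for x
          by (simp only: power2_eq_square mult_ac)
        then show ?thesis
          by (simp only: norm_mult[of "of_real (2 * pi * t) * \<i>"] n) (simp add: power2_eq_square)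
      qed
      also have "\<dots> \<le> integral {- R..R} (\<lambda>\<xi>. norm (g2 \<xi>))"
        unfolding p2[symmetric] by (intro norm_fourier_integral_le d R0)
      finally show ?thesis by simp
    qed
  qed
  moreover have "(LINT t|lborel. cexp \<mu> t * fourier g t) = 0" if "\<mu> \<in> {a..b}" for \<mu>
  proof (rule lebesgue_integral_eq_0_if_symmetric_limit)
    have \<mu>: "\<mu> \<notin> C" using that U C by auto
    \<comment> \<open>At \<xi> = \<mu> the convention inverse 0 = 0 gives the right values, because
      \<open>g\<close> and \<open>g1\<close> vanish in a neighbourhood of \<mu>.\<close>
    define k where "k \<xi> = inverse (\<xi> - \<mu>) *\<^sub>R g \<xi>" for \<xi>
    define k1 where "k1 \<xi> = inverse (\<xi> - \<mu>) *\<^sub>R g1 \<xi> + (- (inverse (\<xi> - \<mu>))\<^sup>2) *\<^sub>R g \<xi>" for \<xi>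
    have k0: "k \<xi> = 0" "k1 \<xi> = 0" if "\<xi> \<notin> C" for \<xi>
      using that C g1_0 by (auto simp: k_def k1_def)
    have dk: "(k has_vector_derivative k1 \<xi>) (at \<xi>)" for \<xi>
    proof (cases "\<xi> = \<mu>")
      case False
      then show ?thesis
        unfolding k_def[abs_def] k1_def
        by (intro has_vector_derivative_scaleR d) (auto intro!: derivative_eq_intros simp: power2_eq_square)
    next
      case True
      have "(k has_vector_derivative 0) (at \<mu>)"
        by (rule has_vector_derivative_transform_within_open[where f="\<lambda>_. 0" and S="- C"])
          (use \<mu> C k0 in \<open>auto simp: open_Compl\<close>)
      then show ?thesis using True k0 \<mu> by simp
    qed
    have ck1: "continuous_on UNIV k1"
    proof -
      have "continuous_on ((- {\<mu>}) \<union> (- C)) k1"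
      proof (rule continuous_on_open_Un)
        show "continuous_on (- {\<mu>}) k1"
          unfolding k1_def[abs_def] by (intro continuous_intros cg) auto
        show "continuous_on (- C) k1"
          by (rule continuous_on_eq[where f="\<lambda>_. 0"]) (use k0 in auto)
      qed (use C in auto)
      moreover have "(- {\<mu>}) \<union> (- C) = UNIV" using \<mu> by auto
      ultimately show ?thesis by simp
    qed
    have ck: "continuous_on S k" for S
      using dk by (meson continuous_at_imp_continuous_on has_vector_derivative_continuous)
    define K where "K t = integral {- R..R} (\<lambda>\<xi>. cexp (\<mu> - \<xi>) t * k \<xi>)" for t
    have Keq: "K t = cexp \<mu> t * integral {- R..R} (\<lambda>\<xi>. cexp (- \<xi>) t * k \<xi>)" for t
    proof -
      have "cexp (\<mu> - \<xi>) t * k \<xi> = cexp \<mu> t * (cexp (- \<xi>) t * k \<xi>)" for \<xi>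
        using cexp_add[of \<mu> "- \<xi>" t] by simp
      then show ?thesis unfolding K_def by (simp only: integral_mult_right)
    qed
    define Q where "Q = integral {- R..R} (\<lambda>\<xi>. norm (k1 \<xi>))"
    have Kb: "norm (K t) * (2 * pi * \<bar>t\<bar>) \<le> Q" for t
    proof -
      have "norm (integral {- R..R} (\<lambda>\<xi>. cexp (- \<xi>) t * k1 \<xi>)) \<le> Q"
        unfolding Q_def by (intro norm_fourier_integral_le ck1 R0)
      also have "integral {- R..R} (\<lambda>\<xi>. cexp (- \<xi>) t * k1 \<xi>) = (2 * pi * t * \<i>) * integral {- R..R} (\<lambda>\<xi>. cexp (- \<xi>) t * k \<xi>)"
        by (rule fourier_integral_by_parts) (use dk ck1 R0 k0 in auto)
      finally show ?thesis unfolding Keq by (simp add: norm_mult mult_ac)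
    qed
    have dK: "(K has_vector_derivative - (2 * pi * \<i>) * (cexp \<mu> t * fourier g t)) (at t)" for t
    proof -
      have eq: "cexp (\<mu> - \<xi>) t * g \<xi> = cexp \<mu> t * (cexp (- \<xi>) t * g \<xi>)" for \<xi>
        using cexp_add[of \<mu> "- \<xi>" t] by simp
      have kg: "of_real (\<mu> - \<xi>) * k \<xi> = - g \<xi>" for \<xi>
        using C(4)[OF \<mu>] by (cases "\<xi> = \<mu>") (auto simp: k_def scaleR_conv_of_real field_simps)
      have "((\<lambda>t. integral (cbox (- R) R) (\<lambda>\<xi>. cexp (\<mu> - \<xi>) t * k \<xi>)) has_vector_derivative
         integral (cbox (- R) R) (\<lambda>\<xi>. - (2 * pi * \<i>) * (cexp (\<mu> - \<xi>) t * g \<xi>))) (at t within UNIV)"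
      proof (rule leibniz_rule_vector_derivative)
        show "((\<lambda>t. cexp (\<mu> - \<xi>) t * k \<xi>) has_vector_derivative - (2 * pi * \<i>) * (cexp (\<mu> - \<xi>) t * g \<xi>)) (at t within UNIV)" for t \<xi>
        proof -
          have "((\<lambda>t. cexp (\<mu> - \<xi>) t * k \<xi>) has_vector_derivative (2 * pi * (\<mu> - \<xi>) * \<i>) * cexp (\<mu> - \<xi>) t * k \<xi>) (at t within UNIV)"
            by (intro has_vector_derivative_mult_left cexp_has_vector_derivative')
          also have "(2 * pi * (\<mu> - \<xi>) * \<i>) * cexp (\<mu> - \<xi>) t * k \<xi> = (2 * pi * \<i>) * (cexp (\<mu> - \<xi>) t * (of_real (\<mu> - \<xi>) * k \<xi>))"
            by (simp add: mult_ac)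
          finally show ?thesis unfolding kg by simp
        qed
        show "(\<lambda>\<xi>. cexp (\<mu> - \<xi>) t * k \<xi>) integrable_on cbox (- R) R" for t
          unfolding cbox_interval by (intro integrable_continuous_interval continuous_intros ck)
        show "continuous_on (UNIV \<times> cbox (- R) R) (\<lambda>(t, \<xi>). - (2 * pi * \<i>) * (cexp (\<mu> - \<xi>) t * g \<xi>))"
          by (auto simp: split_beta intro!: continuous_intros continuous_on_compose2[OF cg(1)[of UNIV]])
      qed auto
      also have "integral (cbox (- R) R) (\<lambda>\<xi>. - (2 * pi * \<i>) * (cexp (\<mu> - \<xi>) t * g \<xi>))
         = - (2 * pi * \<i>) * (cexp \<mu> t * fourier g t)"
        unfolding four eq cbox_interval by (simp only: integral_mult_right)
      finally show ?thesis unfolding K_def[abs_def] by simp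
    qed
    show "integrable lborel (\<lambda>t. cexp \<mu> t * fourier g t)"
      by (intro integrable_bounded_mult int borel_measurable_continuous_onI continuous_intros)
        (auto intro: boundedI[where B=1])
    define J where "J n = - (1 / (2 * pi * \<i>)) * (K (real n) - K (- real n))" for n
    show "((\<lambda>t. cexp \<mu> t * fourier g t) has_integral J n) {- real n..real n}" for n
    proof -
      have "((\<lambda>t. - (2 * pi * \<i>) * (cexp \<mu> t * fourier g t)) has_integral K (real n) - K (- real n)) {- real n..real n}"
        by (intro fundamental_theorem_of_calculus has_vector_derivative_at_within[OF dK]) auto
      from has_integral_mult_right[OF this, of "- (1 / (2 * pi * \<i>))"] show ?thesis
        by (simp add: J_def)
    qed
    have "(\<lambda>n. K (s * real n)) \<longlonglongrightarrow> 0" if s: "\<bar>s\<bar> = 1" for s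
    proof (rule Lim_null_comparison)
      show "\<forall>\<^sub>F n in sequentially. norm (K (s * real n)) \<le> Q / (2 * pi) * inverse (real n)"
        using eventually_gt_at_top[of 0]
      proof eventually_elim
        case (elim n)
        have "norm (K (s * real n)) * (2 * pi * real n) \<le> Q"
          using Kb[of "s * real n"] s by (simp add: abs_mult)
        then show ?case using elim by (simp add: field_simps)
      qed
      show "(\<lambda>n. Q / (2 * pi) * inverse (real n)) \<longlonglongrightarrow> 0"
        by (intro tendsto_mult_right_zero lim_inverse_n)
    qed
    from this[of 1] this[of "-1"] show "J \<longlonglongrightarrow> 0"
      unfolding J_def[abs_def] by (intro tendsto_mult_right_zero) (auto intro: tendsto_diff[of _ 0 _ _ 0, simplified])
  qed
  ultimately show ?thesis by (auto simp: kills_def)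
qed

text \<open>Test functions supported off [a, b] have transforms that kill [a, b], so the
  distributional transform of \<open>f\<close> vanishes on the open complement of the band.\<close>

lemma band_limited_imp_V:
  assumes "band_limited a b (apply_bcontfun f)"
  shows "f \<in> V a b"
proof -
  have "dist_fourier (dist_of_fun (apply_bcontfun f)) g = 0" if "test_function_on (- {a..b}) g" for g
    using assms kills_fourier[OF that] by (auto simp: dist_fourier_def dist_of_fun_def band_limited_def)
  then have "- {a..b} \<subseteq> - dist_support (dist_fourier (dist_of_fun (apply_bcontfun f)))"
    unfolding dist_support_def by (auto intro!: exI[of _ "- {a..b}"] simp: open_Compl)
  then show ?thesis unfolding V_def by auto
qed

section \<open>The Fejer kernel\<close>

text \<open>Unnormalised: the Fourier transform is a triangle over [-\<delta>, \<delta>], nonzero at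
  0 and zero from |\<nu>| = \<delta> on.\<close>

definition fejer :: "real \<Rightarrow> real \<Rightarrow> complex" where
  "fejer \<delta> t = of_real ((sinc (pi * \<delta> * t))\<^sup>2)"

lemma continuous_sinc_mult: "continuous_on S (\<lambda>t. sinc (c * t))"
  by (intro continuous_on_compose2[OF continuous_on_sinc[OF continuous_on_id, of UNIV]] continuous_intros) auto

lemma continuous_fejer: "continuous_on S (fejer \<delta>)"
  unfolding fejer_def[abs_def] by (intro continuous_intros continuous_sinc_mult)

lemma integrable_fejer:
  assumes "0 < \<delta>"
  shows "integrable lborel (fejer \<delta>)"
proof (rule integrable_decay)
  show "fejer \<delta> \<in> borel_measurable borel"
    by (intro borel_measurable_continuous_onI continuous_fejer)
  have n: "norm (fejer \<delta> t) = \<bar>sinc (pi * \<delta> * t)\<bar>\<^sup>2" for t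
    unfolding fejer_def norm_of_real by (simp only: power2_abs abs_power2)
  show "norm (fejer \<delta> t) \<le> 1" for t
    unfolding n by (intro power_le_one abs_sinc_le) auto
  show "t\<^sup>2 * norm (fejer \<delta> t) \<le> 1 / (pi * \<delta>)\<^sup>2" for t
  proof -
    have "\<bar>(pi * \<delta> * t) * sinc (pi * \<delta> * t)\<bar>\<^sup>2 \<le> 1"
      by (intro power_le_one abs_sinc_le) auto
    then have "(pi * \<delta>)\<^sup>2 * (t\<^sup>2 * norm (fejer \<delta> t)) \<le> 1"
      unfolding n by (simp only: abs_mult power_mult_distrib power2_abs mult.assoc)
    then show ?thesis using assms by (simp add: pos_le_divide_eq mult.commute)
  qed
qed

text \<open>A nonnegative continuous function with integral 0 is nonzero at most on an open null
  set, which is empty; but the value at 0 is 1.\<close>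

lemma integral_fejer_nonzero:
  assumes "0 < \<delta>"
  shows "(LINT t|lborel. fejer \<delta> t) \<noteq> 0"
proof
  let ?f = "\<lambda>t. (sinc (pi * \<delta> * t))\<^sup>2"
  assume "(LINT t|lborel. fejer \<delta> t) = 0"
  then have "(LINT t|lborel. ?f t) = 0"
    unfolding fejer_def integral_complex_of_real by simp
  moreover have int: "integrable lborel ?f"
    using integrable_fejer[OF assms] unfolding fejer_def[abs_def] by (simp only: complex_of_real_integrable_eq)
  ultimately have "AE t in lborel. ?f t = 0"
    by (subst (asm) integral_nonneg_eq_0_iff_AE) auto
  then have ae: "AE t in lborel. ?f t = 0" .
  have "continuous_on UNIV ?f"
    by (intro continuous_intros continuous_sinc_mult)
  then have o: "open {t. ?f t \<noteq> 0}"
    by (intro open_Collect_neq) (auto intro: continuous_on_const)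
  then have "{t. ?f t \<noteq> 0} \<in> null_sets lborel"
    using AE_iff_null[of lborel "\<lambda>t. ?f t = 0"] ae by auto
  then have "negligible {t. ?f t \<noteq> 0}"
    unfolding negligible_iff_null_sets by (rule null_sets_completionI)
  then have "{t. ?f t \<noteq> 0} = {}"
    using open_not_negligible[OF o] by blast
  then have "?f 0 = 0" by blast
  then show False by simp
qed

text \<open>Integration by parts reduces the integral over \<open>{- T..T}\<close> to sine integrals, whose
  limits cancel since \<open>2 * \<nu> = (\<nu> + \<delta>) + (\<nu> - \<delta>)\<close>.\<close>

lemma fejer_cos_integral:
  assumes "0 < \<delta>" "\<delta> \<le> \<nu>"
  obtains J where "\<And>n::nat. ((\<lambda>t. cos (2 * pi * \<nu> * t) * (sinc (pi * \<delta> * t))\<^sup>2) has_integral J n) {- real n..real n}"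
    "J \<longlonglongrightarrow> 0"
proof -
  \<comment> \<open>The integrand is N t / (pi \<delta> t)^2. Expanding N into cosines makes its
    derivative N1 a sum of sines, so that N1 t / t has a primitive in terms of
    \<open>Si\<close>.\<close>
  define N where "N t = (sin (pi * \<delta> * t))\<^sup>2 * cos (2 * pi * \<nu> * t)" for t
  have N: "N t = cos (2 * pi * \<nu> * t) / 2 - cos (2 * pi * (\<nu> + \<delta>) * t) / 4 - cos (2 * pi * (\<nu> - \<delta>) * t) / 4" for t
  proof -
    have *: "2 * pi * (\<nu> + \<delta>) * t = 2 * pi * \<nu> * t + 2 * (pi * \<delta> * t)"
      "2 * pi * (\<nu> - \<delta>) * t = 2 * pi * \<nu> * t - 2 * (pi * \<delta> * t)" by (simp_all add: algebra_simps)
    show ?thesis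
      unfolding N_def * cos_add cos_diff cos_double_sin by (simp add: field_simps)
  qed
  define N1 where "N1 t = - pi * \<nu> * sin (2 * pi * \<nu> * t) + (pi / 2) * (\<nu> + \<delta>) * sin (2 * pi * (\<nu> + \<delta>) * t)
    + (pi / 2) * (\<nu> - \<delta>) * sin (2 * pi * (\<nu> - \<delta>) * t)" for t
  have dN: "(N has_real_derivative N1 t) (at t)" for t
    unfolding N[abs_def] N1_def by (auto intro!: derivative_eq_intros simp: field_simps)
  define S where "S t = - pi * \<nu> * Si (2 * pi * \<nu> * t) + (pi / 2) * (\<nu> + \<delta>) * Si (2 * pi * (\<nu> + \<delta>) * t)
    + (pi / 2) * (\<nu> - \<delta>) * Si (2 * pi * (\<nu> - \<delta>) * t)" for t
  have dSi: "((\<lambda>t. Si (c * t)) has_real_derivative c * sinc (c * t)) (at t)" for c t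
    by (rule DERIV_cong[OF DERIV_chain2[OF DERIV_Si DERIV_cmult_Id]]) (rule mult.commute)
  have dS: "(S has_real_derivative N1 t / t) (at t)" if "t \<noteq> 0" for t
  proof -
    have "(S has_real_derivative - pi * \<nu> * (2 * pi * \<nu> * sinc (2 * pi * \<nu> * t)) + (pi / 2) * (\<nu> + \<delta>) * (2 * pi * (\<nu> + \<delta>) * sinc (2 * pi * (\<nu> + \<delta>) * t))
    + (pi / 2) * (\<nu> - \<delta>) * (2 * pi * (\<nu> - \<delta>) * sinc (2 * pi * (\<nu> - \<delta>) * t))) (at t)"
      unfolding S_def[abs_def] by (intro DERIV_add DERIV_cmult dSi)
    moreover have "c * sinc (c * t) = sin (c * t) / t" for c using that by simp
    ultimately show ?thesis
      unfolding N1_def by (simp only: add_divide_distrib times_divide_eq_right)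
  qed
  \<comment> \<open>The boundary term N t / t of the integration by parts, written with
    \<open>sinc\<close> so that it is continuous at 0.\<close>
  define W where "W t = pi * \<delta> * sinc (pi * \<delta> * t) * sin (pi * \<delta> * t) * cos (2 * pi * \<nu> * t)" for t
  have W: "W t = N t / t" if "t \<noteq> 0" for t
    using that assms(1) by (simp add: W_def N_def power2_eq_square)
  define H where "H t = (1 / (pi * \<delta>)\<^sup>2) * (S t - W t)" for t
  have dH: "(H has_real_derivative cos (2 * pi * \<nu> * t) * (sinc (pi * \<delta> * t))\<^sup>2) (at t)" if "t \<noteq> 0" for t
  proof -
    have "((\<lambda>t. (1 / (pi * \<delta>)\<^sup>2) * (S t - N t / t)) has_real_derivative (1 / (pi * \<delta>)\<^sup>2) * (N1 t / t - (N1 t * t - N t * 1) / (t * t))) (at t)"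
      by (intro DERIV_cmult DERIV_diff DERIV_divide dS dN DERIV_ident that)
    moreover have "(1 / (pi * \<delta>)\<^sup>2) * (N1 t / t - (N1 t * t - N t * 1) / (t * t)) = cos (2 * pi * \<nu> * t) * (sinc (pi * \<delta> * t))\<^sup>2"
      using that assms(1) by (simp add: N_def field_simps power2_eq_square)
    ultimately have *: "((\<lambda>t. (1 / (pi * \<delta>)\<^sup>2) * (S t - N t / t)) has_real_derivative cos (2 * pi * \<nu> * t) * (sinc (pi * \<delta> * t))\<^sup>2) (at t)"
      by simp
    show ?thesis
      by (rule has_field_derivative_transform_within_open[OF *, of "- {0}"]) (use that W in \<open>auto simp: H_def\<close>)
  qed
  have cS: "continuous_on UNIV S"
    unfolding S_def[abs_def]
    by (intro continuous_intros continuous_on_compose2[OF continuous_at_imp_continuous_on, of UNIV Si]) (auto simp: isCont_Si)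
  have cW: "continuous_on UNIV W"
    unfolding W_def[abs_def] by (intro continuous_intros continuous_sinc_mult)
  define J where "J n = H (real n) - H (- real n)" for n
  have "((\<lambda>t. cos (2 * pi * \<nu> * t) * (sinc (pi * \<delta> * t))\<^sup>2) has_integral J n) {- real n..real n}" for n
    unfolding J_def
  proof (rule fundamental_theorem_of_calculus_interior_strong[of "{0}"])
    show "continuous_on {- real n..real n} H"
      unfolding H_def[abs_def] by (intro continuous_intros continuous_on_subset[OF cS] continuous_on_subset[OF cW]) auto
    show "(H has_vector_derivative cos (2 * pi * \<nu> * t) * (sinc (pi * \<delta> * t))\<^sup>2) (at t)"
      if "t \<in> {- real n<..<real n} - {0}" for t
      using dH that by (auto simp: has_real_derivative_iff_has_vector_derivative)
  qed auto
  moreover have "J \<longlonglongrightarrow> 0"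
  proof -
    have SiT: "(\<lambda>n. Si (c * real n)) \<longlonglongrightarrow> pi / 2" if "0 < c" for c
      by (rule filterlim_compose[OF Si_at_top])
        (intro filterlim_tendsto_pos_mult_at_top[OF tendsto_const that] filterlim_real_sequentially)
    \<comment> \<open>The coefficient 0 occurs at \<nu> = \<delta>. There the argument of
      \<open>Si\<close> is constantly 0 and \<open>Si\<close> does not approach pi / 2; the factor
      \<open>c\<close> repairs this.\<close>
    have SiT': "(\<lambda>n. c * Si (2 * pi * c * real n)) \<longlonglongrightarrow> c * (pi / 2)" if "0 \<le> c" for c
    proof (cases "c = 0")
      case False
      then show ?thesis using that by (intro tendsto_mult tendsto_const SiT) simp
    qed simp
    have "(\<lambda>n. - pi * (\<nu> * Si (2 * pi * \<nu> * real n)) + (pi / 2) * ((\<nu> + \<delta>) * Si (2 * pi * (\<nu> + \<delta>) * real n))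
      + (pi / 2) * ((\<nu> - \<delta>) * Si (2 * pi * (\<nu> - \<delta>) * real n))) \<longlonglongrightarrow>
      - pi * (\<nu> * (pi / 2)) + (pi / 2) * ((\<nu> + \<delta>) * (pi / 2)) + (pi / 2) * ((\<nu> - \<delta>) * (pi / 2))"
      using assms by (intro tendsto_intros SiT') auto
    moreover have "- pi * (\<nu> * (pi / 2)) + (pi / 2) * ((\<nu> + \<delta>) * (pi / 2)) + (pi / 2) * ((\<nu> - \<delta>) * (pi / 2)) = 0"
      by (simp add: field_simps)
    ultimately have S0: "(\<lambda>n. S (real n)) \<longlonglongrightarrow> 0"
      unfolding S_def by (simp only: mult.assoc)
    have Si_minus: "Si (- x) = - Si x" for x
      using Si_neg[of x] Si_neg[of "- x"] by (cases "0 \<le> x") auto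
    have Sodd: "S (- real n) = - S (real n)" for n
      unfolding S_def mult_minus_right Si_minus by simp
    have W0: "(\<lambda>n. W (s * real n)) \<longlonglongrightarrow> 0" if s: "\<bar>s\<bar> = 1" for s
    proof (rule Lim_null_comparison)
      show "\<forall>\<^sub>F n in sequentially. norm (W (s * real n)) \<le> 1 * inverse (real n)"
        using eventually_gt_at_top[of 0]
      proof eventually_elim
        case (elim n)
        have "\<bar>N t\<bar> \<le> 1" for t
          unfolding N_def abs_mult by (intro mult_le_one) (auto simp: power_le_one abs_square_le_1)
        moreover have "s \<noteq> 0" using s by auto
        ultimately show ?case using elim s by (subst W) (auto simp: abs_mult abs_divide divide_inverse intro: mult_right_mono)
      qed
      show "(\<lambda>n. 1 * inverse (real n)) \<longlonglongrightarrow> 0" by (intro tendsto_mult_right_zero lim_inverse_n)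
    qed
    have lim: "(\<lambda>n. (1 / (pi * \<delta>)\<^sup>2) * (2 * S (real n) - W (1 * real n) + W (- 1 * real n))) \<longlonglongrightarrow> (1 / (pi * \<delta>)\<^sup>2) * (2 * 0 - 0 + 0)"
      by (intro tendsto_intros S0 W0) auto
    have alg: "k * (s - w) - k * (- s - w') = k * (2 * s - w + w')" for k s w w' :: real
      by (simp add: algebra_simps)
    show ?thesis using lim unfolding J_def H_def Sodd alg by simp
  qed
  ultimately show thesis by (rule that)
qed

text \<open>The cosine part is the preceding integral, the sine part vanishes by oddness.\<close>

lemma cexp_fejer_integral:
  assumes "0 < \<delta>" "\<delta> \<le> \<bar>\<nu>\<bar>"
  shows "(LINT t|lborel. cexp \<nu> t * fejer \<delta> t) = 0"
proof -
  obtain J where J: "\<And>n::nat. ((\<lambda>t. cos (2 * pi * \<bar>\<nu>\<bar> * t) * (sinc (pi * \<delta> * t))\<^sup>2) has_integral J n) {- real n..real n}"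
    "J \<longlonglongrightarrow> 0"
    using fejer_cos_integral[OF assms] by blast
  have co: "cos (2 * pi * \<bar>\<nu>\<bar> * t) = cos (2 * pi * \<nu> * t)" for t
    by (cases "0 \<le> \<nu>") (auto simp: abs_if)
  have int: "integrable lborel (\<lambda>t. c t * fejer \<delta> t)" if "continuous_on UNIV c" "\<And>t. norm (c t) \<le> 1" for c :: "real \<Rightarrow> complex"
    using that by (intro integrable_bounded_mult integrable_fejer assms borel_measurable_continuous_onI)
      (auto intro: boundedI[where B=1])
  have i1: "integrable lborel (\<lambda>t. of_real (cos (2 * pi * \<nu> * t)) * fejer \<delta> t)"
    by (intro int continuous_intros) auto
  have i2: "integrable lborel (\<lambda>t. of_real (sin (2 * pi * \<nu> * t)) * fejer \<delta> t)"
    by (intro int continuous_intros) auto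
  have z1: "(LINT t|lborel. of_real (cos (2 * pi * \<nu> * t)) * fejer \<delta> t) = 0"
  proof (rule lebesgue_integral_eq_0_if_symmetric_limit[OF i1])
    show "((\<lambda>t. of_real (cos (2 * pi * \<nu> * t)) * fejer \<delta> t) has_integral of_real (J n)) {- real n..real n}" for n
      using has_integral_of_real[OF J(1)] unfolding co fejer_def by (simp only: of_real_mult)
    show "(\<lambda>n. complex_of_real (J n)) \<longlonglongrightarrow> 0" using tendsto_of_real[OF J(2)] by simp
  qed
  have "(LINT t|lborel. of_real (sin (2 * pi * \<nu> * t)) * fejer \<delta> t)
      = (LINT t|lborel. of_real (sin (2 * pi * \<nu> * (- t))) * fejer \<delta> (- t))"
    using lborel_integral_real_affine[of "-1" "\<lambda>t. of_real (sin (2 * pi * \<nu> * t)) * fejer \<delta> t" 0] by simp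
  also have "\<dots> = - (LINT t|lborel. of_real (sin (2 * pi * \<nu> * t)) * fejer \<delta> t)"
  proof -
    have "fejer \<delta> (- t) = fejer \<delta> t" for t
      unfolding fejer_def mult_minus_right sinc_neg ..
    then show ?thesis by simp
  qed
  finally have z2: "(LINT t|lborel. of_real (sin (2 * pi * \<nu> * t)) * fejer \<delta> t) = 0" by simp
  have "cexp \<nu> t * fejer \<delta> t = of_real (cos (2 * pi * \<nu> * t)) * fejer \<delta> t + \<i> * (of_real (sin (2 * pi * \<nu> * t)) * fejer \<delta> t)" for t
  proof -
    have "cexp \<nu> t = of_real (cos (2 * pi * \<nu> * t)) + \<i> * of_real (sin (2 * pi * \<nu> * t))"
      by (simp add: complex_eq_iff)
    then show ?thesis by (simp only: distrib_right mult.assoc)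
  qed
  then show ?thesis using i1 i2 z1 z2 by simp
qed

text \<open>A functional that reads off the coefficient of \<open>cexp \<kappa>\<close>.\<close>

definition probe :: "real \<Rightarrow> real \<Rightarrow> real \<Rightarrow> complex" where
  "probe \<kappa> \<delta> t = cexp (- \<kappa>) t * fejer \<delta> t"

lemma integrable_probe: "0 < \<delta> \<Longrightarrow> integrable lborel (probe \<kappa> \<delta>)"
  unfolding probe_def[abs_def]
  by (intro integrable_bounded_mult integrable_fejer borel_measurable_continuous_onI continuous_intros)
    (auto intro: boundedI[where B=1])

lemma integral_cexp_probe:
  assumes "0 < \<delta>"
  shows "\<delta> \<le> \<bar>\<mu> - \<kappa>\<bar> \<Longrightarrow> (LINT t|lborel. cexp \<mu> t * probe \<kappa> \<delta> t) = 0"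
    and "(LINT t|lborel. cexp \<kappa> t * probe \<kappa> \<delta> t) \<noteq> 0"
proof -
  have *: "cexp \<mu> t * probe \<kappa> \<delta> t = cexp (\<mu> - \<kappa>) t * fejer \<delta> t" for \<mu> t
    using cexp_add[of \<mu> "- \<kappa>" t] by (simp add: probe_def)
  show "\<delta> \<le> \<bar>\<mu> - \<kappa>\<bar> \<Longrightarrow> (LINT t|lborel. cexp \<mu> t * probe \<kappa> \<delta> t) = 0"
    unfolding * by (rule cexp_fejer_integral[OF assms])
  show "(LINT t|lborel. cexp \<kappa> t * probe \<kappa> \<delta> t) \<noteq> 0"
    unfolding * using integral_fejer_nonzero[OF assms] by simp
qed

section \<open>Covering dimension of products\<close>

text \<open>Frechet's embedding: a point is sent to its distances from a dense sequence. It moves an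
  abstract compact metric space into a type of class \<open>metric_space\<close>, where compactness
  and continuity are stated for sets.\<close>

lemma isometric_embedding:
  assumes "compact_space (mtopology_of m)"
  obtains e :: "'a \<Rightarrow> nat \<Rightarrow>\<^sub>C real"
  where "\<And>x y. x \<in> mspace m \<Longrightarrow> y \<in> mspace m \<Longrightarrow> dist (e x) (e y) = mdist m x y"
proof (cases "mspace m = {}")
  case True
  then show ?thesis using that by auto
next
  case False
  interpret M: Metric_space "mspace m" "mdist m" by simp
  have comp: "compactin M.mtopology (mspace m)"
    using assms by (simp add: mtopology_of_def compact_space_def)
  obtain B where B: "\<And>x y. x \<in> mspace m \<Longrightarrow> y \<in> mspace m \<Longrightarrow> mdist m x y \<le> B"
    using M.compactin_imp_mbounded[OF comp] unfolding M.mbounded_alt by blast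
  have "M.mtotally_bounded (mspace m)" using M.compactin_imp_mtotally_bounded[OF comp] .
  then have "\<forall>n. \<exists>K. finite K \<and> K \<subseteq> mspace m \<and> mspace m \<subseteq> (\<Union>x\<in>K. M.mball x (1 / Suc n))"
    unfolding M.mtotally_bounded_def by simp
  then obtain K where K: "\<And>n. finite (K n)" "\<And>n. K n \<subseteq> mspace m" "\<And>n. mspace m \<subseteq> (\<Union>x\<in>K n. M.mball x (1 / Suc n))"
    by metis
  \<comment> \<open>A union of finite 1/(n+1)-nets is countable and dense.\<close>
  define D where "D = (\<Union>n. K n)"
  have "countable D" unfolding D_def using K(1) by (auto intro: countable_finite)
  moreover have "D \<noteq> {}" using K(3)[of 0] False by (auto simp: D_def)
  ultimately have r: "range (from_nat_into D) = D" by simp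
  define a where "a = from_nat_into D"
  have a: "a n \<in> mspace m" for n using r K(2) unfolding a_def D_def by blast
  define e where "e x = Bcontfun (\<lambda>n. mdist m x (a n))" for x
  have e: "apply_bcontfun (e x) n = mdist m x (a n)" if "x \<in> mspace m" for x n
  proof -
    have "(\<lambda>n. mdist m x (a n)) \<in> bcontfun"
      unfolding bcontfun_def using B[OF that a] by (auto intro!: boundedI[where B=B])
    then show ?thesis by (simp add: e_def Bcontfun_inverse)
  qed
  show ?thesis
  proof
    fix x y assume xy: "x \<in> mspace m" "y \<in> mspace m"
    show "dist (e x) (e y) = mdist m x y"
    proof (rule antisym)
      show "dist (e x) (e y) \<le> mdist m x y"
      proof (rule dist_bound)
        show "dist (apply_bcontfun (e x) n) (apply_bcontfun (e y) n) \<le> mdist m x y" for n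
          using M.triangle[OF xy(1) xy(2) a[of n]] M.triangle[OF xy(2) xy(1) a[of n]] M.commute[of x y]
          by (simp add: e xy dist_real_def)
      qed
      show "mdist m x y \<le> dist (e x) (e y)"
      proof (rule field_le_epsilon)
        fix \<epsilon> :: real assume "0 < \<epsilon>"
        then obtain n where n: "1 / real (Suc n) < \<epsilon> / 2"
          using nat_approx_posE[of "\<epsilon> / 2"] by auto
        obtain z where "z \<in> K n" "y \<in> M.mball z (1 / Suc n)" using K(3)[of n] xy by blast
        moreover then obtain k where "z = a k" using r unfolding a_def D_def by blast
        ultimately have k: "mdist m y (a k) < \<epsilon> / 2" using n M.commute[of y z] by simp
        have "mdist m x y \<le> mdist m x (a k) + mdist m y (a k)"
          using M.triangle[OF xy(1) a[of k] xy(2)] M.commute[of y "a k"] by simp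
        also have "\<dots> \<le> dist (apply_bcontfun (e x) k) (apply_bcontfun (e y) k) + 2 * mdist m y (a k)"
          by (simp add: e xy dist_real_def)
        also have "\<dots> \<le> dist (e x) (e y) + \<epsilon>" using dist_bounded[of "e x" k "e y"] k by linarith
        finally show "mdist m x y \<le> dist (e x) (e y) + \<epsilon>" .
      qed
    qed
  qed
qed

lemma isometry_homeomorphic:
  fixes e :: "'a \<Rightarrow> 'b::metric_space"
  assumes "\<And>x y. x \<in> mspace m \<Longrightarrow> y \<in> mspace m \<Longrightarrow> dist (e x) (e y) = mdist m x y"
  shows "homeomorphic_map (mtopology_of m) (top_of_set (e ` mspace m)) e"
proof -
  interpret Metric_space12 "mspace m" "mdist m" UNIV "dist :: 'b \<Rightarrow> 'b \<Rightarrow> real"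
    by (simp add: Metric_space12_def Met_TC.Metric_space_axioms)
  have "embedding_map (mtopology_of m) euclidean e"
    using isometry_imp_embedding_map[of e] assms
    by (auto simp: mtopology_of_def mtopology_is_euclidean)
  then show ?thesis by (simp add: embedding_map_def)
qed

section \<open>Open covers and partitions of unity\<close>

definition refinement_of_order :: "'a topology \<Rightarrow> int \<Rightarrow> 'a set set \<Rightarrow> 'a set set \<Rightarrow> bool" where
  "refinement_of_order K n \<U> \<V> \<longleftrightarrow> finite \<V> \<and> (\<forall>V\<in>\<V>. openin K V) \<and> \<Union>\<V> = topspace K \<and>
     (\<forall>V\<in>\<V>. \<exists>U\<in>\<U>. V \<subseteq> U) \<and> (\<forall>x\<in>topspace K. int (card {V\<in>\<V>. x \<in> V}) \<le> n + 1)"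

lemma refinement_of_orderD:
  assumes "refinement_of_order K n \<U> \<V>"
  shows "finite \<V>" "W \<in> \<V> \<Longrightarrow> openin K W" "\<Union>\<V> = topspace K"
    "W \<in> \<V> \<Longrightarrow> \<exists>U\<in>\<U>. W \<subseteq> U" "x \<in> topspace K \<Longrightarrow> int (card {V\<in>\<V>. x \<in> V}) \<le> n + 1"
  using assms unfolding refinement_of_order_def by simp_all

lemma covering_dim_leE:
  assumes "covering_dim_le K n" "finite \<U>" "\<And>U. U \<in> \<U> \<Longrightarrow> openin K U" "\<Union>\<U> = topspace K"
  obtains \<V> where "refinement_of_order K n \<U> \<V>"
proof -
  have 1: "finite \<U> \<and> (\<forall>U\<in>\<U>. openin K U) \<and> \<Union>\<U> = topspace K" using assms(2,3,4) by simp
  have 2: "\<forall>\<U>. finite \<U> \<and> (\<forall>U\<in>\<U>. openin K U) \<and> \<Union>\<U> = topspace K \<longrightarrow> (\<exists>\<V>. refinement_of_order K n \<U> \<V>)"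
    using assms(1) unfolding covering_dim_le_def refinement_of_order_def by (rule conjunct2)
  have "\<exists>\<V>. refinement_of_order K n \<U> \<V>" using 2[THEN spec, of \<U>] 1 by (rule mp)
  then show thesis using that by (rule exE)
qed

lemma covering_dim_le_homeomorphic:
  assumes X: "covering_dim_le X n" and h: "homeomorphic_map X Y f"
  shows "covering_dim_le Y n"
  unfolding covering_dim_le_def
proof (intro conjI allI impI)
  show "-1 \<le> n" using X by (simp add: covering_dim_le_def)
  fix \<U> assume U: "finite \<U> \<and> (\<forall>U\<in>\<U>. openin Y U) \<and> \<Union>\<U> = topspace Y"
  obtain g where g: "homeomorphic_maps X Y f g" using h homeomorphic_map_maps by blast
  have cf: "continuous_map X Y f" and fg: "\<And>y. y \<in> topspace Y \<Longrightarrow> f (g y) = y"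
      and gf: "\<And>x. x \<in> topspace X \<Longrightarrow> g (f x) = x"
      and f: "f ` topspace X = topspace Y" and gX: "\<And>y. y \<in> topspace Y \<Longrightarrow> g y \<in> topspace X"
      and op: "open_map X Y f"
    using g h by (auto simp: homeomorphic_maps_def homeomorphic_eq_everything_map continuous_map_def)
  define \<U>' where "\<U>' = (\<lambda>U. {x \<in> topspace X. f x \<in> U}) ` \<U>"
  have "\<Union>\<U>' = topspace X"
  proof (intro equalityI subsetI)
    fix x assume x: "x \<in> topspace X"
    then have "f x \<in> topspace Y" using f by (metis imageI)
    then have "f x \<in> \<Union>\<U>" using U by simp
    then obtain W where "W \<in> \<U>" "f x \<in> W" by blast
    then show "x \<in> \<Union>\<U>'" using x unfolding \<U>'_def by blast
  qed (auto simp: \<U>'_def)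
  moreover have "finite \<U>'" using U by (simp add: \<U>'_def)
  moreover have "\<forall>U\<in>\<U>'. openin X U"
    using U openin_continuous_map_preimage[OF cf] unfolding \<U>'_def by blast
  ultimately obtain \<V> where V: "refinement_of_order X n \<U>' \<V>"
    using covering_dim_leE[OF X, of \<U>'] by metis
  note V = refinement_of_orderD[OF V]
  show "\<exists>\<V>. finite \<V> \<and> (\<forall>V\<in>\<V>. openin Y V) \<and> \<Union>\<V> = topspace Y \<and> (\<forall>V\<in>\<V>. \<exists>U\<in>\<U>. V \<subseteq> U) \<and>
      (\<forall>x\<in>topspace Y. int (card {V \<in> \<V>. x \<in> V}) \<le> n + 1)"
  proof (intro exI[of _ "(`) f ` \<V>"] conjI ballI)
    show "\<Union> ((`) f ` \<V>) = topspace Y" using V(3) f image_Union[of f \<V>] by presburger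
    show "\<exists>U\<in>\<U>. W \<subseteq> U" if W: "W \<in> (`) f ` \<V>" for W
    proof -
      obtain V where "V \<in> \<V>" "W = f ` V" using W by blast
      moreover then obtain U where "U \<in> \<U>" "V \<subseteq> {x \<in> topspace X. f x \<in> U}"
        using V(4)[of V] unfolding \<U>'_def by blast
      ultimately show ?thesis by blast
    qed
    show "openin Y W" if "W \<in> (`) f ` \<V>" for W using that V(2) op unfolding open_map_def by blast
    show "finite ((`) f ` \<V>)" using V(1) by simp
    show "int (card {W \<in> (`) f ` \<V>. y \<in> W}) \<le> n + 1" if y: "y \<in> topspace Y" for y
    proof -
      have "{W \<in> (`) f ` \<V>. y \<in> W} \<subseteq> (`) f ` {V \<in> \<V>. g y \<in> V}"
      proof
        fix W assume "W \<in> {W \<in> (`) f ` \<V>. y \<in> W}"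
        then obtain V x where Vx: "V \<in> \<V>" "W = f ` V" "x \<in> V" "y = f x" by blast
        then have "x \<in> topspace X" using V(3) by (metis UnionI)
        then show "W \<in> (`) f ` {V \<in> \<V>. g y \<in> V}" using Vx gf by auto
      qed
      moreover have "finite {V \<in> \<V>. g y \<in> V}" using V(1) by simp
      ultimately have "card {W \<in> (`) f ` \<V>. y \<in> W} \<le> card {V \<in> \<V>. g y \<in> V}"
        by (rule surj_card_le[rotated])
      moreover have "int (card {V \<in> \<V>. g y \<in> V}) \<le> n + 1" using V(5) gX[OF y] .
      ultimately show ?thesis by linarith
    qed
  qed
qed

text \<open>The weight \<open>p W\<close> is positive exactly on \<open>W\<close>, not merely
  supported in it, so the number of nonzero weights at a point is the multiplicity of the cover
  there.\<close>

definition unity_partition :: "'b::topological_space set \<Rightarrow> 'b set set \<Rightarrow> ('b set \<Rightarrow> 'b \<Rightarrow> real) \<Rightarrow> bool" where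
  "unity_partition C \<V> p \<longleftrightarrow> (\<forall>W\<in>\<V>. continuous_on C (p W) \<and> (\<forall>x\<in>C. 0 \<le> p W x \<and> (0 < p W x \<longleftrightarrow> x \<in> W)))
     \<and> (\<forall>x\<in>C. (\<Sum>W\<in>\<V>. p W x) = 1)"

lemma unity_partitionD:
  assumes "unity_partition C \<V> p"
  shows "W \<in> \<V> \<Longrightarrow> continuous_on C (p W)"
    "W \<in> \<V> \<Longrightarrow> x \<in> C \<Longrightarrow> 0 \<le> p W x"
    "W \<in> \<V> \<Longrightarrow> x \<in> C \<Longrightarrow> 0 < p W x \<longleftrightarrow> x \<in> W"
    "x \<in> C \<Longrightarrow> (\<Sum>W\<in>\<V>. p W x) = 1"
  using assms unfolding unity_partition_def by simp_all

lemma partition_of_unity: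
  fixes C :: "'b::metric_space set"
  assumes C: "compact C" and \<V>: "finite \<V>" "\<And>V. V \<in> \<V> \<Longrightarrow> openin (top_of_set C) V" "\<Union>\<V> = C"
  obtains p where "unity_partition C \<V> p"
proof -
  \<comment> \<open>\<open>infdist\<close> to the empty set is 0, which would be the wrong weight
    for V = C.\<close>
  define g where "g V x = (if C - V = {} then 1 else infdist x (C - V))" for V x
  have gc: "continuous_on C (g V)" for V
    unfolding g_def[abs_def] by (cases "C - V = {}") (auto intro!: continuous_intros)
  have g0: "0 \<le> g V x" for V x by (simp add: g_def infdist_nonneg)
  have gpos: "0 < g V x \<longleftrightarrow> x \<in> V" if V: "V \<in> \<V>" and x: "x \<in> C" for V x
  proof (cases "C - V = {}")
    case False
    have "closedin (top_of_set C) (C - V)" using \<V>(2)[OF V] by (auto simp: closedin_def Diff_Diff_Int openin_imp_subset Int_absorb1)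
    then have "closed (C - V)" using C compact_imp_closed closedin_closed_trans by blast
    then have "infdist x (C - V) = 0 \<longleftrightarrow> x \<in> C - V" using False in_closed_iff_infdist_zero by blast
    then show ?thesis using False x infdist_nonneg[of x "C - V"] by (auto simp: g_def less_le)
  qed (use x in \<open>auto simp: g_def\<close>)
  define s where "s x = (\<Sum>V\<in>\<V>. g V x)" for x
  have spos: "0 < s x" if "x \<in> C" for x
  proof -
    have "x \<in> \<Union>\<V>" using that \<V>(3) by simp
    then obtain V where "V \<in> \<V>" "x \<in> V" by blast
    then show ?thesis unfolding s_def using gpos that g0 \<V>(1) by (intro sum_pos2[of _ V]) auto
  qed
  show ?thesis
  proof (rule that[of "\<lambda>V x. g V x / s x"], unfold unity_partition_def, intro conjI ballI)
    show "continuous_on C (\<lambda>x. g V x / s x)" for V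
      using spos unfolding s_def by (intro continuous_intros gc) (auto simp: less_le)
    show "0 \<le> g V x / s x" if "x \<in> C" for V x using g0 spos[OF that] by simp
    show "0 < g V x / s x \<longleftrightarrow> x \<in> V" if "V \<in> \<V>" "x \<in> C" for V x
      using gpos[OF that] spos[OF that(2)] by (simp add: zero_less_divide_iff)
    show "(\<Sum>V\<in>\<V>. g V x / s x) = 1" if "x \<in> C" for x
      using spos[OF that] by (simp add: s_def flip: sum_divide_distrib)
  qed
qed

definition fine_cover :: "'b::metric_space set \<Rightarrow> int \<Rightarrow> real \<Rightarrow> 'b set set \<Rightarrow> bool" where
  "fine_cover C n e \<V> \<longleftrightarrow> finite \<V> \<and> (\<forall>W\<in>\<V>. openin (top_of_set C) W) \<and> \<Union>\<V> = C \<and>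
     (\<forall>W\<in>\<V>. \<forall>x\<in>W. \<forall>y\<in>W. dist x y < e) \<and> (\<forall>x\<in>C. int (card {W\<in>\<V>. x \<in> W}) \<le> n + 1)"

lemma fine_coverD:
  assumes "fine_cover C n e \<V>"
  shows "finite \<V>" "W \<in> \<V> \<Longrightarrow> openin (top_of_set C) W" "\<Union>\<V> = C"
    "W \<in> \<V> \<Longrightarrow> x \<in> W \<Longrightarrow> y \<in> W \<Longrightarrow> dist x y < e"
    "x \<in> C \<Longrightarrow> int (card {W\<in>\<V>. x \<in> W}) \<le> n + 1"
  using assms unfolding fine_cover_def by simp_all

text \<open>Finitely many balls of radius e/2 form a cover; any refinement of it has members of
  small diameter.\<close>

lemma covering_dim_le_refine:
  fixes C :: "'b::metric_space set"
  assumes C: "compact C" and n: "covering_dim_le (top_of_set C) n" and e: "0 < e"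
  obtains \<V> where "fine_cover C n e \<V>"
proof -
  obtain F where F: "finite F" "F \<subseteq> C" "C \<subseteq> (\<Union>x\<in>F. ball x (e/2))"
  proof (rule compactE_image[OF C, of C "\<lambda>x. ball x (e/2)"])
    show "C \<subseteq> (\<Union>x\<in>C. ball x (e/2))" using e by force
  qed auto
  let ?\<U> = "(\<lambda>x. C \<inter> ball x (e/2)) ` F"
  have U: "\<And>U. U \<in> ?\<U> \<Longrightarrow> openin (top_of_set C) U" "\<Union>?\<U> = topspace (top_of_set C)"
    using F by (auto intro: openin_open_Int)
  obtain \<V> where V: "refinement_of_order (top_of_set C) n ?\<U> \<V>"
    by (rule covering_dim_leE[OF n finite_imageI[OF F(1)] U])
  note V = refinement_of_orderD[OF V]
  show ?thesis
  proof (rule that[of \<V>], unfold fine_cover_def, intro conjI ballI)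
    show "dist x y < e" if xy: "V \<in> \<V>" "x \<in> V" "y \<in> V" for V x y
    proof -
      obtain z where "V \<subseteq> C \<inter> ball z (e/2)" using V(4)[OF xy(1)] by blast
      then have "dist z x < e/2" "dist z y < e/2" using xy by auto
      then show ?thesis using dist_triangle[of x y z] dist_commute[of x z] by linarith
    qed
  qed (use V in auto)
qed

text \<open>Two subdivisions \<open>P\<close>, \<open>Q\<close> of \<open>[0, 1]\<close> with \<open>a\<close> and \<open>b\<close> nondegenerate pieces have a common
  refinement with at most \<open>a + b - 1\<close> nondegenerate pieces, because those pieces are determined
  by their right end points, and \<open>1\<close> is an end point of both.\<close>

lemma common_subdivision:
  fixes P Q :: "nat \<Rightarrow> real"
  assumes P: "\<And>i. P i \<le> P (Suc i)" "P 0 = 0" "P A = 1"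
    and Q: "\<And>i. Q i \<le> Q (Suc i)" "Q 0 = 0" "Q B = 1"
  defines "w \<equiv> \<lambda>i j. min (P (Suc i)) (Q (Suc j)) - max (P i) (Q j)"
  shows "\<exists>i<A. \<exists>j<B. 0 < w i j"
    and "card {(i, j). i < A \<and> j < B \<and> 0 < w i j} + 1 \<le> card {i. i < A \<and> P i < P (Suc i)} + card {j. j < B \<and> Q j < Q (Suc j)}"
proof -
  \<comment> \<open>The piece that ends at the first index with value 1 is nondegenerate.\<close>
  have last: "\<exists>i<N. R i < R (Suc i) \<and> R (Suc i) = 1" if R: "\<And>i. R i \<le> R (Suc i)" "R 0 = 0" "R N = 1" for R :: "nat \<Rightarrow> real" and N
  proof -
    define k where "k = (LEAST k. R k = 1)"
    have k: "R k = 1" "k \<le> N" unfolding k_def using R(3) by (auto intro: LeastI Least_le)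
    then obtain i where i: "k = Suc i" using R(2) by (cases k) auto
    have "R i \<noteq> 1" using not_less_Least[of i "\<lambda>k. R k = 1"] i unfolding k_def[symmetric] by simp
    then show ?thesis using k i R(1)[of i] by (intro exI[of _ i]) auto
  qed
  obtain i0 where i0: "i0 < A" "P i0 < P (Suc i0)" "P (Suc i0) = 1" using last[OF P] by blast
  obtain j0 where j0: "j0 < B" "Q j0 < Q (Suc j0)" "Q (Suc j0) = 1" using last[OF Q] by blast
  show "\<exists>i<A. \<exists>j<B. 0 < w i j"
    using i0 j0 by (intro exI[of _ i0] conjI exI[of _ j0]) (auto simp: w_def)
  let ?I = "{i. i < A \<and> P i < P (Suc i)}" and ?J = "{j. j < B \<and> Q j < Q (Suc j)}"
  let ?S = "{(i, j). i < A \<and> j < B \<and> 0 < w i j}"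
  define r where "r = (\<lambda>(i, j). min (P (Suc i)) (Q (Suc j)))"
  have Pm: "P i \<le> P j" if "i \<le> j" for i j using lift_Suc_mono_le[of P, OF P(1) that] .
  have Qm: "Q i \<le> Q j" if "i \<le> j" for i j using lift_Suc_mono_le[of Q, OF Q(1) that] .
  \<comment> \<open>A nondegenerate common piece that is later in either index starts at or after
    the right end of the earlier one.\<close>
  have lt: "r (i, j) < r (i', j')" if "0 < w i' j'" "i < i' \<or> j < j'" for i j i' j'
  proof -
    have "P (Suc i) \<le> P i' \<or> Q (Suc j) \<le> Q j'" using that(2) Pm[of "Suc i" i'] Qm[of "Suc j" j'] by auto
    then show ?thesis using that(1) by (auto simp: w_def r_def)
  qed
  have "inj_on r ?S"
  proof (rule inj_onI, clarify)
    fix i j i' j' assume *: "0 < w i j" "0 < w i' j'" "r (i, j) = r (i', j')"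
    then have "\<not> (i < i' \<or> j < j')" "\<not> (i' < i \<or> j' < j)" using lt by (metis order_less_irrefl)+
    then show "i = i' \<and> j = j'" by auto
  qed
  moreover have "finite ?S" by (rule finite_subset[of _ "{..<A} \<times> {..<B}"]) auto
  ultimately have "card ?S = card (r ` ?S)" by (simp add: card_image)
  also have "\<dots> \<le> card ((\<lambda>i. P (Suc i)) ` ?I \<union> (\<lambda>j. Q (Suc j)) ` ?J)"
  proof (rule card_mono)
    show "r ` ?S \<subseteq> (\<lambda>i. P (Suc i)) ` ?I \<union> (\<lambda>j. Q (Suc j)) ` ?J"
    proof clarify
      fix i j assume *: "i < A" "j < B" "0 < w i j" "r (i, j) \<notin> (\<lambda>j. Q (Suc j)) ` ?J"
      have "i \<in> ?I" "j \<in> ?J" using * by (auto simp: w_def)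
      then show "r (i, j) \<in> (\<lambda>i. P (Suc i)) ` ?I" using * by (auto simp: r_def min_def split: if_splits)
    qed
  qed auto
  also have "\<dots> + 1 \<le> card ?I + card ?J"
  proof -
    have "1 \<in> (\<lambda>i. P (Suc i)) ` ?I \<inter> (\<lambda>j. Q (Suc j)) ` ?J" using i0 j0 by force
    then have "(\<lambda>i. P (Suc i)) ` ?I \<inter> (\<lambda>j. Q (Suc j)) ` ?J \<noteq> {}" by blast
    moreover have "finite ((\<lambda>i. P (Suc i)) ` ?I \<inter> (\<lambda>j. Q (Suc j)) ` ?J)" by simp
    ultimately have "1 \<le> card ((\<lambda>i. P (Suc i)) ` ?I \<inter> (\<lambda>j. Q (Suc j)) ` ?J)"
      unfolding One_nat_def Suc_le_eq card_gt_0_iff by simp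
    moreover have "card ((\<lambda>i. P (Suc i)) ` ?I) \<le> card ?I" "card ((\<lambda>j. Q (Suc j)) ` ?J) \<le> card ?J"
      by (auto intro: card_image_le)
    ultimately show ?thesis
      using card_Un_Int[of "(\<lambda>i. P (Suc i)) ` ?I" "(\<lambda>j. Q (Suc j)) ` ?J"] by simp
  qed
  finally show "card ?S + 1 \<le> card ?I + card ?J" by simp
qed

text \<open>Partitions of unity subordinate to fine covers of the factors cut [0, 1] into
  consecutive intervals, one subdivision for each point of C and one for each point of D. The set of
  pairs for which the i-th and the j-th interval overlap is open and small, and counting common
  pieces shows that a point lies in at most (n + 1) + (m + 1) - 1 such sets. This is the staircase
  triangulation of a product of simplices, in the language of covers.\<close>

lemma covering_dim_le_Times:
  fixes C :: "'b::metric_space set" and D :: "'c::metric_space set"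
  assumes C: "compact C" "covering_dim_le (top_of_set C) n" and D: "compact D" "covering_dim_le (top_of_set D) m"
    and nm: "0 \<le> n" "0 \<le> m"
  shows "covering_dim_le (top_of_set (C \<times> D)) (n + m)"
  unfolding covering_dim_le_def
proof (intro conjI allI impI)
  fix \<W> assume W: "finite \<W> \<and> (\<forall>W\<in>\<W>. openin (top_of_set (C \<times> D)) W) \<and> \<Union>\<W> = topspace (top_of_set (C \<times> D))"
  have CD: "compact (C \<times> D)" using C D compact_Times by blast
  have "\<forall>W\<in>\<W>. \<exists>T. open T \<and> W = (C \<times> D) \<inter> T" using W by (auto simp: openin_open)
  then obtain T where T: "\<And>W. W \<in> \<W> \<Longrightarrow> open (T W)" "\<And>W. W \<in> \<W> \<Longrightarrow> W = (C \<times> D) \<inter> T W" by metis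
  \<comment> \<open>A Lebesgue number of the cover; half of it is given to each factor.\<close>
  obtain e where e: "0 < e" "\<And>x. x \<in> C \<times> D \<Longrightarrow> \<exists>G\<in>T ` \<W>. ball x e \<subseteq> G"
  proof (rule Heine_Borel_lemma[OF CD, of "T ` \<W>"])
    show "C \<times> D \<subseteq> \<Union> (T ` \<W>)"
    proof
      fix z assume "z \<in> C \<times> D"
      then have "z \<in> \<Union>\<W>" using W by simp
      then obtain W where "W \<in> \<W>" "z \<in> W" by blast
      then show "z \<in> \<Union> (T ` \<W>)" using T(2)[of W] by blast
    qed
  qed (use T in auto)
  obtain \<U> where U: "fine_cover C n (e/2) \<U>"
    by (rule covering_dim_le_refine[OF C half_gt_zero[OF e(1)]])
  note U = fine_coverD[OF U]
  obtain \<V> where V: "fine_cover D m (e/2) \<V>"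
    by (rule covering_dim_le_refine[OF D half_gt_zero[OF e(1)]])
  note V = fine_coverD[OF V]
  obtain p where p: "unity_partition C \<U> p" by (rule partition_of_unity[OF C(1) U(1-3)])
  note p = unity_partitionD[OF p]
  obtain q where q: "unity_partition D \<V> q" by (rule partition_of_unity[OF D(1) V(1-3)])
  note q = unity_partitionD[OF q]
  define A B where "A = card \<U>" and "B = card \<V>"
  obtain u where u: "bij_betw u {0..<A} \<U>" using ex_bij_betw_nat_finite[OF U(1)] unfolding A_def by blast
  obtain v where v: "bij_betw v {0..<B} \<V>" using ex_bij_betw_nat_finite[OF V(1)] unfolding B_def by blast
  have um: "u i \<in> \<U>" if "i < A" for i using u that by (auto simp: bij_betw_def)
  have vm: "v i \<in> \<V>" if "i < B" for i using v that by (auto simp: bij_betw_def)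
  \<comment> \<open>Stopping at A keeps the cumulative sums monotone at every index, as a
    subdivision requires.\<close>
  define P where "P x i = (\<Sum>k<min i A. p (u k) x)" for x i
  define Q where "Q y i = (\<Sum>k<min i B. q (v k) y)" for y i
  have P: "P x i \<le> P x (Suc i)" "P x 0 = 0" "P x A = 1" "i < A \<Longrightarrow> P x i < P x (Suc i) \<longleftrightarrow> x \<in> u i" if x: "x \<in> C" for x i
  proof -
    have s: "P x (Suc i) = P x i + p (u i) x" if "i < A" for i using that by (simp add: P_def min_def)
    show "P x i \<le> P x (Suc i)" using s[of i] p(2)[OF um x] by (cases "i < A") (auto simp: P_def min_def)
    show "P x 0 = 0" by (simp add: P_def)
    show "P x A = 1" using p(4)[OF x] sum.reindex_bij_betw[OF u, of "\<lambda>V. p V x"] by (simp add: P_def lessThan_atLeast0)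
    show "i < A \<Longrightarrow> P x i < P x (Suc i) \<longleftrightarrow> x \<in> u i" using s[of i] p(3)[OF um x] by simp
  qed
  have Q: "Q x i \<le> Q x (Suc i)" "Q x 0 = 0" "Q x B = 1" "i < B \<Longrightarrow> Q x i < Q x (Suc i) \<longleftrightarrow> x \<in> v i" if x: "x \<in> D" for x i
  proof -
    have s: "Q x (Suc i) = Q x i + q (v i) x" if "i < B" for i using that by (simp add: Q_def min_def)
    show "Q x i \<le> Q x (Suc i)" using s[of i] q(2)[OF vm x] by (cases "i < B") (auto simp: Q_def min_def)
    show "Q x 0 = 0" by (simp add: Q_def)
    show "Q x B = 1" using q(4)[OF x] sum.reindex_bij_betw[OF v, of "\<lambda>V. q V x"] by (simp add: Q_def lessThan_atLeast0)
    show "i < B \<Longrightarrow> Q x i < Q x (Suc i) \<longleftrightarrow> x \<in> v i" using s[of i] q(3)[OF vm x] by simp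
  qed
  have Pc: "continuous_on (C \<times> D) (\<lambda>z. P (fst z) i)" for i
    unfolding P_def using um by (intro continuous_intros continuous_on_compose2[OF p(1)]) auto
  have Qc: "continuous_on (C \<times> D) (\<lambda>z. Q (snd z) i)" for i
    unfolding Q_def using vm by (intro continuous_intros continuous_on_compose2[OF q(1)]) auto
  define w where "w z i j = min (P (fst z) (Suc i)) (Q (snd z) (Suc j)) - max (P (fst z) i) (Q (snd z) j)" for z i j
  have wc: "continuous_on (C \<times> D) (\<lambda>z. w z i j)" for i j
    unfolding w_def by (intro continuous_intros Pc Qc)
  define Z where "Z ij = {z \<in> C \<times> D. 0 < w z (fst ij) (snd ij)}" for ij
  let ?I = "{ij \<in> {..<A} \<times> {..<B}. Z ij \<noteq> {}}"
  show "\<exists>\<V>. finite \<V> \<and> (\<forall>V\<in>\<V>. openin (top_of_set (C \<times> D)) V) \<and> \<Union>\<V> = topspace (top_of_set (C \<times> D)) \<and>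
     (\<forall>V\<in>\<V>. \<exists>U\<in>\<W>. V \<subseteq> U) \<and> (\<forall>z\<in>topspace (top_of_set (C \<times> D)). int (card {V \<in> \<V>. z \<in> V}) \<le> n + m + 1)"
  proof (intro exI[of _ "Z ` ?I"] conjI ballI)
    show "openin (top_of_set (C \<times> D)) X" if "X \<in> Z ` ?I" for X
    proof -
      obtain i j where X: "X = {z \<in> C \<times> D. 0 < w z i j}" using \<open>X \<in> Z ` ?I\<close> unfolding Z_def by blast
      have "openin (top_of_set (C \<times> D)) ((C \<times> D) \<inter> (\<lambda>z. w z i j) -` {0<..})"
        by (rule continuous_openin_preimage_gen[OF wc]) auto
      also have "(C \<times> D) \<inter> (\<lambda>z. w z i j) -` {0<..} = X" using X by auto
      finally show ?thesis .
    qed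
    show "\<Union> (Z ` ?I) = topspace (top_of_set (C \<times> D))"
    proof
      show "topspace (top_of_set (C \<times> D)) \<subseteq> \<Union> (Z ` ?I)"
      proof
        fix z assume "z \<in> topspace (top_of_set (C \<times> D))"
        then have z: "z \<in> C \<times> D" "fst z \<in> C" "snd z \<in> D" by auto
        obtain i j where "i < A" "j < B" "0 < w z i j"
          using common_subdivision(1)[OF P(1-3)[OF z(2)] Q(1-3)[OF z(3)]] unfolding w_def by blast
        then have "z \<in> Z (i, j)" "(i, j) \<in> ?I" using z(1) unfolding Z_def by auto
        then show "z \<in> \<Union> (Z ` ?I)" by (rule UN_I[rotated])
      qed
    qed (auto simp: Z_def)
    show "\<exists>W\<in>\<W>. X \<subseteq> W" if "X \<in> Z ` ?I" for X
    proof -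
      obtain i j where ij: "i < A" "j < B" "X = {z \<in> C \<times> D. 0 < w z i j}" using \<open>X \<in> Z ` ?I\<close> unfolding Z_def by auto
      have sub: "fst z \<in> u i \<and> snd z \<in> v j \<and> z \<in> C \<times> D" if "z \<in> X" for z
        using that ij(3) P(4)[of "fst z" i] Q(4)[of "snd z" j] ij(1,2) by (auto simp: w_def)
      have "X \<noteq> {}" using that by blast
        then obtain z where z: "z \<in> X" by blast
        then obtain W where W': "W \<in> \<W>" "ball z e \<subseteq> T W" using e(2)[of z] sub by blast
        have "X \<subseteq> W"
        proof
          fix y assume y: "y \<in> X"
          have "dist (fst z) (fst y) < e/2" "dist (snd z) (snd y) < e/2"
            using U(4)[OF um[OF ij(1)]] V(4)[OF vm[OF ij(2)]] sub[OF z] sub[OF y] by auto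
          moreover have "dist z y \<le> dist (fst z) (fst y) + dist (snd z) (snd y)"
            by (simp add: dist_prod_def sqrt_sum_squares_le_sum)
          ultimately have "y \<in> ball z e" by simp
          then show "y \<in> W" using W' T(2)[OF W'(1)] sub[OF y] by blast
        qed
        then show ?thesis using W'(1) by blast
    qed
    show "int (card {V \<in> Z ` ?I. z \<in> V}) \<le> n + m + 1" if "z \<in> topspace (top_of_set (C \<times> D))" for z
    proof -
      have z: "z \<in> C \<times> D" "fst z \<in> C" "snd z \<in> D" using that by auto
      have fin: "finite {(i, j). i < A \<and> j < B \<and> 0 < w z i j}" by (rule finite_subset[of _ "{..<A} \<times> {..<B}"]) auto
      \<comment> \<open>Different index pairs may define the same set, which only lowers the
        count.\<close>
      have "card {V \<in> Z ` ?I. z \<in> V} \<le> card {(i, j). i < A \<and> j < B \<and> 0 < w z i j}"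
        by (rule surj_card_le[OF fin, of _ Z]) (auto simp: Z_def)
      moreover have "card {(i, j). i < A \<and> j < B \<and> 0 < w z i j} + 1 \<le>
          card {i. i < A \<and> P (fst z) i < P (fst z) (Suc i)} + card {j. j < B \<and> Q (snd z) j < Q (snd z) (Suc j)}"
        using common_subdivision(2)[OF P(1-3)[OF z(2)] Q(1-3)[OF z(3)]] unfolding w_def .
      moreover have "card {i. i < A \<and> P (fst z) i < P (fst z) (Suc i)} = card {V \<in> \<U>. fst z \<in> V}"
      proof (rule bij_betw_same_card)
        show "bij_betw u {i. i < A \<and> P (fst z) i < P (fst z) (Suc i)} {V \<in> \<U>. fst z \<in> V}"
          using u P(4)[OF z(2)] unfolding bij_betw_def inj_on_def by (auto simp: image_iff)
      qed
      moreover have "card {j. j < B \<and> Q (snd z) j < Q (snd z) (Suc j)} = card {V \<in> \<V>. snd z \<in> V}"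
      proof (rule bij_betw_same_card)
        show "bij_betw v {j. j < B \<and> Q (snd z) j < Q (snd z) (Suc j)} {V \<in> \<V>. snd z \<in> V}"
          using v Q(4)[OF z(3)] unfolding bij_betw_def inj_on_def by (auto simp: image_iff)
      qed
      ultimately show ?thesis using U(5)[OF z(2)] V(5)[OF z(3)] by linarith
    qed
  qed auto
qed (use nm in auto)

text \<open>Open intervals of length 2h starting at the multiples of h contain each point at most
  twice, and h is taken from a Lebesgue number. Two copies of this interval will receive the real
  and the imaginary part of one solenoid coordinate.\<close>

lemma covering_dim_le_interval: "covering_dim_le (top_of_set {-1..1::real}) 1"
  unfolding covering_dim_le_def
proof (intro conjI allI impI)
  let ?I = "{-1..1::real}"
  fix \<W> assume W: "finite \<W> \<and> (\<forall>W\<in>\<W>. openin (top_of_set ?I) W) \<and> \<Union>\<W> = topspace (top_of_set ?I)"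
  have "\<forall>W\<in>\<W>. \<exists>T. open T \<and> W = ?I \<inter> T" using W by (auto simp: openin_open)
  then obtain T where T: "\<And>W. W \<in> \<W> \<Longrightarrow> open (T W)" "\<And>W. W \<in> \<W> \<Longrightarrow> W = ?I \<inter> T W" by metis
  obtain e where e: "0 < e" "\<And>x. x \<in> ?I \<Longrightarrow> \<exists>G\<in>T ` \<W>. ball x e \<subseteq> G"
  proof (rule Heine_Borel_lemma[of ?I "T ` \<W>"])
    show "?I \<subseteq> \<Union> (T ` \<W>)"
    proof
      fix z assume "z \<in> ?I"
      then have "z \<in> \<Union>\<W>" using W by simp
      then obtain W where "W \<in> \<W>" "z \<in> W" by blast
      then show "z \<in> \<Union> (T ` \<W>)" using T(2)[of W] by blast
    qed
  qed (use T in auto)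
  define h where "h = min (e / 2) 1"
  have h: "0 < h" "h \<le> e / 2" "h \<le> 1" using e by (auto simp: h_def)
  define Z where "Z k = ?I \<inter> {of_int k * h<..<of_int (k + 2) * h}" for k :: int
  define K where "K = {k. Z k \<noteq> {}}"
  obtain N :: nat where N: "1 / h + 2 \<le> real N" using real_arch_simple by blast
  have "K \<subseteq> {- int N..int N}"
  proof
    fix k assume "k \<in> K"
    then obtain x where x: "-1 \<le> x" "x \<le> 1" "of_int k * h < x" "x < of_int (k + 2) * h" by (auto simp: K_def Z_def)
    then have "of_int k < 1 / h" "- (1 / h) < of_int (k + 2)"
      using h by (auto simp: field_simps)
    then have "of_int k < real N" "- real N < of_int k" using N by auto
    then show "k \<in> {- int N..int N}" by auto
  qed
  then have fK: "finite K" using finite_subset by blast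
  show "\<exists>\<V>. finite \<V> \<and> (\<forall>V\<in>\<V>. openin (top_of_set ?I) V) \<and> \<Union>\<V> = topspace (top_of_set ?I) \<and>
     (\<forall>V\<in>\<V>. \<exists>U\<in>\<W>. V \<subseteq> U) \<and> (\<forall>z\<in>topspace (top_of_set ?I). int (card {V \<in> \<V>. z \<in> V}) \<le> 1 + 1)"
  proof (intro exI[of _ "Z ` K"] conjI ballI)
    show "openin (top_of_set ?I) V" if "V \<in> Z ` K" for V using that by (auto simp: Z_def openin_open)
    show "\<Union> (Z ` K) = topspace (top_of_set ?I)"
    proof
      show "topspace (top_of_set ?I) \<subseteq> \<Union> (Z ` K)"
      proof
        fix x assume "x \<in> topspace (top_of_set ?I)"
        then have x: "x \<in> ?I" by simp
        \<comment> \<open>The ceiling makes the lower inequality strict also when x is a multiple of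
          h.\<close>
        define k where "k = \<lceil>x / h\<rceil> - 1"
        have "of_int k < x / h" "x / h < of_int (k + 2)" unfolding k_def by linarith+
        then have "x \<in> Z k" using x h by (simp add: Z_def field_simps)
        then show "x \<in> \<Union> (Z ` K)" unfolding K_def by blast
      qed
    qed (auto simp: Z_def)
    show "\<exists>W\<in>\<W>. V \<subseteq> W" if V: "V \<in> Z ` K" for V
    proof -
      obtain k x where k: "V = Z k" "x \<in> Z k" using V unfolding K_def by blast
      then obtain W where W': "W \<in> \<W>" "ball x e \<subseteq> T W" using e(2)[of x] by (auto simp: Z_def)
      have "Z k \<subseteq> ball x e"
        using k(2) h unfolding Z_def by (auto simp: dist_real_def algebra_simps)
      then have "V \<subseteq> W" using k(1) W' T(2)[OF W'(1)] by (auto simp: Z_def)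
      then show ?thesis using W'(1) by blast
    qed
    show "int (card {V \<in> Z ` K. x \<in> V}) \<le> 1 + 1" if "x \<in> topspace (top_of_set ?I)" for x
    proof -
      have "{V \<in> Z ` K. x \<in> V} \<subseteq> Z ` {\<lceil>x / h\<rceil> - 1, \<lceil>x / h\<rceil> - 2}"
      proof clarify
        fix k assume "x \<in> Z k"
        then have "of_int k < x / h" "x / h < of_int (k + 2)" using h by (auto simp: Z_def field_simps)
        then have "k = \<lceil>x / h\<rceil> - 1 \<or> k = \<lceil>x / h\<rceil> - 2" by linarith
        then show "Z k \<in> Z ` {\<lceil>x / h\<rceil> - 1, \<lceil>x / h\<rceil> - 2}" by blast
      qed
      then have "card {V \<in> Z ` K. x \<in> V} \<le> card {\<lceil>x / h\<rceil> - 1, \<lceil>x / h\<rceil> - 2}"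
        by (intro surj_card_le) auto
      also have "\<dots> \<le> 2" by (simp add: card_insert_if)
      finally show ?thesis by simp
    qed
  qed (use fK in auto)
qed auto

section \<open>Flows\<close>

text \<open>Transport along the isometric embedding yields a flow on a compact subset of a type of
  class \<open>metric_space\<close>, with joint continuity expressed by
  \<open>continuous_on\<close>.\<close>

lemma flow_model:
  assumes fl: "flow X \<phi>"
  obtains e :: "'a \<Rightarrow> nat \<Rightarrow>\<^sub>C real" and \<psi>
  where "\<And>x y. x \<in> mspace X \<Longrightarrow> y \<in> mspace X \<Longrightarrow> dist (e x) (e y) = mdist X x y"
    "compact (e ` mspace X)" "continuous_on (UNIV \<times> e ` mspace X) (\<lambda>(r, x). \<psi> r x)"
    "\<And>r x. x \<in> mspace X \<Longrightarrow> \<psi> r (e x) = e (\<phi> r x)"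
proof -
  have comp: "compact_space (mtopology_of X)" using fl by (simp add: flow_def)
  obtain e :: "'a \<Rightarrow> nat \<Rightarrow>\<^sub>C real"
    where e: "\<And>x y. x \<in> mspace X \<Longrightarrow> y \<in> mspace X \<Longrightarrow> dist (e x) (e y) = mdist X x y"
    using isometric_embedding[OF comp] by blast
  let ?X = "e ` mspace X"
  have h: "homeomorphic_map (mtopology_of X) (top_of_set ?X) e" using e by (rule isometry_homeomorphic)
  then obtain g where g: "homeomorphic_maps (mtopology_of X) (top_of_set ?X) e g" using homeomorphic_map_maps by blast
  then have ge: "\<And>x. x \<in> mspace X \<Longrightarrow> g (e x) = x"
    and ce: "continuous_map (mtopology_of X) (top_of_set ?X) e"
    and cg: "continuous_map (top_of_set ?X) (mtopology_of X) g"
    by (auto simp: homeomorphic_maps_def)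
  have "compact_space (top_of_set ?X)"
    using comp h homeomorphic_compact_space homeomorphic_map_imp_homeomorphic_space by blast
  then have c: "compact ?X" by (simp add: compact_space_subtopology compactin_euclidean_iff compact_space_def)
  define \<psi> where "\<psi> r x = e (\<phi> r (g x))" for r x
  have "continuous_map (prod_topology euclideanreal (top_of_set ?X)) (prod_topology euclideanreal (mtopology_of X)) (\<lambda>(r, x). (r, g x))"
    using cg by (auto simp: continuous_map_prod_top[of _ _ _ _ "\<lambda>r. r" g, simplified id_def])
  then have "continuous_map (prod_topology euclideanreal (top_of_set ?X)) (mtopology_of X) ((\<lambda>(r, x). \<phi> r x) \<circ> (\<lambda>(r, x). (r, g x)))"
    using fl continuous_map_compose unfolding flow_def by blast
  from continuous_map_compose[OF this ce]
  have "continuous_map (prod_topology euclideanreal (top_of_set ?X)) (top_of_set ?X) (\<lambda>(r, x). \<psi> r x)"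
    by (simp add: \<psi>_def o_def case_prod_unfold)
  then have cp: "continuous_on (UNIV \<times> ?X) (\<lambda>(r, x). \<psi> r x)"
    using prod_topology_subtopology_eu[of "UNIV :: real set" ?X] by (simp add: continuous_map_in_subtopology)
  have "\<psi> r (e x) = e (\<phi> r x)" if "x \<in> mspace X" for r x using that by (simp add: \<psi>_def ge)
  with e c cp show thesis by (rule that)
qed

section \<open>Metrics over a time window\<close>

lemma flow_zero: "flow X \<phi> \<Longrightarrow> x \<in> mspace X \<Longrightarrow> \<phi> 0 x = x"
  and flow_add: "flow X \<phi> \<Longrightarrow> x \<in> mspace X \<Longrightarrow> \<phi> r (\<phi> s x) = \<phi> (r + s) x"
  by (auto simp: flow_def)

text \<open>Uniform continuity of the flow on the compact product of [0, N] with X.\<close>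

lemma flow_equicontinuous:
  assumes fl: "flow X \<phi>" and e: "0 < \<epsilon>"
  obtains \<delta> where "0 < \<delta>" "\<And>x y r. x \<in> mspace X \<Longrightarrow> y \<in> mspace X \<Longrightarrow> mdist X x y < \<delta> \<Longrightarrow> r \<in> {0..N} \<Longrightarrow>
    mdist X (\<phi> r x) (\<phi> r y) < \<epsilon>"
proof -
  obtain e :: "'a \<Rightarrow> nat \<Rightarrow>\<^sub>C real" and \<psi>
    where iso: "\<And>x y. x \<in> mspace X \<Longrightarrow> y \<in> mspace X \<Longrightarrow> dist (e x) (e y) = mdist X x y"
    and c: "compact (e ` mspace X)" and cp: "continuous_on (UNIV \<times> e ` mspace X) (\<lambda>(r, x). \<psi> r x)"
    and \<psi>: "\<And>r x. x \<in> mspace X \<Longrightarrow> \<psi> r (e x) = e (\<phi> r x)"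
    using flow_model[OF fl] by blast
  have "uniformly_continuous_on ({0..N} \<times> e ` mspace X) (\<lambda>(r, x). \<psi> r x)"
    by (intro compact_uniformly_continuous compact_Times c continuous_on_subset[OF cp]) auto
  then obtain \<delta> where "0 < \<delta>" and \<delta>: "\<And>z z'. z \<in> {0..N} \<times> e ` mspace X \<Longrightarrow> z' \<in> {0..N} \<times> e ` mspace X \<Longrightarrow>
      dist z' z < \<delta> \<Longrightarrow> dist ((\<lambda>(r, x). \<psi> r x) z') ((\<lambda>(r, x). \<psi> r x) z) < \<epsilon>"
    unfolding uniformly_continuous_on_def using e by metis
  show thesis
  proof (rule that[OF \<open>0 < \<delta>\<close>])
    fix x y r assume *: "x \<in> mspace X" "y \<in> mspace X" "mdist X x y < \<delta>" "r \<in> {0..N}"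
    have "dist (r, e x) (r, e y) < \<delta>" using *(1-3) iso by (simp add: dist_Pair_Pair)
    then have "dist (\<psi> r (e x)) (\<psi> r (e y)) < \<epsilon>" using \<delta>[of "(r, e y)" "(r, e x)"] * by auto
    then show "mdist X (\<phi> r x) (\<phi> r y) < \<epsilon>"
      using * flow_in_mspace[OF fl] by (simp add: \<psi> iso)
  qed
qed

lemma le_flow_dist:
  assumes fl: "flow X \<phi>" and xy: "x \<in> mspace X" "y \<in> mspace X" and r: "r \<in> {0..N}"
  shows "mdist X (\<phi> r x) (\<phi> r y) \<le> flow_dist X \<phi> N x y"
proof -
  interpret M: Metric_space "mspace X" "mdist X" by simp
  have "compactin M.mtopology (mspace X)"
    using fl by (simp add: flow_def mtopology_of_def compact_space_def)
  then have "M.mbounded (mspace X)" by (rule M.compactin_imp_mbounded)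
  then obtain B where "\<And>x y. x \<in> mspace X \<Longrightarrow> y \<in> mspace X \<Longrightarrow> mdist X x y \<le> B"
    unfolding M.mbounded_alt by blast
  then have "bdd_above ((\<lambda>r. mdist X (\<phi> r x) (\<phi> r y)) ` {0..N})"
    using flow_in_mspace[OF fl] xy by (intro bdd_aboveI2) blast
  then show ?thesis using xy cSUP_upper[OF r] by (simp add: flow_dist_def)
qed

lemma flow_dist_le:
  assumes "0 \<le> N" "x \<in> mspace X" "y \<in> mspace X" "\<And>r. r \<in> {0..N} \<Longrightarrow> mdist X (\<phi> r x) (\<phi> r y) \<le> c"
  shows "flow_dist X \<phi> N x y \<le> c"
  using assms by (auto simp: flow_dist_def intro!: cSUP_least)

lemma flow_dist_mono:
  assumes "flow X \<phi>" "x \<in> mspace X" "y \<in> mspace X" "0 \<le> N" "N \<le> M"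
  shows "flow_dist X \<phi> N x y \<le> flow_dist X \<phi> M x y"
  using assms by (intro flow_dist_le le_flow_dist) auto

lemma flow_dist_add_le:
  assumes fl: "flow X \<phi>" and xy: "x \<in> mspace X" "y \<in> mspace X" and NM: "0 \<le> N" "0 \<le> M"
  shows "flow_dist X \<phi> (N + M) x y \<le> max (flow_dist X \<phi> N x y) (flow_dist X \<phi> M (\<phi> N x) (\<phi> N y))"
proof (rule flow_dist_le)
  fix r assume r: "r \<in> {0..N + M}"
  show "mdist X (\<phi> r x) (\<phi> r y) \<le> max (flow_dist X \<phi> N x y) (flow_dist X \<phi> M (\<phi> N x) (\<phi> N y))"
  proof (cases "r \<le> N")
    case True
    then show ?thesis using le_flow_dist[OF fl xy, of r N] r by auto
  next
    case False
    have "mdist X (\<phi> (r - N) (\<phi> N x)) (\<phi> (r - N) (\<phi> N y)) \<le> flow_dist X \<phi> M (\<phi> N x) (\<phi> N y)"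
      using flow_in_mspace[OF fl] xy False r by (intro le_flow_dist[OF fl]) auto
    then show ?thesis using flow_add[OF fl] xy by simp
  qed
qed (use assms in auto)

text \<open>Equicontinuity on [0, N] gives one inclusion, time 0 the other. Widths at different time
  scales thus concern continuous maps on one and the same space.\<close>

lemma mtopology_flow_dist:
  assumes fl: "flow X \<phi>" and N: "0 \<le> N"
  shows "Metric_space.mtopology (mspace X) (flow_dist X \<phi> N) = mtopology_of X"
proof -
  interpret M: Metric_space "mspace X" "mdist X" by simp
  interpret F: Metric_space "mspace X" "flow_dist X \<phi> N" using Metric_space_flow_dist[OF fl N] .
  have "openin F.mtopology U \<longleftrightarrow> openin M.mtopology U" for U
  proof
    assume U: "openin F.mtopology U"
    show "openin M.mtopology U"
      unfolding M.openin_mtopology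
    proof (intro conjI allI impI)
      show "U \<subseteq> mspace X" using U F.openin_mtopology by blast
      fix x assume x: "x \<in> U"
      then obtain r where r: "0 < r" "F.mball x r \<subseteq> U" using U F.openin_mtopology by blast
      have xM: "x \<in> mspace X" using x \<open>U \<subseteq> mspace X\<close> by blast
      obtain \<delta> where \<delta>: "0 < \<delta>" "\<And>x y s. x \<in> mspace X \<Longrightarrow> y \<in> mspace X \<Longrightarrow> mdist X x y < \<delta> \<Longrightarrow> s \<in> {0..N} \<Longrightarrow>
        mdist X (\<phi> s x) (\<phi> s y) < r / 2"
        using flow_equicontinuous[OF fl half_gt_zero[OF r(1)]] by blast
      have "M.mball x \<delta> \<subseteq> F.mball x r"
      proof
        fix y assume y: "y \<in> M.mball x \<delta>"
        then have "flow_dist X \<phi> N x y \<le> r / 2"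
          using \<delta>(2)[of x y] N by (intro flow_dist_le) (auto simp: less_imp_le)
        then show "y \<in> F.mball x r" using y r by auto
      qed
      then show "\<exists>r>0. M.mball x r \<subseteq> U" using \<delta>(1) r(2) by blast
    qed
  next
    assume U: "openin M.mtopology U"
    show "openin F.mtopology U"
      unfolding F.openin_mtopology
    proof (intro conjI allI impI)
      show "U \<subseteq> mspace X" using U M.openin_mtopology by blast
      fix x assume x: "x \<in> U"
      then obtain r where r: "0 < r" "M.mball x r \<subseteq> U" using U M.openin_mtopology by blast
      have "F.mball x r \<subseteq> M.mball x r"
      proof
        fix y assume y: "y \<in> F.mball x r"
        then have "mdist X (\<phi> 0 x) (\<phi> 0 y) \<le> flow_dist X \<phi> N x y"
          using N by (intro le_flow_dist[OF fl]) auto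
        then show "y \<in> M.mball x r" using y flow_zero[OF fl] by auto
      qed
      then show "\<exists>r>0. F.mball x r \<subseteq> U" using r by blast
    qed
  qed
  then show ?thesis by (simp add: mtopology_of_def topology_eq)
qed

subsection \<open>Width\<close>

text \<open>\<open>Widim \<epsilon> \<le> n\<close> in terms of compact subsets of one metric space.\<close>

definition small_width :: "'a topology \<Rightarrow> ('a \<Rightarrow> 'a \<Rightarrow> real) \<Rightarrow> real \<Rightarrow> int \<Rightarrow> bool" where
  "small_width T D \<epsilon> n \<longleftrightarrow> (\<exists>(C :: (nat \<Rightarrow>\<^sub>C real) set) f. compact C \<and> covering_dim_le (top_of_set C) n \<and>
     continuous_map T (top_of_set C) f \<and> (\<forall>x\<in>topspace T. \<forall>y\<in>topspace T. f x = f y \<longrightarrow> D x y < \<epsilon>))"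

lemma small_width_metric:
  assumes K: "compact_space (mtopology_of m)" "covering_dim_le (mtopology_of m) n"
    and f: "continuous_map T (mtopology_of m) f" "\<And>x y. x \<in> topspace T \<Longrightarrow> y \<in> topspace T \<Longrightarrow> f x = f y \<Longrightarrow> D x y < \<epsilon>"
  shows "small_width T D \<epsilon> n"
proof -
  obtain e :: "_ \<Rightarrow> nat \<Rightarrow>\<^sub>C real"
    where e: "\<And>x y. x \<in> mspace m \<Longrightarrow> y \<in> mspace m \<Longrightarrow> dist (e x) (e y) = mdist m x y"
    using isometric_embedding[OF K(1)] by blast
  have h: "homeomorphic_map (mtopology_of m) (top_of_set (e ` mspace m)) e" using e by (rule isometry_homeomorphic)
  have "compact_space (top_of_set (e ` mspace m))"
    using K(1) h homeomorphic_compact_space homeomorphic_map_imp_homeomorphic_space by blast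
  then have c: "compact (e ` mspace m)" by (simp add: compact_space_def)
  have fm: "f x \<in> mspace m" if "x \<in> topspace T" for x
    using f(1) that by (auto simp: continuous_map_def)
  show ?thesis
    unfolding small_width_def
  proof (intro exI conjI ballI impI)
    show "compact (e ` mspace m)" by fact
    show "covering_dim_le (top_of_set (e ` mspace m)) n" using covering_dim_le_homeomorphic[OF K(2) h] .
    show "continuous_map T (top_of_set (e ` mspace m)) (e \<circ> f)"
      using continuous_map_compose[OF f(1)] homeomorphic_imp_continuous_map[OF h] by blast
    fix x y assume xy: "x \<in> topspace T" "y \<in> topspace T" "(e \<circ> f) x = (e \<circ> f) y"
    then have "mdist m (f x) (f y) = 0" using e[OF fm fm, of x y] by simp
    then have "f x = f y" using fm xy mdist_zero by fastforce
    then show "D x y < \<epsilon>" using f(2) xy by blast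
  qed
qed

lemma small_width_compact:
  fixes C :: "'b::metric_space set"
  assumes "compact C" "covering_dim_le (top_of_set C) n" "continuous_map T (top_of_set C) f"
    "\<And>x y. x \<in> topspace T \<Longrightarrow> y \<in> topspace T \<Longrightarrow> f x = f y \<Longrightarrow> D x y < \<epsilon>"
  shows "small_width T D \<epsilon> n"
proof -
  have m: "mtopology_of (submetric euclidean_metric C) = top_of_set C"
    by (simp add: mtopology_of_submetric)
  show ?thesis
    by (rule small_width_metric[of "submetric euclidean_metric C" n T f]) (use assms in \<open>auto simp: m compact_space_def\<close>)
qed

lemma covering_dim_small_widthI:
  fixes K :: "'b topology"
  assumes "compact_space K" "metrizable_space K" "covering_dim_le K n" "continuous_map T K f"
    "\<And>x y. x \<in> topspace T \<Longrightarrow> y \<in> topspace T \<Longrightarrow> f x = f y \<Longrightarrow> D x y < \<epsilon>"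
  shows "small_width T D \<epsilon> n"
proof -
  obtain M d where Md: "Metric_space M d" "K = Metric_space.mtopology M d"
    using assms(2) by (auto simp: metrizable_space_def)
  then have m: "mtopology_of (metric (M, d)) = K"
    by (simp add: mtopology_of_def Metric_space.mspace_metric Metric_space.mdist_metric)
  show ?thesis
    by (rule small_width_metric[of "metric (M, d)" n T f]) (use assms in \<open>auto simp: m\<close>)
qed

text \<open>The two infima range over targets in different types. A compact set of bounded sequences
  becomes a topology on \<open>nat \<Rightarrow> real\<close> by transporting its metric; conversely
  every compact metrizable space embeds isometrically into the bounded sequences.\<close>

lemma Widim_eq_INF:
  assumes "Metric_space M d"
  shows "Widim \<epsilon> M d = (INF n\<in>{n. small_width (Metric_space.mtopology M d) d \<epsilon> n}. ereal (of_int n))"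
    (is "_ = ?R")
proof -
  interpret Metric_space M d by fact
  show ?thesis
  proof (rule antisym)
    show "Widim \<epsilon> M d \<le> ?R"
    proof (rule INF_greatest)
      fix n assume "n \<in> {n. small_width mtopology d \<epsilon> n}"
      then obtain C :: "(nat \<Rightarrow>\<^sub>C real) set" and f where C: "compact C" "covering_dim_le (top_of_set C) n"
        "continuous_map mtopology (top_of_set C) f" "\<And>x y. x \<in> M \<Longrightarrow> y \<in> M \<Longrightarrow> f x = f y \<Longrightarrow> d x y < \<epsilon>"
        unfolding small_width_def by auto
      let ?a = "apply_bcontfun :: (nat \<Rightarrow>\<^sub>C real) \<Rightarrow> _"
      interpret A: Metric_space "?a ` C" "\<lambda>u v. dist (Bcontfun u) (Bcontfun v)"
        by unfold_locales (auto simp: dist_commute dist_triangle apply_bcontfun_inverse)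
      interpret CA: Metric_space12 C dist "?a ` C" "\<lambda>u v. dist (Bcontfun u) (Bcontfun v)"
        by (simp add: Metric_space12_def A.Metric_space_axioms Met_TC.subspace)
      have h: "homeomorphic_map (top_of_set C) A.mtopology ?a"
        using CA.isometry_imp_homeomorphic_map[of ?a] mtopology_of_submetric[of euclidean_metric C]
        by (simp add: mtopology_of_def apply_bcontfun_inverse)
      let ?K = A.mtopology
      have K: "compact_space ?K" "metrizable_space ?K" "covering_dim_le ?K n"
      proof -
        have "compact_space (top_of_set C)" using C(1) by (simp add: compact_space_def)
        then show "compact_space ?K"
          using h homeomorphic_compact_space homeomorphic_map_imp_homeomorphic_space by blast
      qed (use covering_dim_le_homeomorphic[OF C(2) h] A.metrizable_space_mtopology in auto)
      have "eps_embedding M d \<epsilon> ?K (?a \<circ> f)"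
        unfolding eps_embedding_def
        using continuous_map_compose[OF C(3) homeomorphic_imp_continuous_map[OF h]] C(4) by (auto simp: apply_bcontfun_inject)
      then have "Widim \<epsilon> M d \<le> covering_dim ?K"
        unfolding Widim_def using K by (intro Inf_lower) blast
      also have "\<dots> \<le> ereal (of_int n)"
        unfolding covering_dim_def using K(3) by (intro INF_lower) auto
      finally show "Widim \<epsilon> M d \<le> ereal (of_int n)" .
    qed
    show "?R \<le> Widim \<epsilon> M d"
      unfolding Widim_def
    proof (rule Inf_greatest, clarify)
      fix K :: "(nat \<Rightarrow> real) topology" and f
      assume K: "compact_space K" "metrizable_space K" "eps_embedding M d \<epsilon> K f"
      show "?R \<le> covering_dim K"
        unfolding covering_dim_def
      proof (rule INF_greatest, rule INF_lower, clarify)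
        fix n assume "covering_dim_le K n"
        then show "small_width mtopology d \<epsilon> n"
          using K by (intro covering_dim_small_widthI[of K n _ f]) (auto simp: eps_embedding_def)
      qed
    qed
  qed
qed

section \<open>Mean dimension as a supremum\<close>

lemma covering_dim_le_nonneg:
  assumes "covering_dim_le K n" "topspace K \<noteq> {}"
  shows "0 \<le> n"
proof -
  obtain \<V> where "refinement_of_order K n {topspace K} \<V>"
    by (rule covering_dim_leE[OF assms(1), of "{topspace K}"]) auto
  note V = refinement_of_orderD[OF this]
  obtain x where x: "x \<in> topspace K" using assms(2) by blast
  then obtain U where "U \<in> \<V>" "x \<in> U" using V(3) by blast
  then have "card {V\<in>\<V>. x \<in> V} \<noteq> 0" using V(1) by auto
  then show ?thesis using V(5)[OF x] by linarith
qed

lemma small_width_nonneg: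
  assumes "small_width T D \<epsilon> n" "topspace T \<noteq> {}"
  shows "0 \<le> n"
proof -
  obtain C :: "(nat \<Rightarrow>\<^sub>C real) set" and f where C: "covering_dim_le (top_of_set C) n" "continuous_map T (top_of_set C) f"
    using assms(1) unfolding small_width_def by blast
  then have "topspace (top_of_set C) \<noteq> {}" using assms(2) unfolding continuous_map_def by (auto simp: Pi_iff)
  then show ?thesis using covering_dim_le_nonneg C(1) by blast
qed

definition flow_small_width :: "'a metric \<Rightarrow> (real \<Rightarrow> 'a \<Rightarrow> 'a) \<Rightarrow> real \<Rightarrow> real \<Rightarrow> int \<Rightarrow> bool" where
  "flow_small_width X \<phi> \<epsilon> N n \<longleftrightarrow> small_width (mtopology_of X) (flow_dist X \<phi> N) \<epsilon> n"

abbreviation flow_Widim :: "'a metric \<Rightarrow> (real \<Rightarrow> 'a \<Rightarrow> 'a) \<Rightarrow> real \<Rightarrow> real \<Rightarrow> ereal" where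
  "flow_Widim X \<phi> \<epsilon> N \<equiv> Widim \<epsilon> (mspace X) (flow_dist X \<phi> N)"

lemma flow_Widim_eq:
  assumes "flow X \<phi>" "0 \<le> N"
  shows "flow_Widim X \<phi> \<epsilon> N = (INF n\<in>{n. flow_small_width X \<phi> \<epsilon> N n}. ereal (of_int n))"
  using Widim_eq_INF[OF Metric_space_flow_dist[OF assms]] mtopology_flow_dist[OF assms]
  by (simp add: flow_small_width_def)

lemma flow_small_width_nonneg: "flow_small_width X \<phi> \<epsilon> N n \<Longrightarrow> mspace X \<noteq> {} \<Longrightarrow> 0 \<le> n"
  unfolding flow_small_width_def using small_width_nonneg by fastforce

lemma flow_Widim_nonneg:
  assumes "flow X \<phi>" "0 \<le> N" "mspace X \<noteq> {}"
  shows "0 \<le> flow_Widim X \<phi> \<epsilon> N"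
  unfolding flow_Widim_eq[OF assms(1,2)] using flow_small_width_nonneg[OF _ assms(3)]
  by (intro INF_greatest) auto

lemma flow_Widim_le: "flow X \<phi> \<Longrightarrow> 0 \<le> N \<Longrightarrow> flow_small_width X \<phi> \<epsilon> N n \<Longrightarrow> flow_Widim X \<phi> \<epsilon> N \<le> of_int n"
  unfolding flow_Widim_eq by (intro INF_lower) auto

lemma flow_Widim_less: 
  assumes "flow X \<phi>" "0 \<le> N" "flow_Widim X \<phi> \<epsilon> N < ereal c"
  obtains n where "flow_small_width X \<phi> \<epsilon> N n" "of_int n < c"
  using assms(3) unfolding flow_Widim_eq[OF assms(1,2)] INF_less_iff by auto

lemma flow_small_width_mono:
  assumes fl: "flow X \<phi>" and N: "0 \<le> N" "N \<le> M" and e: "\<epsilon> \<le> \<epsilon>'" and sw: "flow_small_width X \<phi> \<epsilon> M n"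
  shows "flow_small_width X \<phi> \<epsilon>' N n"
proof -
  obtain C :: "(nat \<Rightarrow>\<^sub>C real) set" and f where C: "compact C" "covering_dim_le (top_of_set C) n"
     "continuous_map (mtopology_of X) (top_of_set C) f" "\<And>x y. x\<in>mspace X \<Longrightarrow> y\<in>mspace X \<Longrightarrow> f x = f y \<Longrightarrow> flow_dist X \<phi> M x y < \<epsilon>"
    using sw unfolding flow_small_width_def small_width_def by auto
  show ?thesis
    unfolding flow_small_width_def
  proof (rule small_width_compact[OF C(1-3)])
    fix x y assume "x \<in> topspace (mtopology_of X)" "y \<in> topspace (mtopology_of X)" "f x = f y"
    then show "flow_dist X \<phi> N x y < \<epsilon>'"
      using C(4)[of x y] flow_dist_mono[OF fl _ _ N, of x y] e by simp
  qed
qed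

text \<open>A map that resolves the first N units of time is paired with one that resolves the next
  M, precomposed with the flow at time N. The product theorem bounds the dimension of the target by
  the sum; this subadditivity is behind the limit over N.\<close>

lemma flow_small_width_add:
  assumes fl: "flow X \<phi>" and ne: "mspace X \<noteq> {}" and NM: "0 \<le> N" "0 \<le> M"
    and n: "flow_small_width X \<phi> \<epsilon> N n" and m: "flow_small_width X \<phi> \<epsilon> M m"
  shows "flow_small_width X \<phi> \<epsilon> (N + M) (n + m)"
proof -
  obtain C :: "(nat \<Rightarrow>\<^sub>C real) set" and f where C: "compact C" "covering_dim_le (top_of_set C) n"
     "continuous_map (mtopology_of X) (top_of_set C) f" "\<And>x y. x\<in>mspace X \<Longrightarrow> y\<in>mspace X \<Longrightarrow> f x = f y \<Longrightarrow> flow_dist X \<phi> N x y < \<epsilon>"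
    using n unfolding flow_small_width_def small_width_def by auto
  obtain D :: "(nat \<Rightarrow>\<^sub>C real) set" and g where D: "compact D" "covering_dim_le (top_of_set D) m"
     "continuous_map (mtopology_of X) (top_of_set D) g" "\<And>x y. x\<in>mspace X \<Longrightarrow> y\<in>mspace X \<Longrightarrow> g x = g y \<Longrightarrow> flow_dist X \<phi> M x y < \<epsilon>"
    using m unfolding flow_small_width_def small_width_def by auto
  have nm: "0 \<le> n" "0 \<le> m" using flow_small_width_nonneg n m ne by blast+
  have c\<phi>: "continuous_map (mtopology_of X) (mtopology_of X) (\<phi> N)"
  proof -
    have "continuous_map (mtopology_of X) (prod_topology euclideanreal (mtopology_of X)) (\<lambda>x. (N, x))"
      by (simp add: continuous_map_pairwise o_def)
    then have "continuous_map (mtopology_of X) (mtopology_of X) ((\<lambda>(r, x). \<phi> r x) \<circ> (\<lambda>x. (N, x)))"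
      using fl continuous_map_compose unfolding flow_def by blast
    then show ?thesis by (simp add: o_def)
  qed
  show ?thesis
    unfolding flow_small_width_def
  proof (rule small_width_compact)
    show "compact (C \<times> D)" using C D compact_Times by blast
    show "covering_dim_le (top_of_set (C \<times> D)) (n + m)"
      using covering_dim_le_Times[OF C(1,2) D(1,2) nm] .
    have "continuous_map (mtopology_of X) (prod_topology (top_of_set C) (top_of_set D)) (\<lambda>x. (f x, g (\<phi> N x)))"
      unfolding continuous_map_pairwise using continuous_map_compose[OF c\<phi> D(3)] C(3) by (simp add: o_def)
    then show "continuous_map (mtopology_of X) (top_of_set (C \<times> D)) (\<lambda>x. (f x, g (\<phi> N x)))" by simp
    fix x y assume xy: "x \<in> topspace (mtopology_of X)" "y \<in> topspace (mtopology_of X)" "(f x, g (\<phi> N x)) = (f y, g (\<phi> N y))"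
    then show "flow_dist X \<phi> (N + M) x y < \<epsilon>"
      using flow_dist_add_le[OF fl _ _ NM, of x y] C(4)[of x y] D(4)[of "\<phi> N x" "\<phi> N y"] flow_in_mspace[OF fl] by simp
  qed
qed

lemma flow_small_width_mult:
  assumes fl: "flow X \<phi>" and ne: "mspace X \<noteq> {}" and N: "0 \<le> N" and n: "flow_small_width X \<phi> \<epsilon> N n"
  shows "flow_small_width X \<phi> \<epsilon> (real (Suc k) * N) (int (Suc k) * n)"
proof (induction k)
  case (Suc k)
  have "flow_small_width X \<phi> \<epsilon> (real (Suc k) * N + N) (int (Suc k) * n + n)"
    by (rule flow_small_width_add[OF fl ne _ N Suc n]) (use N in auto)
  then show ?case by (simp add: algebra_simps)
qed (use n in simp)

text \<open>Fekete's argument: by subadditivity and monotonicity in N the limit is an infimum, so a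
  single good time scale controls all large ones.\<close>

lemma flow_Widim_tendsto:
  assumes fl: "flow X \<phi>" and ne: "mspace X \<noteq> {}"
  shows "((\<lambda>N. flow_Widim X \<phi> \<epsilon> N / ereal N) \<longlongrightarrow> (INF N\<in>{0<..}. flow_Widim X \<phi> \<epsilon> N / ereal N)) at_top"
proof (rule order_tendstoI)
  fix c assume "c < (INF N\<in>{0<..}. flow_Widim X \<phi> \<epsilon> N / ereal N)"
  then have *: "c < flow_Widim X \<phi> \<epsilon> N / ereal N" if "0 < N" for N
    using that by (meson INF_lower greaterThan_iff less_le_trans)
  show "\<forall>\<^sub>F N in at_top. c < flow_Widim X \<phi> \<epsilon> N / ereal N"
    using eventually_gt_at_top[of 0] by eventually_elim (rule *)
next
  fix c assume "(INF N\<in>{0<..}. flow_Widim X \<phi> \<epsilon> N / ereal N) < c"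
  then obtain N where N: "0 < N" "flow_Widim X \<phi> \<epsilon> N / ereal N < c" by (auto simp: INF_less_iff)
  then obtain c' where c': "flow_Widim X \<phi> \<epsilon> N / ereal N < ereal c'" "ereal c' < c"
    using ereal_dense2 by blast
  then have "flow_Widim X \<phi> \<epsilon> N < ereal (c' * N)"
    using N(1) ereal_divide_less_iff[of "ereal N" "flow_Widim X \<phi> \<epsilon> N" "ereal c'"] by (simp add: mult.commute)
  then obtain n where n: "flow_small_width X \<phi> \<epsilon> N n" "of_int n < c' * N"
    using flow_Widim_less[OF fl] N(1) by (metis less_imp_le)
  have n0: "0 \<le> n" using flow_small_width_nonneg[OF n(1) ne] .
  define r where "r = of_int n / N"
  have r: "r < c'" "0 \<le> r" using n(2) N(1) n0 by (auto simp: r_def pos_divide_less_eq)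
  show "\<forall>\<^sub>F M in at_top. flow_Widim X \<phi> \<epsilon> M / ereal M < c"
    using eventually_gt_at_top[of "max 0 (of_int n / (c' - r))"]
  proof eventually_elim
    case (elim M)
    then have M: "0 < M" "of_int n / (c' - r) < M" by auto
    \<comment> \<open>k + 1 blocks of length N cover the window of length M. The cost n of the
      surplus block is less than (c' - r) M by the threshold on M.\<close>
    define k where "k = nat \<lfloor>M / N\<rfloor>"
    have "real k = of_int \<lfloor>M / N\<rfloor>" using M N by (simp add: k_def)
    then have k0: "real k \<le> M / N" "M / N < real (Suc k)" unfolding of_nat_Suc by linarith+
    then have k: "real k * N \<le> M" "M < real (Suc k) * N" using N(1) by (auto simp: field_simps)
    have "flow_small_width X \<phi> \<epsilon> M (int (Suc k) * n)"
      using flow_small_width_mult[OF fl ne less_imp_le[OF N(1)] n(1)] k M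
      by (intro flow_small_width_mono[OF fl, of M "real (Suc k) * N" \<epsilon>]) auto
    then have W: "flow_Widim X \<phi> \<epsilon> M \<le> ereal (real (Suc k) * of_int n)"
      using flow_Widim_le[OF fl less_imp_le[OF M(1)]] by (metis of_int_mult of_int_of_nat_eq)
    have "real (Suc k) * of_int n \<le> (M / N + 1) * of_int n" using k0 n0 by (intro mult_right_mono) auto
    also have "\<dots> = r * M + of_int n" by (simp add: r_def field_simps)
    also have "\<dots> < c' * M" using M(2) r by (simp add: field_simps)
    finally have "flow_Widim X \<phi> \<epsilon> M < ereal (c' * M)" using W le_less_trans by fastforce
    then have "flow_Widim X \<phi> \<epsilon> M / ereal M < ereal c'"
      using M(1) ereal_divide_less_iff[of "ereal M" "flow_Widim X \<phi> \<epsilon> M" "ereal c'"] by (simp add: mult.commute)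
    then show ?case using c' by simp
  qed
qed

text \<open>Widths grow as \<epsilon> decreases, so the limit at 0 is a supremum.\<close>

lemma mdim_eq:
  assumes fl: "flow X \<phi>" and ne: "mspace X \<noteq> {}"
  shows "mdim X \<phi> = (SUP \<epsilon>\<in>{0<..}. INF N\<in>{0<..}. flow_Widim X \<phi> \<epsilon> N / ereal N)" (is "_ = (SUP \<epsilon>\<in>_. ?I \<epsilon>)")
proof -
  have L: "Lim at_top (\<lambda>N. flow_Widim X \<phi> \<epsilon> N / ereal N) = ?I \<epsilon>" for \<epsilon>
    by (rule tendsto_Lim[OF _ flow_Widim_tendsto[OF fl ne]]) simp
  have mono: "?I \<epsilon>' \<le> ?I \<epsilon>" if "\<epsilon> \<le> \<epsilon>'" for \<epsilon> \<epsilon>'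
  proof (rule INF_mono, clarify)
    fix N :: real assume N: "0 < N"
    have "flow_Widim X \<phi> \<epsilon>' N \<le> flow_Widim X \<phi> \<epsilon> N"
      unfolding flow_Widim_eq[OF fl less_imp_le[OF N]]
      using flow_small_width_mono[OF fl less_imp_le[OF N] order_refl that] by (intro INF_superset_mono) auto
    then show "\<exists>M\<in>{0<..}. flow_Widim X \<phi> \<epsilon>' M / ereal M \<le> flow_Widim X \<phi> \<epsilon> N / ereal N"
      using N by (intro bexI[of _ N] ereal_divide_right_mono) auto
  qed
  have "(?I \<longlongrightarrow> (SUP \<epsilon>\<in>{0<..}. ?I \<epsilon>)) (at_right 0)"
  proof (rule order_tendstoI)
    fix c assume "c < (SUP \<epsilon>\<in>{0<..}. ?I \<epsilon>)"
    then obtain \<epsilon>0 where e0: "0 < \<epsilon>0" "c < ?I \<epsilon>0" by (auto simp: less_SUP_iff)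
    show "\<forall>\<^sub>F \<epsilon> in at_right 0. c < ?I \<epsilon>"
      using eventually_at_right_less[of 0] eventually_at_right_real[OF e0(1)]
    proof eventually_elim
      case (elim \<epsilon>)
      then show ?case using mono[of \<epsilon> \<epsilon>0] e0 by (auto intro: less_le_trans)
    qed
  next
    fix c assume "(SUP \<epsilon>\<in>{0<..}. ?I \<epsilon>) < c"
    then have *: "?I \<epsilon> < c" if "0 < \<epsilon>" for \<epsilon> using that by (meson SUP_upper greaterThan_iff le_less_trans)
    show "\<forall>\<^sub>F \<epsilon> in at_right 0. ?I \<epsilon> < c"
      using eventually_at_right_less[of 0] by eventually_elim (rule *)
  qed
  then show ?thesis unfolding mdim_def L by (intro tendsto_Lim) auto
qed

lemma mdim_less_imp_small_width:
  assumes fl: "flow X \<phi>" and ne: "mspace X \<noteq> {}" and lt: "mdim X \<phi> < ereal \<rho>" and e: "0 < \<epsilon>"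
  shows "\<forall>\<^sub>F N in at_top. \<exists>n. flow_small_width X \<phi> \<epsilon> N n \<and> of_int n < \<rho> * N"
proof -
  have "(INF N\<in>{0<..}. flow_Widim X \<phi> \<epsilon> N / ereal N) < ereal \<rho>"
    using lt e unfolding mdim_eq[OF fl ne] by (meson SUP_upper greaterThan_iff le_less_trans)
  from order_tendstoD(2)[OF flow_Widim_tendsto[OF fl ne] this] eventually_gt_at_top[of 0]
  show ?thesis
  proof eventually_elim
    case (elim N)
    then have "flow_Widim X \<phi> \<epsilon> N < ereal (\<rho> * N)"
      using ereal_divide_less_iff[of "ereal N" "flow_Widim X \<phi> \<epsilon> N" "ereal \<rho>"] by (simp add: mult.commute)
    then show ?case using flow_Widim_less[OF fl] elim by (metis less_imp_le)
  qed
qed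

text \<open>Two extra dimensions at every time scale disappear after division by \<open>N\<close>.\<close>

lemma mdim_extension_eq:
  assumes X: "flow X \<phi>" and Y: "flow Y \<eta>" and ne: "mspace X \<noteq> {}"
    and j: "continuous_map (mtopology_of X) (mtopology_of Y) j"
      "\<And>N x y. 0 \<le> N \<Longrightarrow> x \<in> mspace X \<Longrightarrow> y \<in> mspace X \<Longrightarrow> flow_dist X \<phi> N x y \<le> flow_dist Y \<eta> N (j x) (j y)"
    and p: "continuous_map (mtopology_of Y) (mtopology_of X) p"
    and g: "\<And>\<epsilon>. 0 < \<epsilon> \<Longrightarrow> \<exists>g. continuous_map (mtopology_of Y) (top_of_set ({-1..1::real} \<times> {-1..1::real})) g \<and>
      (\<forall>N\<ge>0. \<forall>x\<in>mspace Y. \<forall>y\<in>mspace Y. g x = g y \<longrightarrow> flow_dist X \<phi> N (p x) (p y) < \<epsilon> \<longrightarrow> flow_dist Y \<eta> N x y < \<epsilon>)"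
  shows "mdim Y \<eta> = mdim X \<phi>"
proof -
  have jY: "j x \<in> mspace Y" if "x \<in> mspace X" for x using j(1) that by (auto simp: continuous_map_def)
  have pX: "p x \<in> mspace X" if "x \<in> mspace Y" for x using p that by (auto simp: continuous_map_def)
  have neY: "mspace Y \<noteq> {}" using jY ne by blast
  \<comment> \<open>Since \<open>j\<close> does not decrease flow distances, a map that resolves Y
    resolves X after composition with \<open>j\<close>.\<close>
  have 1: "flow_small_width X \<phi> \<epsilon> N n" if N: "0 \<le> N" and sw: "flow_small_width Y \<eta> \<epsilon> N n" for \<epsilon> N n
  proof -
    obtain C :: "(nat \<Rightarrow>\<^sub>C real) set" and f where C: "compact C" "covering_dim_le (top_of_set C) n"
       "continuous_map (mtopology_of Y) (top_of_set C) f" "\<And>x y. x\<in>mspace Y \<Longrightarrow> y\<in>mspace Y \<Longrightarrow> f x = f y \<Longrightarrow> flow_dist Y \<eta> N x y < \<epsilon>"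
      using sw unfolding flow_small_width_def small_width_def by auto
    show ?thesis
      unfolding flow_small_width_def
    proof (rule small_width_compact[OF C(1,2) continuous_map_compose[OF j(1) C(3)]])
      fix x y assume "x \<in> topspace (mtopology_of X)" "y \<in> topspace (mtopology_of X)" "(f \<circ> j) x = (f \<circ> j) y"
      then show "flow_dist X \<phi> N x y < \<epsilon>" using j(2)[OF N, of x y] C(4)[OF jY jY, of x y] by simp
    qed
  qed
  \<comment> \<open>Adjoining \<open>g\<close> costs two dimensions, the same for every N.\<close>
  have 2: "flow_small_width Y \<eta> \<epsilon> N (n + 2)" if N: "0 \<le> N" and e: "0 < \<epsilon>" and sw: "flow_small_width X \<phi> \<epsilon> N n" for \<epsilon> N n
  proof -
    obtain C :: "(nat \<Rightarrow>\<^sub>C real) set" and f where C: "compact C" "covering_dim_le (top_of_set C) n"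
       "continuous_map (mtopology_of X) (top_of_set C) f" "\<And>x y. x\<in>mspace X \<Longrightarrow> y\<in>mspace X \<Longrightarrow> f x = f y \<Longrightarrow> flow_dist X \<phi> N x y < \<epsilon>"
      using sw unfolding flow_small_width_def small_width_def by auto
    let ?I = "{-1..1::real}"
    have I: "covering_dim_le (top_of_set (?I \<times> ?I)) 2"
      using covering_dim_le_Times[OF _ covering_dim_le_interval _ covering_dim_le_interval] by simp
    obtain g where g: "continuous_map (mtopology_of Y) (top_of_set (?I \<times> ?I)) g"
      "\<And>x y. x \<in> mspace Y \<Longrightarrow> y \<in> mspace Y \<Longrightarrow> g x = g y \<Longrightarrow> flow_dist X \<phi> N (p x) (p y) < \<epsilon> \<Longrightarrow> flow_dist Y \<eta> N x y < \<epsilon>"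
      using g[OF e] N by blast
    show ?thesis
      unfolding flow_small_width_def
    proof (rule small_width_compact)
      show "compact (C \<times> (?I \<times> ?I))" using C by (intro compact_Times) auto
      show "covering_dim_le (top_of_set (C \<times> (?I \<times> ?I))) (n + 2)"
        using flow_small_width_nonneg[OF sw ne] C I by (intro covering_dim_le_Times compact_Times) auto
      have "continuous_map (mtopology_of Y) (prod_topology (top_of_set C) (top_of_set (?I \<times> ?I))) (\<lambda>x. (f (p x), g x))"
        unfolding continuous_map_pairwise using continuous_map_compose[OF p C(3)] g(1) by (simp add: o_def)
      then show "continuous_map (mtopology_of Y) (top_of_set (C \<times> (?I \<times> ?I))) (\<lambda>x. (f (p x), g x))"
        by (simp only: prod_topology_subtopology_eu)
      fix x y assume "x \<in> topspace (mtopology_of Y)" "y \<in> topspace (mtopology_of Y)" "(f (p x), g x) = (f (p y), g y)"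
      then show "flow_dist Y \<eta> N x y < \<epsilon>" using g(2)[of x y] C(4)[OF pX pX, of x y] by simp
    qed
  qed
  have W1: "flow_Widim X \<phi> \<epsilon> N \<le> flow_Widim Y \<eta> \<epsilon> N" if N: "0 \<le> N" for \<epsilon> N
    unfolding flow_Widim_eq[OF X N] flow_Widim_eq[OF Y N] using 1[OF N] by (intro INF_superset_mono) auto
  have W2: "flow_Widim Y \<eta> \<epsilon> N \<le> flow_Widim X \<phi> \<epsilon> N + 2" if N: "0 \<le> N" and e: "0 < \<epsilon>" for \<epsilon> N
  proof -
    have "flow_Widim Y \<eta> \<epsilon> N - 2 \<le> flow_Widim X \<phi> \<epsilon> N"
      unfolding flow_Widim_eq[OF X N]
    proof (rule INF_greatest, clarify)
      fix n assume "flow_small_width X \<phi> \<epsilon> N n"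
      from flow_Widim_le[OF Y N 2[OF N e this]] show "flow_Widim Y \<eta> \<epsilon> N - 2 \<le> ereal (of_int n)"
        by (cases "flow_Widim Y \<eta> \<epsilon> N") (auto simp: numeral_eq_ereal)
    qed
    then show ?thesis by (cases "flow_Widim Y \<eta> \<epsilon> N"; cases "flow_Widim X \<phi> \<epsilon> N") (auto simp: numeral_eq_ereal)
  qed
  have "(INF N\<in>{0<..}. flow_Widim Y \<eta> \<epsilon> N / ereal N) = (INF N\<in>{0<..}. flow_Widim X \<phi> \<epsilon> N / ereal N)" (is "?y = ?x")
    if e: "0 < \<epsilon>" for \<epsilon>
  proof (rule antisym)
    show "?x \<le> ?y"
      using W1 by (intro INF_mono) (force intro: ereal_divide_right_mono)
    have lim: "((\<lambda>N. flow_Widim X \<phi> \<epsilon> N / ereal N + ereal (2 / N)) \<longlongrightarrow> ?x + ereal 0) at_top"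
    proof (rule tendsto_add_ereal_general1[OF _ flow_Widim_tendsto[OF X ne]])
      have "((\<lambda>N::real. 2 / N) \<longlongrightarrow> 0) at_top" by real_asymp
      then show "((\<lambda>N. ereal (2 / N)) \<longlongrightarrow> ereal 0) at_top" by simp
    qed simp
    have "?y \<le> ?x + ereal 0"
    proof (rule tendsto_le[OF _ lim flow_Widim_tendsto[OF Y neY]])
      show "\<forall>\<^sub>F N in at_top. flow_Widim Y \<eta> \<epsilon> N / ereal N \<le> flow_Widim X \<phi> \<epsilon> N / ereal N + ereal (2 / N)"
        using eventually_gt_at_top[of 0]
      proof eventually_elim
        case (elim N)
        have "flow_Widim Y \<eta> \<epsilon> N / ereal N \<le> (flow_Widim X \<phi> \<epsilon> N + 2) / ereal N"
          using W2[of N \<epsilon>] e elim by (intro ereal_divide_right_mono) auto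
        also have "\<dots> = flow_Widim X \<phi> \<epsilon> N / ereal N + ereal (2 / N)"
          using elim flow_Widim_nonneg[OF X _ ne, of N \<epsilon>]
          by (cases "flow_Widim X \<phi> \<epsilon> N") (auto simp: numeral_eq_ereal add_divide_distrib)
        finally show ?case .
      qed
    qed simp
    then show "?y \<le> ?x" by (simp add: zero_ereal_def[symmetric])
  qed
  then show ?thesis unfolding mdim_eq[OF X ne] mdim_eq[OF Y neY] by (intro SUP_cong) auto
qed

section \<open>The dyadic solenoid\<close>

text \<open>A continuous map from a compact space to a Hausdorff space is closed, hence a quotient
  map onto its image. In this way periodic functions descend to the circle.\<close>

lemma continuous_on_compact_quotient:
  fixes F :: "'a::t2_space \<Rightarrow> 'b::t2_space" and g :: "'b \<Rightarrow> 'c::topological_space"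
  assumes "compact A" "continuous_on A F" "continuous_on A (\<lambda>x. g (F x))"
  shows "continuous_on (F ` A) g"
  unfolding continuous_on_closed_invariant
proof (intro allI impI)
  fix B :: "'c set" assume B: "closed B"
  have "closed (A \<inter> (\<lambda>x. g (F x)) -` B)"
    using continuous_closed_preimage[OF assms(3) compact_imp_closed[OF assms(1)] B] .
  then have "compact (A \<inter> (A \<inter> (\<lambda>x. g (F x)) -` B))" using assms(1) by (intro compact_Int_closed)
  then have "compact (F ` (A \<inter> (A \<inter> (\<lambda>x. g (F x)) -` B)))"
    by (intro compact_continuous_image continuous_on_subset[OF assms(2)]) auto
  then show "\<exists>C. closed C \<and> C \<inter> F ` A = g -` B \<inter> F ` A"
    by (intro exI[of _ "F ` (A \<inter> (A \<inter> (\<lambda>x. g (F x)) -` B))"]) (auto simp: compact_imp_closed)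
qed

definition solenoid :: "(nat \<Rightarrow> complex) set" where
  "solenoid = {z. \<forall>k. norm (z k) = 1 \<and> (z (Suc k))\<^sup>2 = z k}"

text \<open>Coordinate \<open>k\<close> is a clock of period 2^k.\<close>

definition rot :: "real \<Rightarrow> (nat \<Rightarrow> complex) \<Rightarrow> nat \<Rightarrow> complex" where
  "rot r z = (\<lambda>k. cis (2 * pi * r / 2 ^ k) * z k)"

lemma continuous_on_coordinate: "continuous_on S (\<lambda>z::nat \<Rightarrow> complex. z k)"
  by (rule continuous_on_subset[OF continuous_on_product_coordinates]) auto

lemma compact_solenoid: "compact solenoid"
proof -
  have "closed solenoid"
    unfolding solenoid_def
    by (intro closed_Collect_all closed_Collect_conj closed_Collect_eq continuous_intros continuous_on_coordinate)
  moreover have "compact (PiE UNIV (\<lambda>_::nat. sphere (0::complex) 1))"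
    using compactin_PiE[of "\<lambda>_. euclidean" UNIV "\<lambda>_::nat. sphere (0::complex) 1"]
    by (simp add: euclidean_product_topology)
  moreover have "solenoid \<subseteq> PiE UNIV (\<lambda>_. sphere 0 1)" by (auto simp: solenoid_def)
  ultimately show ?thesis using compact_Int_closed[of "PiE UNIV (\<lambda>_::nat. sphere (0::complex) 1)" solenoid]
    by (simp add: Int_absorb1)
qed

lemma one_solenoid: "(\<lambda>_. 1) \<in> solenoid"
  by (simp add: solenoid_def)

lemma rot_solenoid: "z \<in> solenoid \<Longrightarrow> rot r z \<in> solenoid"
proof -
  have "(cis (2 * pi * r / 2 ^ Suc k))\<^sup>2 = cis (2 * pi * r / 2 ^ k)" for k
    unfolding power2_eq_square cis_mult by (simp add: mult.assoc)
  then show "z \<in> solenoid \<Longrightarrow> rot r z \<in> solenoid"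
    by (simp add: solenoid_def rot_def norm_mult power_mult_distrib del: power_Suc)
qed

lemma rot_rot: "rot r (rot s z) = rot (r + s) z"
  by (auto simp: rot_def cis_mult mult.assoc[symmetric] add_divide_distrib distrib_left)

text \<open>Multiplication by a unit complex number preserves each coordinate distance, and the
  metric on functions is built from these. The solenoid part of a distance is therefore constant
  along orbits, whatever the length of the window.\<close>

lemma dist_rot: "dist (rot r z) (rot r w) = dist z w"
proof -
  have "dist (rot r z k) (rot r w k) = dist (z k) (w k)" for k
    by (simp add: rot_def dist_norm right_diff_distrib[symmetric] norm_mult)
  then show ?thesis by (simp add: dist_fun_def)
qed

lemma continuous_on_rot: "continuous_on S (\<lambda>(r, z). rot r z)"
proof -
  have "continuous_on S (\<lambda>p. cis (2 * pi * fst p / 2 ^ k) * snd p k)" for k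
    by (intro continuous_intros continuous_on_compose2[OF continuous_on_coordinate[of UNIV]]) auto
  then show ?thesis
    unfolding rot_def case_prod_unfold by (rule continuous_on_coordinatewise_then_product)
qed

lemma solenoid_power:
  assumes "z \<in> solenoid"
  shows "z (k + j) ^ (2 ^ j) = z k"
proof (induction j)
  case (Suc j)
  have "z (k + Suc j) ^ (2 ^ Suc j) = ((z (Suc (k + j)))\<^sup>2) ^ (2 ^ j)"
    by (simp flip: power_mult)
  then show ?case using Suc assms by (simp add: solenoid_def)
qed simp

lemma solenoid_coordinate_eq:
  assumes "z \<in> solenoid" "w \<in> solenoid" "z k = w k" "j \<le> k"
  shows "z j = w j"
  using solenoid_power[OF assms(1), of j "k - j"] solenoid_power[OF assms(2), of j "k - j"] assms by simp

text \<open>Up to \<epsilon> the product metric sees finitely many coordinates, and by repeated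
  squaring the last of them determines the others. A single circle coordinate thus resolves the
  solenoid at scale \<epsilon>.\<close>

lemma solenoid_close:
  assumes "0 < \<epsilon>"
  obtains k where "\<And>z w. z \<in> solenoid \<Longrightarrow> w \<in> solenoid \<Longrightarrow> z k = w k \<Longrightarrow> dist z w < \<epsilon>"
proof -
  obtain N where N: "(1/2::real) ^ N < \<epsilon>" using real_arch_pow_inv[OF assms, of "1/2"] by auto
  \<comment> \<open>The metric on functions enumerates the index type through
    \<open>from_nat\<close>; the maximum is the latest coordinate among the relevant ones.\<close>
  let ?A = "(from_nat :: nat \<Rightarrow> nat) ` {..N}"
  show thesis
  proof (rule that[of "Max ?A"])
    fix z w assume zw: "z \<in> solenoid" "w \<in> solenoid" "z (Max ?A) = w (Max ?A)"
    have "z (from_nat n) = w (from_nat n)" if "n \<le> N" for n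
      using that by (intro solenoid_coordinate_eq[OF zw]) (auto intro: Max_ge)
    then have "{dist (z (from_nat n)) (w (from_nat n)) |n. n \<le> N} = {0}"
      by (auto intro!: exI[of _ 0])
    then show "dist z w < \<epsilon>" using dist_fun_le_dist_first_terms[of z w N] N by simp
  qed
qed

text \<open>A discontinuous lift of \<open>z k\<close> from the circle to the line, measured in
  units of time. It is plugged only into functions for which 2^k is a period, where the jump is
  invisible.\<close>

definition phase :: "nat \<Rightarrow> (nat \<Rightarrow> complex) \<Rightarrow> real" where
  "phase k z = 2 ^ k * Arg (z k) / (2 * pi)"

lemma cis_phase:
  assumes "z \<in> solenoid"
  shows "cis (2 * pi * phase k z / 2 ^ k) = z k"
proof -
  have "norm (z k) = 1" using assms by (simp add: solenoid_def)
  then show ?thesis using rcis_cmod_Arg[of "z k"] by (simp add: phase_def rcis_def)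
qed

text \<open>The phase of a late coordinate is also a lift of every earlier one; this makes maps
  built at different stages comparable.\<close>

lemma cis_phase_le:
  assumes "z \<in> solenoid" "j \<le> k"
  shows "cis (2 * pi * phase k z / 2 ^ j) = z j"
proof -
  have "(2::real) ^ k = 2 ^ j * 2 ^ (k - j)" using assms(2) by (simp flip: power_add)
  then have "2 * pi * phase k z / 2 ^ j = real (2 ^ (k - j)) * (2 * pi * phase k z / 2 ^ k)" by simp
  then have "cis (2 * pi * phase k z / 2 ^ j) = cis (2 * pi * phase k z / 2 ^ k) ^ (2 ^ (k - j))"
    by (simp only: Complex.DeMoivre)
  then show ?thesis using solenoid_power[OF assms(1), of j "k - j"] assms by (simp add: cis_phase)
qed

lemma periodic_int:
  fixes c :: "real \<Rightarrow> 'a"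
  assumes "\<And>\<theta>. c (\<theta> + T) = c \<theta>"
  shows "c (\<theta> + of_int n * T) = c \<theta>"
proof -
  have nat: "c (\<theta> + real n * T) = c \<theta>" for n \<theta>
  proof (induction n)
    case (Suc n)
    have "c (\<theta> + real (Suc n) * T) = c ((\<theta> + real n * T) + T)" by (simp add: algebra_simps)
    then show ?case using Suc assms by simp
  qed simp
  show ?thesis
  proof (cases "0 \<le> n")
    case True
    then show ?thesis using nat[of \<theta> "nat n"] by simp
  next
    case False
    then show ?thesis using nat[of "\<theta> + of_int n * T" "nat (- n)"] by (simp add: algebra_simps)
  qed
qed

lemma periodic_cis:
  fixes c :: "real \<Rightarrow> 'a"
  assumes "\<And>\<theta>. c (\<theta> + T) = c \<theta>" "0 < T" "cis (2 * pi * \<theta> / T) = cis (2 * pi * \<theta>' / T)"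
  shows "c \<theta> = c \<theta>'"
proof -
  have "cis (2 * pi * \<theta> / T - 2 * pi * \<theta>' / T) = 1" using assms(3) by (simp flip: cis_divide)
  then have "cos (2 * pi * \<theta> / T - 2 * pi * \<theta>' / T) = 1" by (simp add: complex_eq_iff)
  then obtain n :: int where "2 * pi * \<theta> / T - 2 * pi * \<theta>' / T = of_int n * 2 * pi"
    by (auto simp: cos_one_2pi_int)
  then have "2 * pi * (\<theta> / T - \<theta>' / T) = 2 * pi * of_int n" by (simp add: algebra_simps)
  then have "\<theta> / T - \<theta>' / T = of_int n" by simp
  then have "\<theta> = \<theta>' + of_int n * T" using assms(2) by (simp add: field_simps)
  then show ?thesis using periodic_int[of c T, OF assms(1)] by simp
qed

text \<open>By periodicity the function factors through the circle, and the factor is continuous by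
  the quotient argument; the jump of \<open>Arg\<close> disappears.\<close>

lemma continuous_on_phase:
  fixes X :: "'b::metric_space set" and c :: "'b \<Rightarrow> real \<Rightarrow> complex"
  assumes X: "compact X" and c: "continuous_on (X \<times> UNIV) (\<lambda>(x, \<theta>). c x \<theta>)"
    and per: "\<And>x \<theta>. x \<in> X \<Longrightarrow> c x (\<theta> + 2 ^ k) = c x \<theta>"
  shows "continuous_on (X \<times> solenoid) (\<lambda>(x, z). c x (phase k z))"
proof -
  let ?F = "\<lambda>(x, \<theta>). (x, cis (2 * pi * \<theta> / 2 ^ k))"
  let ?g = "\<lambda>(x, w). c x (2 ^ k * Arg w / (2 * pi))"
  have eq: "?g (?F (x, \<theta>)) = c x \<theta>" if "x \<in> X" for x \<theta>
  proof -
    have p: "cis (2 * pi * (2 ^ k * Arg (cis (2 * pi * \<theta> / 2 ^ k)) / (2 * pi)) / 2 ^ k) = cis (2 * pi * \<theta> / 2 ^ k)"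
      using rcis_cmod_Arg[of "cis (2 * pi * \<theta> / 2 ^ k)"] by (simp add: rcis_def)
    have "c x (2 ^ k * Arg (cis (2 * pi * \<theta> / 2 ^ k)) / (2 * pi)) = c x \<theta>"
      by (rule periodic_cis[where c="c x" and T="2 ^ k", OF per[OF that] _ p]) simp
    then show ?thesis by simp
  qed
  have g: "continuous_on (?F ` (X \<times> {-(2^k)..2^k})) ?g"
  proof (rule continuous_on_compact_quotient)
    show "compact (X \<times> {-(2^k)..2^k::real})" using X by (intro compact_Times) auto
    show "continuous_on (X \<times> {-(2^k)..2^k}) ?F"
      unfolding case_prod_unfold by (intro continuous_intros) auto
    have "continuous_on (X \<times> {-(2^k)..2^k}) (\<lambda>(x, \<theta>). c x \<theta>)" by (rule continuous_on_subset[OF c]) auto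
    then show "continuous_on (X \<times> {-(2^k)..2^k}) (\<lambda>p. ?g (?F p))"
      by (rule continuous_on_eq) (use eq in auto)
  qed
  have mem: "(x, z k) \<in> ?F ` (X \<times> {-(2^k)..2^k})" if "x \<in> X" "z \<in> solenoid" for x z
  proof -
    have "- 1 \<le> Arg (z k) / (2 * pi)" "Arg (z k) / (2 * pi) \<le> 1"
      using Arg_bounded[of "z k"] pi_gt_zero by (auto simp: field_simps)
    then have "2 ^ k * - 1 \<le> 2 ^ k * (Arg (z k) / (2 * pi))" "2 ^ k * (Arg (z k) / (2 * pi)) \<le> 2 ^ k * 1"
      by (intro mult_left_mono; simp)+
    then have "phase k z \<in> {-(2^k)..2^k}" by (simp add: phase_def)
    then have "?F (x, phase k z) \<in> ?F ` (X \<times> {-(2^k)..2^k})" using that(1) by (intro imageI SigmaI)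
    then show ?thesis using cis_phase[OF that(2), of k] by simp
  qed
  have "continuous_on (X \<times> solenoid) (\<lambda>p. (fst p, snd p k))"
    by (intro continuous_intros continuous_on_compose2[OF continuous_on_coordinate[of UNIV]]) auto
  then have "continuous_on (X \<times> solenoid) (\<lambda>p. ?g (fst p, snd p k))"
    by (rule continuous_on_compose2[OF g]) (use mem in auto)
  then show ?thesis by (simp add: case_prod_unfold phase_def)
qed

section \<open>Vectors in general position\<close>

text \<open>Fewer equations than unknowns, by Gaussian elimination: an equation with a nonzero
  coefficient is solved for that unknown, and \<open>b\<close> is the system that remains.\<close>

lemma exists_annihilating_functional:
  fixes a :: "'i \<Rightarrow> 'j \<Rightarrow> real"
  assumes "finite I" "finite J" "card I < card J"
  shows "\<exists>l. (\<exists>j\<in>J. l j \<noteq> 0) \<and> (\<forall>i\<in>I. (\<Sum>j\<in>J. l j * a i j) = 0)"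
  using assms
proof (induction I arbitrary: J a rule: finite_induct)
  case empty
  then have "J \<noteq> {}" by auto
  then show ?case by (intro exI[of _ "\<lambda>_. 1"]) auto
next
  case (insert i0 I)
  show ?case
  proof (cases "\<forall>j\<in>J. a i0 j = 0")
    case True
    from insert obtain l where "\<exists>j\<in>J. l j \<noteq> 0" "\<forall>i\<in>I. (\<Sum>j\<in>J. l j * a i j) = 0"
      using insert.IH[of J a] by fastforce
    then show ?thesis using True by (intro exI[of _ l]) auto
  next
    case False
    then obtain j0 where j0: "j0 \<in> J" "a i0 j0 \<noteq> 0" by blast
    let ?J = "J - {j0}"
    define b where "b i j = a i j - a i j0 * (a i0 j / a i0 j0)" for i j
    have "card I < card ?J" using insert j0 by (simp add: card_Diff_singleton)
    then obtain l where l: "\<exists>j\<in>?J. l j \<noteq> 0" "\<forall>i\<in>I. (\<Sum>j\<in>?J. l j * b i j) = 0"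
      using insert.IH[of ?J b] insert.prems by auto
    define s where "s = (\<Sum>j\<in>?J. l j * (a i0 j / a i0 j0))"
    define l' where "l' = l(j0 := - s)"
    have split: "(\<Sum>j\<in>J. l' j * a i j) = - s * a i j0 + (\<Sum>j\<in>?J. l j * a i j)" for i
    proof -
      have "(\<Sum>j\<in>J. l' j * a i j) = l' j0 * a i j0 + (\<Sum>j\<in>?J. l' j * a i j)"
        using insert.prems j0 by (simp add: sum.remove)
      also have "(\<Sum>j\<in>?J. l' j * a i j) = (\<Sum>j\<in>?J. l j * a i j)"
        by (intro sum.cong) (auto simp: l'_def)
      finally show ?thesis by (simp add: l'_def)
    qed
    have "(\<Sum>j\<in>?J. l j * a i j) = s * a i j0 + (\<Sum>j\<in>?J. l j * b i j)" for i
      unfolding s_def b_def sum_distrib_right sum.distrib[symmetric] by (intro sum.cong) (auto simp: algebra_simps)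
    moreover have "(\<Sum>j\<in>?J. l j * b i0 j) = 0" using j0 by (simp add: b_def)
    ultimately have "\<forall>i\<in>insert i0 I. (\<Sum>j\<in>J. l' j * a i j) = 0" using l(2) unfolding split by auto
    moreover have "\<exists>j\<in>J. l' j \<noteq> 0" using l(1) by (auto simp: l'_def)
    ultimately show ?thesis by blast
  qed
qed

text \<open>The hyperplanes are avoided one after the other by moving a single coordinate a little;
  only finitely many shifts are bad.\<close>

lemma exists_avoiding_hyperplanes:
  fixes u :: "'j \<Rightarrow> real"
  assumes "finite \<L>" "finite J" "0 < \<delta>" "\<And>l. l \<in> \<L> \<Longrightarrow> \<exists>j\<in>J. l j \<noteq> 0"
  shows "\<exists>w. (\<forall>j. \<bar>w j - u j\<bar> < \<delta>) \<and> (\<forall>l\<in>\<L>. (\<Sum>j\<in>J. l j * w j) \<noteq> 0)"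
  using assms(1,4)
proof (induction rule: finite_induct)
  case empty
  then show ?case using assms(3) by (intro exI[of _ u]) auto
next
  case (insert l \<L>)
  then obtain w where w: "\<And>j. \<bar>w j - u j\<bar> < \<delta>" "\<And>l. l \<in> \<L> \<Longrightarrow> (\<Sum>j\<in>J. l j * w j) \<noteq> 0" by blast
  obtain j0 where j0: "j0 \<in> J" "l j0 \<noteq> 0" using insert.prems by blast
  define h where "h = \<delta> - \<bar>w j0 - u j0\<bar>"
  have h: "0 < h" using w(1)[of j0] by (simp add: h_def)
  have "infinite {0<..<h}" using h by (rule infinite_Ioo)
  \<comment> \<open>The functionals treated before are listed too, so that they stay nonzero. One
    with coefficient 0 at \<open>j0\<close> contributes the value 0, which a positive shift avoids
    anyway.\<close>
  moreover have "finite ((\<lambda>l. - (\<Sum>j\<in>J. l j * w j) / l j0) ` insert l \<L>)" using insert by auto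
  ultimately have "{0<..<h} - (\<lambda>l. - (\<Sum>j\<in>J. l j * w j) / l j0) ` insert l \<L> \<noteq> {}"
    using Diff_infinite_finite infinite_imp_nonempty by blast
  then obtain s where s0: "s \<in> {0<..<h}" "s \<notin> (\<lambda>l. - (\<Sum>j\<in>J. l j * w j) / l j0) ` insert l \<L>"
    by blast
  have s: "0 < s" "s < h" using s0(1) by auto
  have s3: "s \<noteq> - (\<Sum>j\<in>J. l' j * w j) / l' j0" if "l' \<in> insert l \<L>" for l'
    using s0(2) imageI[OF that, of "\<lambda>l. - (\<Sum>j\<in>J. l j * w j) / l j0"] by metis
  define w' where "w' = w(j0 := w j0 + s)"
  have sum: "(\<Sum>j\<in>J. l' j * w' j) = (\<Sum>j\<in>J. l' j * w j) + l' j0 * s" for l'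
  proof -
    have "(\<Sum>j\<in>J. l' j * w' j) = l' j0 * w' j0 + (\<Sum>j\<in>J - {j0}. l' j * w' j)"
      using assms(2) j0 by (simp add: sum.remove)
    also have "(\<Sum>j\<in>J - {j0}. l' j * w' j) = (\<Sum>j\<in>J - {j0}. l' j * w j)"
      by (intro sum.cong) (auto simp: w'_def)
    also have "l' j0 * w' j0 + \<dots> = (l' j0 * w j0 + (\<Sum>j\<in>J - {j0}. l' j * w j)) + l' j0 * s"
      by (simp add: w'_def algebra_simps)
    also have "l' j0 * w j0 + (\<Sum>j\<in>J - {j0}. l' j * w j) = (\<Sum>j\<in>J. l' j * w j)"
      using assms(2) j0 by (simp add: sum.remove)
    finally show ?thesis .
  qed
  show ?case
  proof (intro exI[of _ w'] conjI allI ballI)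
    show "\<bar>w' j - u j\<bar> < \<delta>" for j using w(1)[of j] s by (auto simp: w'_def h_def)
    show "(\<Sum>j\<in>J. l' j * w' j) \<noteq> 0" if "l' \<in> insert l \<L>" for l'
    proof (cases "l' j0 = 0")
      case True
      then have "l' \<in> \<L>" using that j0 by auto
      then show ?thesis using w(2) True unfolding sum by simp
    next
      case False
      then show ?thesis using s3[OF that] unfolding sum by (auto simp: field_simps add_eq_0_iff)
    qed
  qed
qed

text \<open>For each set of fewer than \<open>card J\<close> old vectors the new vector is kept off
  a hyperplane that contains the set. A short relation in which the new vector occurs would put it
  on such a hyperplane.\<close>

lemma exists_general_position:
  fixes u :: "'i \<Rightarrow> 'j \<Rightarrow> real"
  assumes "finite I" "finite J" "0 < \<delta>"
  shows "\<exists>v. (\<forall>i j. \<bar>v i j - u i j\<bar> < \<delta>) \<and>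
    (\<forall>c. card {i\<in>I. c i \<noteq> 0} \<le> card J \<longrightarrow> (\<forall>j\<in>J. (\<Sum>i\<in>I. c i * v i j) = 0) \<longrightarrow> (\<forall>i\<in>I. c i = 0))"
  using assms(1)
proof (induction rule: finite_induct)
  case empty
  then show ?case using assms(3) by (intro exI[of _ u]) auto
next
  case (insert i0 I)
  then obtain v where v: "\<And>i j. \<bar>v i j - u i j\<bar> < \<delta>"
    "\<And>c. card {i\<in>I. c i \<noteq> 0} \<le> card J \<Longrightarrow> (\<forall>j\<in>J. (\<Sum>i\<in>I. c i * v i j) = 0) \<Longrightarrow> (\<forall>i\<in>I. c i = 0)" by blast
  define \<A> where "\<A> = {A. A \<subseteq> I \<and> card A < card J}"
  have fA: "finite \<A>" unfolding \<A>_def using insert by auto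
  have "\<forall>A\<in>\<A>. \<exists>l. (\<exists>j\<in>J. l j \<noteq> 0) \<and> (\<forall>i\<in>A. (\<Sum>j\<in>J. l j * v i j) = 0)"
    using exists_annihilating_functional[OF _ assms(2)] insert.hyps(1) finite_subset unfolding \<A>_def by blast
  then obtain l where l: "\<And>A. A \<in> \<A> \<Longrightarrow> \<exists>j\<in>J. l A j \<noteq> 0" "\<And>A i. A \<in> \<A> \<Longrightarrow> i \<in> A \<Longrightarrow> (\<Sum>j\<in>J. l A j * v i j) = 0"
    by metis
  have "\<exists>w. (\<forall>j. \<bar>w j - u i0 j\<bar> < \<delta>) \<and> (\<forall>l\<in>l ` \<A>. (\<Sum>j\<in>J. l j * w j) \<noteq> 0)"
    by (rule exists_avoiding_hyperplanes) (use fA assms l(1) in auto)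
  then obtain w where w: "\<And>j. \<bar>w j - u i0 j\<bar> < \<delta>" "\<And>A. A \<in> \<A> \<Longrightarrow> (\<Sum>j\<in>J. l A j * w j) \<noteq> 0" by auto
  show ?case
  proof (intro exI[of _ "v(i0 := w)"] conjI allI impI)
    show "\<bar>(v(i0 := w)) i j - u i j\<bar> < \<delta>" for i j using v(1) w(1) by auto
    fix c assume c: "card {i \<in> insert i0 I. c i \<noteq> 0} \<le> card J"
      and z: "\<forall>j\<in>J. (\<Sum>i\<in>insert i0 I. c i * (v(i0 := w)) i j) = 0"
    have eq: "(\<Sum>i\<in>insert i0 I. c i * (v(i0 := w)) i j) = c i0 * w j + (\<Sum>i\<in>I. c i * v i j)" for j
      using insert.hyps by (simp, intro sum.cong) auto
    have c0: "c i0 = 0"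
    proof (rule ccontr)
      assume c0: "c i0 \<noteq> 0"
      let ?A = "{i\<in>I. c i \<noteq> 0}"
      have "{i \<in> insert i0 I. c i \<noteq> 0} = insert i0 ?A" using c0 by auto
      then have A: "?A \<in> \<A>" using c insert.hyps by (simp add: \<A>_def)
      have "0 = (\<Sum>j\<in>J. l ?A j * (c i0 * w j + (\<Sum>i\<in>I. c i * v i j)))" using z unfolding eq by simp
      also have "\<dots> = c i0 * (\<Sum>j\<in>J. l ?A j * w j) + (\<Sum>j\<in>J. \<Sum>i\<in>I. c i * (l ?A j * v i j))"
        by (simp add: distrib_left sum.distrib sum_distrib_left sum_distrib_right mult_ac)
      also have "(\<Sum>j\<in>J. \<Sum>i\<in>I. c i * (l ?A j * v i j)) = (\<Sum>i\<in>I. c i * (\<Sum>j\<in>J. l ?A j * v i j))"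
        unfolding sum_distrib_left by (rule sum.swap)
      also have "\<dots> = 0" using l(2)[OF A] by (intro sum.neutral) auto
      finally show False using w(2)[OF A] c0 by simp
    qed
    have "{i \<in> insert i0 I. c i \<noteq> 0} = {i \<in> I. c i \<noteq> 0}" using c0 by auto
    with c have "card {i \<in> I. c i \<noteq> 0} \<le> card J" by (simp only:)
    moreover have "\<forall>j\<in>J. (\<Sum>i\<in>I. c i * v i j) = 0" using z unfolding eq c0 by simp
    ultimately have "\<forall>i\<in>I. c i = 0" by (rule v(2))
    then show "\<forall>i\<in>insert i0 I. c i = 0" using c0 by simp
  qed
qed

text \<open>The values of \<open>G\<close> are convex combinations of vectors in general position. Two combinations with at
  most \<open>m\<close> nonzero weights each differ by at most \<open>2 * m\<close> terms, the real dimension of \<open>\<complex>\<^sup>m\<close>, so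
  they agree only if their weights do.\<close>

lemma exists_separating_approximation:
  fixes F :: "nat \<Rightarrow> 'b::metric_space \<Rightarrow> complex" and p :: "'i \<Rightarrow> 'b \<Rightarrow> real"
  assumes I: "finite I" and \<delta>: "0 < \<delta>"
    and p: "\<And>i. i \<in> I \<Longrightarrow> continuous_on X (p i)" "\<And>i x. i \<in> I \<Longrightarrow> x \<in> X \<Longrightarrow> 0 \<le> p i x"
      "\<And>x. x \<in> X \<Longrightarrow> (\<Sum>i\<in>I. p i x) = 1"
      "\<And>x. x \<in> X \<Longrightarrow> card {i\<in>I. p i x \<noteq> 0} \<le> m"
    and F: "\<And>i x y j. i \<in> I \<Longrightarrow> x \<in> X \<Longrightarrow> y \<in> X \<Longrightarrow> p i x \<noteq> 0 \<Longrightarrow> p i y \<noteq> 0 \<Longrightarrow> j < m \<Longrightarrow> norm (F j x - F j y) \<le> \<delta>"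
  obtains G :: "nat \<Rightarrow> 'b \<Rightarrow> complex" where "\<And>j. continuous_on X (G j)"
    "\<And>j x. j < m \<Longrightarrow> x \<in> X \<Longrightarrow> norm (G j x - F j x) \<le> 3 * \<delta>"
    "\<And>x y. x \<in> X \<Longrightarrow> y \<in> X \<Longrightarrow> \<forall>j<m. G j x = G j y \<Longrightarrow> \<exists>i\<in>I. p i x \<noteq> 0 \<and> p i y \<noteq> 0"
proof -
  \<comment> \<open>A sample point at which the weight \<open>p i\<close> is nonzero; the vector
    attached to \<open>i\<close> is a perturbation of the values of F there.\<close>
  define x0 where "x0 i = (SOME x. x \<in> X \<and> p i x \<noteq> 0)" for i
  have x0: "x0 i \<in> X \<and> p i (x0 i) \<noteq> 0" if "x \<in> X" "p i x \<noteq> 0" for i x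
    unfolding x0_def using someI[of "\<lambda>x. x \<in> X \<and> p i x \<noteq> 0"] that by blast
  \<comment> \<open>Real and imaginary parts of the m complex coordinates.\<close>
  define J where "J = {..<m} \<times> (UNIV :: bool set)"
  have J: "finite J" "card J = 2 * m" by (auto simp: J_def card_cartesian_product)
  define u where "u i = (\<lambda>(j, b). if b then Re (F j (x0 i)) else Im (F j (x0 i)))" for i
  obtain v where v: "\<And>i j. \<bar>v i j - u i j\<bar> < \<delta>"
    "\<And>c. card {i\<in>I. c i \<noteq> 0} \<le> card J \<Longrightarrow> (\<forall>j\<in>J. (\<Sum>i\<in>I. c i * v i j) = 0) \<Longrightarrow> (\<forall>i\<in>I. c i = 0)"
    using exists_general_position[OF I J(1) \<delta>, of u] by blast
  define w where "w i j = Complex (v i (j, True)) (v i (j, False))" for i j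
  have w: "norm (w i j - F j (x0 i)) \<le> 2 * \<delta>" for i j
  proof -
    have "norm (w i j - F j (x0 i)) \<le> \<bar>Re (w i j - F j (x0 i))\<bar> + \<bar>Im (w i j - F j (x0 i))\<bar>"
      by (rule cmod_le)
    also have "\<dots> \<le> 2 * \<delta>" using v(1)[of i "(j, True)"] v(1)[of i "(j, False)"] by (simp add: w_def u_def)
    finally show ?thesis .
  qed
  define G where "G j x = (\<Sum>i\<in>I. of_real (p i x) * w i j)" for j x
  show thesis
  proof
    show "continuous_on X (G j)" for j unfolding G_def by (intro continuous_intros p(1))
    \<comment> \<open>Of the 3 \<delta>, two come from perturbing the real and the imaginary part
      and one from the variation of F where \<open>p i\<close> is nonzero.\<close>
    show "norm (G j x - F j x) \<le> 3 * \<delta>" if jx: "j < m" "x \<in> X" for j x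
    proof -
      have Fx: "F j x = (\<Sum>i\<in>I. of_real (p i x) * F j x)"
        using p(3)[OF jx(2)] by (simp flip: sum_distrib_right of_real_sum)
      then have "norm (G j x - F j x) = norm (\<Sum>i\<in>I. of_real (p i x) * (w i j - F j x))"
        by (simp only: G_def right_diff_distrib sum_subtractf flip: Fx)
      also have "\<dots> \<le> (\<Sum>i\<in>I. p i x * (3 * \<delta>))"
      proof (rule sum_norm_le)
        fix i assume i: "i \<in> I"
        show "norm (of_real (p i x) * (w i j - F j x)) \<le> p i x * (3 * \<delta>)"
        proof (cases "p i x = 0")
          case False
          have "norm (w i j - F j x) \<le> norm (w i j - F j (x0 i)) + norm (F j (x0 i) - F j x)"
            using norm_triangle_ineq[of "w i j - F j (x0 i)" "F j (x0 i) - F j x"] by simp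
          also have "\<dots> \<le> 3 * \<delta>" using w[of i j] F[OF i _ jx(2) _ False jx(1), of "x0 i"] x0[OF jx(2) False] by auto
          finally show ?thesis using p(2)[OF i jx(2)] by (simp add: norm_mult mult_left_mono)
        qed simp
      qed
      also have "\<dots> = 3 * \<delta>" using p(3)[OF jx(2)] by (simp flip: sum_distrib_right)
      finally show ?thesis .
    qed
    fix x y assume xy: "x \<in> X" "y \<in> X" "\<forall>j<m. G j x = G j y"
    have fin: "finite {i\<in>I. p i z \<noteq> 0}" for z using I by simp
    have "{i\<in>I. p i x - p i y \<noteq> 0} \<subseteq> {i\<in>I. p i x \<noteq> 0} \<union> {i\<in>I. p i y \<noteq> 0}" by auto
    then have "card {i\<in>I. p i x - p i y \<noteq> 0} \<le> card {i\<in>I. p i x \<noteq> 0} + card {i\<in>I. p i y \<noteq> 0}"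
      using fin by (meson card_Un_le card_mono finite_UnI order_trans)
    then have "card {i\<in>I. p i x - p i y \<noteq> 0} \<le> card J" using p(4)[OF xy(1)] p(4)[OF xy(2)] J by linarith
    moreover have "\<forall>k\<in>J. (\<Sum>i\<in>I. (p i x - p i y) * v i k) = 0"
    proof
      fix k assume "k \<in> J"
      then obtain j b where k: "k = (j, b)" "j < m" by (auto simp: J_def)
      have "(\<Sum>i\<in>I. of_real (p i x - p i y) * w i j) = 0"
        using xy(3) k(2) by (simp add: G_def left_diff_distrib sum_subtractf)
      then have "Re (\<Sum>i\<in>I. of_real (p i x - p i y) * w i j) = 0" "Im (\<Sum>i\<in>I. of_real (p i x - p i y) * w i j) = 0"
        by simp_all
      then show "(\<Sum>i\<in>I. (p i x - p i y) * v i k) = 0"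
        unfolding k(1) by (cases b) (simp_all add: w_def)
    qed
    ultimately have eq: "\<forall>i\<in>I. p i x - p i y = 0" by (rule v(2))
    have "\<exists>i\<in>I. p i x \<noteq> 0"
    proof (rule ccontr)
      assume "\<not> (\<exists>i\<in>I. p i x \<noteq> 0)"
      then have "(\<Sum>i\<in>I. p i x) = 0" by (intro sum.neutral) auto
      then show False using p(3)[OF xy(1)] by simp
    qed
    then show "\<exists>i\<in>I. p i x \<noteq> 0 \<and> p i y \<noteq> 0" using eq by force
  qed
qed

section \<open>Interpolation by band-limited functions\<close>

lemma recip_le_mult_recip: "y \<le> k * x \<Longrightarrow> 0 < x \<Longrightarrow> 0 < y \<Longrightarrow> 1 / x \<le> k * (1 / y)" for x y k :: real
  by (simp add: field_simps)

text \<open>Replacing \<tau> by its integer part changes each term by at most a factor 3 and leaves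
  a sum over the integers whose two halves are at most T each. Independence of \<tau> is what turns
  into a supremum bound for interpolation.\<close>

lemma finite_lattice_sums_bounded:
  obtains S :: real where "0 < S" "\<And>\<tau> F. finite F \<Longrightarrow> (\<Sum>n\<in>F. 1 / (1 + (\<tau> - real_of_int n)\<^sup>2)) \<le> S"
proof -
  let ?h = "\<lambda>k::nat. 1 / (1 + (real k)\<^sup>2)"
  have h: "summable ?h"
  proof (rule summable_comparison_test'[of "\<lambda>k. inverse (real k ^ 2)" 1])
    show "summable (\<lambda>k. inverse (real k ^ 2))" by (rule inverse_power_summable) simp
    show "norm (?h k) \<le> inverse (real k ^ 2)" if "1 \<le> k" for k
      using that by (simp add: field_simps add_pos_nonneg)
  qed
  define T where "T = suminf ?h"
  have part: "sum (\<lambda>n. ?h (f n)) F \<le> T" if "finite F" "inj_on f F" for f :: "int \<Rightarrow> nat" and F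
  proof -
    have "sum (\<lambda>n. ?h (f n)) F = sum ?h (f ` F)" using that by (simp add: sum.reindex)
    also have "\<dots> \<le> T" unfolding T_def by (rule sum_le_suminf[OF h]) (use that in auto)
    finally show ?thesis .
  qed
  have T0: "0 < T" unfolding T_def by (rule suminf_pos[OF h]) (auto intro: add_pos_nonneg)
  have base: "(\<Sum>j\<in>F. 1 / (1 + (of_int j)\<^sup>2)) \<le> 2 * T" if F: "finite F" for F :: "int set"
  proof -
    let ?P = "{j\<in>F. 0 \<le> j}" and ?N = "{j\<in>F. j < 0}"
    have "F = ?P \<union> ?N" by auto
    then have "(\<Sum>j\<in>F. 1 / (1 + (of_int j)\<^sup>2)) = (\<Sum>j\<in>?P. 1 / (1 + (of_int j)\<^sup>2)) + (\<Sum>j\<in>?N. 1 / (1 + (real_of_int j)\<^sup>2))"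
      using F by (subst sum.union_disjoint[symmetric]) auto
    also have "(\<Sum>j\<in>?P. 1 / (1 + (real_of_int j)\<^sup>2)) = (\<Sum>j\<in>?P. ?h (nat j))" by (intro sum.cong) auto
    also have "\<dots> \<le> T" by (rule part) (use F in \<open>auto simp: inj_on_def\<close>)
    also have "(\<Sum>j\<in>?N. 1 / (1 + (real_of_int j)\<^sup>2)) = (\<Sum>j\<in>?N. ?h (nat (- j)))" by (intro sum.cong) auto
    also have "\<dots> \<le> T" by (rule part) (use F in \<open>auto simp: inj_on_def\<close>)
    finally show ?thesis by simp
  qed
  show thesis
  proof (rule that[of "6 * T"])
    fix \<tau> :: real and F :: "int set" assume F: "finite F"
    have "(\<Sum>n\<in>F. 1 / (1 + (\<tau> - real_of_int n)\<^sup>2)) \<le> (\<Sum>n\<in>F. 3 * (1 / (1 + (of_int (n - \<lfloor>\<tau>\<rfloor>))\<^sup>2)))"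
    proof (rule sum_mono)
      fix n
      define f x where "f = \<tau> - of_int \<lfloor>\<tau>\<rfloor>" and "x = \<tau> - of_int n"
      have f: "0 \<le> f" "f \<le> 1" unfolding f_def by linarith+
      have "f\<^sup>2 \<le> 1" using f by (simp add: power_le_one)
      have "(real_of_int (n - \<lfloor>\<tau>\<rfloor>))\<^sup>2 = (f - x)\<^sup>2" by (simp add: f_def x_def)
      also have "\<dots> \<le> 2 * f\<^sup>2 + 2 * x\<^sup>2" using zero_le_power2[of "f + x"] by (simp add: power2_eq_square algebra_simps)
      also have "\<dots> \<le> 2 + 2 * x\<^sup>2" using \<open>f\<^sup>2 \<le> 1\<close> by simp
      finally have "1 + (real_of_int (n - \<lfloor>\<tau>\<rfloor>))\<^sup>2 \<le> 1 + (2 + 2 * x\<^sup>2)" by (rule add_left_mono)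
      also have "\<dots> \<le> 3 * (1 + x\<^sup>2)" by simp
      finally have "1 + (real_of_int (n - \<lfloor>\<tau>\<rfloor>))\<^sup>2 \<le> 3 * (1 + x\<^sup>2)" .
      moreover have "0 < 1 + x\<^sup>2" "0 < 1 + (real_of_int (n - \<lfloor>\<tau>\<rfloor>))\<^sup>2" by (auto intro: add_pos_nonneg)
      ultimately show "1 / (1 + (\<tau> - of_int n)\<^sup>2) \<le> 3 * (1 / (1 + (of_int (n - \<lfloor>\<tau>\<rfloor>))\<^sup>2))"
        unfolding x_def[symmetric] by (rule recip_le_mult_recip)
    qed
    also have "\<dots> = 3 * (\<Sum>j\<in>(\<lambda>n. n - \<lfloor>\<tau>\<rfloor>) ` F. 1 / (1 + (of_int j)\<^sup>2))"
      by (simp add: sum.reindex inj_on_def sum_distrib_left)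
    also have "\<dots> \<le> 6 * T" using base[of "(\<lambda>n. n - \<lfloor>\<tau>\<rfloor>) ` F"] F by simp
    finally show "(\<Sum>n\<in>F. 1 / (1 + (\<tau> - real_of_int n)\<^sup>2)) \<le> 6 * T" .
  qed (use T0 in auto)
qed

text \<open>One constant for all positions of the lattice: the tolerance of a correction is divided
  by it before the sampling rate is known.\<close>

definition lattice_bound :: real where
  "lattice_bound = (SOME S. 0 < S \<and> (\<forall>\<tau> F. finite F \<longrightarrow> (\<Sum>n\<in>F. 1 / (1 + (\<tau> - real_of_int n)\<^sup>2)) \<le> S))"

lemma lattice_bound: "0 < lattice_bound" "finite F \<Longrightarrow> (\<Sum>n\<in>F. 1 / (1 + (\<tau> - real_of_int n)\<^sup>2)) \<le> lattice_bound"
proof -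
  obtain S :: real where "0 < S \<and> (\<forall>\<tau> F. finite F \<longrightarrow> (\<Sum>n\<in>F. 1 / (1 + (\<tau> - real_of_int n)\<^sup>2)) \<le> S)"
    using finite_lattice_sums_bounded by metis
  then have "0 < lattice_bound \<and> (\<forall>\<tau> F. finite F \<longrightarrow> (\<Sum>n\<in>F. 1 / (1 + (\<tau> - real_of_int n)\<^sup>2)) \<le> lattice_bound)"
    unfolding lattice_bound_def by (rule someI)
  then show "0 < lattice_bound" "finite F \<Longrightarrow> (\<Sum>n\<in>F. 1 / (1 + (\<tau> - real_of_int n)\<^sup>2)) \<le> lattice_bound" by blast+
qed

lemma lattice_summable: "(\<lambda>n::int. 1 / (1 + (\<tau> - real_of_int n)\<^sup>2)) summable_on UNIV"
proof (rule nonneg_bdd_above_summable_on)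
  show "bdd_above (sum (\<lambda>n. 1 / (1 + (\<tau> - real_of_int n)\<^sup>2)) ` {F. F \<subseteq> UNIV \<and> finite F})"
    using lattice_bound(2) by (intro bdd_aboveI[of _ lattice_bound]) auto
qed (auto intro: add_nonneg_nonneg)

text \<open>A cardinal series with a faster kernel: it takes the value \<open>E n\<close> at the
  time n / \<rho> and, unlike the series of plain \<open>sinc\<close> translates, converges
  absolutely for all bounded data.\<close>

definition interp :: "real \<Rightarrow> real \<Rightarrow> real \<Rightarrow> (int \<Rightarrow> complex) \<Rightarrow> real \<Rightarrow> complex" where
  "interp \<omega> \<rho> \<sigma> E t = (\<Sum>\<^sub>\<infinity>n. E n * kern \<omega> \<rho> \<sigma> (t - of_int n / \<rho>))"

context
  fixes \<omega> \<rho> \<sigma> :: real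
  assumes \<rho>: "0 < \<rho>" and \<sigma>: "0 < \<sigma>"
begin

lemma norm_interp_term_le:
  assumes "norm e \<le> B"
  shows "norm (e * kern \<omega> \<rho> \<sigma> (t - of_int n / \<rho>)) \<le> B * (1 + \<rho> / \<sigma>) * (1 / (1 + (\<rho> * t - of_int n)\<^sup>2))"
proof -
  have "\<rho> * (t - of_int n / \<rho>) = \<rho> * t - of_int n" using \<rho> by (simp add: field_simps)
  then have "norm (kern \<omega> \<rho> \<sigma> (t - of_int n / \<rho>)) \<le> (1 + \<rho> / \<sigma>) / (1 + (\<rho> * t - of_int n)\<^sup>2)"
    using kern_bound[OF \<rho> \<sigma>, of \<omega> "t - of_int n / \<rho>"] by simp
  with assms have "norm e * norm (kern \<omega> \<rho> \<sigma> (t - of_int n / \<rho>)) \<le> B * ((1 + \<rho> / \<sigma>) / (1 + (\<rho> * t - of_int n)\<^sup>2))"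
    by (intro mult_mono) (auto intro: order_trans[OF norm_ge_zero])
  then show ?thesis by (simp add: norm_mult)
qed

lemma interp_summable:
  assumes "\<And>n. norm (E n) \<le> B"
  shows "(\<lambda>n. norm (E n * kern \<omega> \<rho> \<sigma> (t - of_int n / \<rho>))) summable_on UNIV"
  by (rule summable_on_comparison_test[OF summable_on_cmult_right[OF lattice_summable[of "\<rho> * t"], of "B * (1 + \<rho> / \<sigma>)"]])
    (use norm_interp_term_le[OF assms] in auto)

lemma norm_interp_finite_le:
  assumes "\<And>n. norm (E n) \<le> B" "finite F"
  shows "(\<Sum>n\<in>F. norm (E n * kern \<omega> \<rho> \<sigma> (t - of_int n / \<rho>))) \<le> B * (1 + \<rho> / \<sigma>) * lattice_bound"
proof -
  have B: "0 \<le> B" using order_trans[OF norm_ge_zero assms(1)] .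
  have "(\<Sum>n\<in>F. norm (E n * kern \<omega> \<rho> \<sigma> (t - of_int n / \<rho>))) \<le> (\<Sum>n\<in>F. B * (1 + \<rho> / \<sigma>) * (1 / (1 + (\<rho> * t - of_int n)\<^sup>2)))"
    by (intro sum_mono norm_interp_term_le assms)
  also have "\<dots> \<le> B * (1 + \<rho> / \<sigma>) * lattice_bound"
    unfolding sum_distrib_left[symmetric] using B \<rho> \<sigma> assms(2) by (intro mult_left_mono lattice_bound) auto
  finally show ?thesis .
qed

lemma norm_interp_le:
  assumes "\<And>n. norm (E n) \<le> B"
  shows "norm (interp \<omega> \<rho> \<sigma> E t) \<le> B * (1 + \<rho> / \<sigma>) * lattice_bound"
proof -
  have "norm (interp \<omega> \<rho> \<sigma> E t) \<le> (\<Sum>\<^sub>\<infinity>n. norm (E n * kern \<omega> \<rho> \<sigma> (t - of_int n / \<rho>)))"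
    unfolding interp_def by (rule norm_infsum_bound) (rule interp_summable[OF assms])
  also have "\<dots> \<le> B * (1 + \<rho> / \<sigma>) * lattice_bound"
    by (intro infsum_le_finite_sums interp_summable[OF assms] norm_interp_finite_le assms)
  finally show ?thesis .
qed

lemma interp_lattice: "interp \<omega> \<rho> \<sigma> E (of_int N / \<rho>) = E N"
proof -
  have "interp \<omega> \<rho> \<sigma> E (of_int N / \<rho>) = (\<Sum>\<^sub>\<infinity>n\<in>{N}. E n * kern \<omega> \<rho> \<sigma> (of_int N / \<rho> - of_int n / \<rho>))"
    unfolding interp_def
  proof (rule infsum_cong_neutral)
    fix n assume "n \<in> UNIV - {N}"
    then have "kern \<omega> \<rho> \<sigma> (of_int (N - n) / \<rho>) = 0" using \<rho> by (intro kern_lattice) auto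
    then show "E n * kern \<omega> \<rho> \<sigma> (of_int N / \<rho> - of_int n / \<rho>) = 0" by (simp add: diff_divide_distrib)
  qed auto
  then show ?thesis by simp
qed

text \<open>A shift by whole lattice steps becomes a shift of the data, by reindexing. Periodicity
  of the corrections rests on this.\<close>

lemma interp_shift: "interp \<omega> \<rho> \<sigma> E (t + of_int m / \<rho>) = interp \<omega> \<rho> \<sigma> (\<lambda>n. E (n + m)) t"
proof -
  have "interp \<omega> \<rho> \<sigma> E (t + of_int m / \<rho>) = (\<Sum>\<^sub>\<infinity>n. E (n + m) * kern \<omega> \<rho> \<sigma> (t + of_int m / \<rho> - of_int (n + m) / \<rho>))"
    unfolding interp_def
    by (rule infsum_reindex_bij_betw[symmetric]) (auto intro!: bij_betwI[where g="\<lambda>n. n - m"])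
  then show ?thesis by (simp add: interp_def add_divide_distrib)
qed

text \<open>The limit theorem for band-limited functions takes sequences, whereas the series is a
  limit over finite sets of integers; symmetric intervals exhaust them.\<close>

lemma interp_tendsto:
  assumes "\<And>n. norm (E n) \<le> B"
  shows "(\<lambda>N. \<Sum>n\<in>{- int N..int N}. E n * kern \<omega> \<rho> \<sigma> (t - of_int n / \<rho>)) \<longlonglongrightarrow> interp \<omega> \<rho> \<sigma> E t"
proof -
  have "((\<lambda>n. E n * kern \<omega> \<rho> \<sigma> (t - of_int n / \<rho>)) has_sum interp \<omega> \<rho> \<sigma> E t) UNIV"
    unfolding interp_def by (rule has_sum_infsum[OF abs_summable_summable[OF interp_summable[OF assms]]])
  then have l: "(sum (\<lambda>n. E n * kern \<omega> \<rho> \<sigma> (t - of_int n / \<rho>)) \<longlongrightarrow> interp \<omega> \<rho> \<sigma> E t) (finite_subsets_at_top UNIV)"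
    by (simp add: has_sum_def)
  have "filterlim (\<lambda>N. {- int N..int N}) (finite_subsets_at_top UNIV) sequentially"
    unfolding filterlim_finite_subsets_at_top
  proof (intro allI impI)
    fix F :: "int set" assume "finite F \<and> F \<subseteq> UNIV"
    then have F: "finite (insert 0 (abs ` F))" by simp
    define M where "M = Max (insert 0 (abs ` F))"
    have M: "\<bar>n\<bar> \<le> M" if "n \<in> F" for n unfolding M_def using F that by (intro Max_ge) auto
    show "\<forall>\<^sub>F N in sequentially. finite {- int N..int N} \<and> F \<subseteq> {- int N..int N} \<and> {- int N..int N} \<subseteq> UNIV"
    proof (intro eventually_sequentiallyI[of "nat M"] conjI subsetI)
      fix N n assume "nat M \<le> N" "n \<in> F"
      then show "n \<in> {- int N..int N}" using M[of n] by auto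
    qed auto
  qed
  from filterlim_compose[OF l this] show ?thesis by (simp add: o_def)
qed

lemma band_limited_interp:
  assumes "\<And>n. norm (E n) \<le> B"
  shows "band_limited (\<omega> - \<rho> / 2 - \<sigma> / 2) (\<omega> + \<rho> / 2 + \<sigma> / 2) (\<lambda>t. interp \<omega> \<rho> \<sigma> E (t + s))"
proof (rule band_limited_limit)
  show "band_limited (\<omega> - \<rho> / 2 - \<sigma> / 2) (\<omega> + \<rho> / 2 + \<sigma> / 2)
     (\<lambda>t. \<Sum>n\<in>{- int N..int N}. E n * kern \<omega> \<rho> \<sigma> (t + s - of_int n / \<rho>))" for N
  proof (intro band_limited_sum band_limited_cmult)
    fix n
    show "band_limited (\<omega> - \<rho> / 2 - \<sigma> / 2) (\<omega> + \<rho> / 2 + \<sigma> / 2) (\<lambda>t. kern \<omega> \<rho> \<sigma> (t + s - of_int n / \<rho>))"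
      using band_limited_shift[OF band_limited_kern, of \<rho> \<sigma> \<omega> "s - of_int n / \<rho>"] \<rho> \<sigma> by (simp add: add_diff_eq)
  qed
  show "norm (\<Sum>n\<in>{- int N..int N}. E n * kern \<omega> \<rho> \<sigma> (t + s - of_int n / \<rho>)) \<le> B * (1 + \<rho> / \<sigma>) * lattice_bound" for N t
    by (rule order_trans[OF norm_sum norm_interp_finite_le[OF assms]]) auto
qed (rule interp_tendsto[OF assms])

text \<open>Weierstrass test: for |t| \<le> R the bound of a term at time t is at most a fixed
  multiple of its bound at time 0, which is summable.\<close>

lemma continuous_on_interp_bounded:
  assumes E: "\<And>n. continuous_on X (E n)" "\<And>n x. x \<in> X \<Longrightarrow> norm (E n x) \<le> B"
  shows "continuous_on (X \<times> {-R..R}) (\<lambda>(x, t). interp \<omega> \<rho> \<sigma> (\<lambda>n. E n x) t)"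
proof (cases "X = {}")
  case False
  then have B: "0 \<le> B" using E(2) order_trans[OF norm_ge_zero] by blast
  define M where "M n = B * (1 + \<rho> / \<sigma>) * (2 + 2 * (\<rho> * R)\<^sup>2) * (1 / (1 + (0 - of_int n)\<^sup>2))" for n :: int
  have "uniform_limit (X \<times> {-R..R}) (\<lambda>F p. \<Sum>n\<in>F. E n (fst p) * kern \<omega> \<rho> \<sigma> (snd p - of_int n / \<rho>))
     (\<lambda>p. \<Sum>\<^sub>\<infinity>n. E n (fst p) * kern \<omega> \<rho> \<sigma> (snd p - of_int n / \<rho>)) (finite_subsets_at_top UNIV)"
  proof (rule Weierstrass_m_test_general)
    show "M summable_on UNIV" unfolding M_def by (intro summable_on_cmult_right lattice_summable)
    fix n :: int and p assume p: "p \<in> X \<times> {-R..R}"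
    define x where "x = \<rho> * snd p - of_int n"
    have "norm (E n (fst p) * kern \<omega> \<rho> \<sigma> (snd p - of_int n / \<rho>)) \<le> B * (1 + \<rho> / \<sigma>) * (1 / (1 + x\<^sup>2))"
      unfolding x_def using p by (intro norm_interp_term_le E(2)) auto
    also have "\<dots> \<le> B * (1 + \<rho> / \<sigma>) * ((2 + 2 * (\<rho> * R)\<^sup>2) * (1 / (1 + (0 - of_int n)\<^sup>2)))"
    proof (rule mult_left_mono)
      have "\<bar>\<rho> * snd p\<bar> \<le> \<rho> * R" using p \<rho> by (auto simp: abs_mult abs_le_iff)
      then have "(\<rho> * snd p)\<^sup>2 \<le> (\<rho> * R)\<^sup>2" using abs_le_square_iff[of "\<rho> * snd p" "\<rho> * R"] by simp
      moreover have "(real_of_int n)\<^sup>2 = (\<rho> * snd p - x)\<^sup>2" by (simp add: x_def)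
      then have "(real_of_int n)\<^sup>2 \<le> 2 * (\<rho> * snd p)\<^sup>2 + 2 * x\<^sup>2"
        using zero_le_power2[of "\<rho> * snd p + x"] by (simp add: power2_eq_square algebra_simps)
      ultimately have "1 + (real_of_int n)\<^sup>2 \<le> 1 + 2 * (\<rho> * R)\<^sup>2 + 2 * x\<^sup>2" by linarith
      also have "\<dots> \<le> (2 + 2 * (\<rho> * R)\<^sup>2) * (1 + x\<^sup>2)"
        using zero_le_power2[of "\<rho> * R"] zero_le_power2[of x] mult_nonneg_nonneg[of "(\<rho> * R)\<^sup>2" "x\<^sup>2"]
        by (simp add: algebra_simps)
      finally have "1 + (real_of_int n)\<^sup>2 \<le> (2 + 2 * (\<rho> * R)\<^sup>2) * (1 + x\<^sup>2)" .
      moreover have "0 < 1 + x\<^sup>2" "0 < 1 + (real_of_int n)\<^sup>2" by (auto intro: add_pos_nonneg)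
      ultimately show "1 / (1 + x\<^sup>2) \<le> (2 + 2 * (\<rho> * R)\<^sup>2) * (1 / (1 + (0 - of_int n)\<^sup>2))"
        unfolding diff_0 power2_minus by (rule recip_le_mult_recip)
    qed (use B \<rho> \<sigma> in auto)
    finally show "norm (E n (fst p) * kern \<omega> \<rho> \<sigma> (snd p - of_int n / \<rho>)) \<le> M n" by (simp add: M_def)
  qed
  then have "continuous_on (X \<times> {-R..R}) (\<lambda>p. \<Sum>\<^sub>\<infinity>n. E n (fst p) * kern \<omega> \<rho> \<sigma> (snd p - of_int n / \<rho>))"
  proof (rule uniform_limit_theorem[rotated])
    show "\<forall>\<^sub>F F in finite_subsets_at_top UNIV. continuous_on (X \<times> {-R..R}) (\<lambda>p. \<Sum>n\<in>F. E n (fst p) * kern \<omega> \<rho> \<sigma> (snd p - of_int n / \<rho>))"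
      by (intro always_eventually allI continuous_intros continuous_on_compose2[OF E(1)] continuous_on_compose2[OF continuous_kern]) auto
  qed simp
  then show ?thesis by (simp add: interp_def case_prod_unfold)
qed simp

text \<open>Continuity is tested on convergent sequences, whose times stay bounded.\<close>

lemma continuous_on_interp:
  fixes X :: "'b::metric_space set"
  assumes E: "\<And>n. continuous_on X (E n)" "\<And>n x. x \<in> X \<Longrightarrow> norm (E n x) \<le> B"
  shows "continuous_on (X \<times> UNIV) (\<lambda>(x, t). interp \<omega> \<rho> \<sigma> (\<lambda>n. E n x) t)"
  unfolding continuous_on_sequentially
proof (intro allI ballI impI)
  fix u :: "nat \<Rightarrow> 'b \<times> real" and z :: "'b \<times> real"
  assume u: "z \<in> X \<times> UNIV" "(\<forall>n. u n \<in> X \<times> UNIV) \<and> u \<longlonglongrightarrow> z"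
  then have "(\<lambda>n. snd (u n)) \<longlonglongrightarrow> snd z" by (intro tendsto_snd) simp
  then obtain R0 where R0: "\<And>n. norm (snd (u n)) \<le> R0"
    using convergent_imp_bounded by (force simp: bounded_iff)
  define R where "R = max R0 (norm (snd z))"
  have "z \<in> X \<times> {-R..R}" using u(1) by (auto simp: R_def abs_le_iff mem_Times_iff)
  moreover have "u n \<in> X \<times> {-R..R}" for n
  proof -
    have "\<bar>snd (u n)\<bar> \<le> R" using R0[of n] by (simp add: R_def)
    moreover have "fst (u n) \<in> X" using u(2) by (auto simp: mem_Times_iff)
    ultimately show ?thesis by (auto simp: mem_Times_iff abs_le_iff)
  qed
  ultimately show "((\<lambda>(x, t). interp \<omega> \<rho> \<sigma> (\<lambda>n. E n x) t) \<circ> u) \<longlonglongrightarrow> (\<lambda>(x, t). interp \<omega> \<rho> \<sigma> (\<lambda>n. E n x) t) z"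
    using continuous_on_interp_bounded[of X E B R, OF E] u(2) unfolding continuous_on_sequentially by blast
qed

end

section \<open>Separating orbits at one scale\<close>

locale compact_flow =
  fixes X :: "'b::metric_space set" and \<psi> :: "real \<Rightarrow> 'b \<Rightarrow> 'b"
  assumes compact_X: "compact X"
    and continuous_flow: "continuous_on (UNIV \<times> X) (\<lambda>(r, x). \<psi> r x)"
    and flow_in: "x \<in> X \<Longrightarrow> \<psi> r x \<in> X"
    and flow_0: "x \<in> X \<Longrightarrow> \<psi> 0 x = x"
    and flow_plus: "x \<in> X \<Longrightarrow> \<psi> r (\<psi> s x) = \<psi> (r + s) x"
begin

lemma continuous_on_flow [continuous_intros]:
  assumes "continuous_on A f" "continuous_on A g" "\<And>z. z \<in> A \<Longrightarrow> g z \<in> X"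
  shows "continuous_on A (\<lambda>z. \<psi> (f z) (g z))"
  using continuous_on_compose2[OF continuous_flow continuous_on_Pair[OF assms(1,2)]] assms(3) by auto

text \<open>The form in which small width enters the approximation: points that share a nonzero
  weight have \<epsilon>-close orbits over the window, and \<open>m\<close> plays the part of the
  dimension plus one, the number of vertices of a simplex.\<close>

definition width_partition_by :: "'i set \<Rightarrow> ('i \<Rightarrow> 'b \<Rightarrow> real) \<Rightarrow> real \<Rightarrow> real \<Rightarrow> nat \<Rightarrow> bool" where
  "width_partition_by I p \<epsilon> N m \<longleftrightarrow> finite I \<and>
     (\<forall>i\<in>I. continuous_on X (p i) \<and> (\<forall>x\<in>X. 0 \<le> p i x)) \<and>
     (\<forall>x\<in>X. (\<Sum>i\<in>I. p i x) = 1 \<and> card {i\<in>I. p i x \<noteq> 0} \<le> m) \<and>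
     (\<forall>i\<in>I. \<forall>x\<in>X. \<forall>y\<in>X. p i x \<noteq> 0 \<longrightarrow> p i y \<noteq> 0 \<longrightarrow> (\<forall>r\<in>{0..N}. dist (\<psi> r x) (\<psi> r y) < \<epsilon>))"

lemma width_partition_byD:
  assumes "width_partition_by I p \<epsilon> N m"
  shows "finite I" "i \<in> I \<Longrightarrow> continuous_on X (p i)" "i \<in> I \<Longrightarrow> x \<in> X \<Longrightarrow> 0 \<le> p i x"
    "x \<in> X \<Longrightarrow> (\<Sum>i\<in>I. p i x) = 1" "x \<in> X \<Longrightarrow> card {i\<in>I. p i x \<noteq> 0} \<le> m"
    "i \<in> I \<Longrightarrow> x \<in> X \<Longrightarrow> y \<in> X \<Longrightarrow> p i x \<noteq> 0 \<Longrightarrow> p i y \<noteq> 0 \<Longrightarrow> r \<in> {0..N} \<Longrightarrow> dist (\<psi> r x) (\<psi> r y) < \<epsilon>"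
  using assms unfolding width_partition_by_def by simp_all

text \<open>The index type is fixed since a definition cannot quantify over types; the indices will
  be members of covers of compact sets of bounded sequences.\<close>

definition width_partition :: "real \<Rightarrow> real \<Rightarrow> nat \<Rightarrow> bool" where
  "width_partition \<epsilon> N m \<longleftrightarrow> (\<exists>(I :: (nat \<Rightarrow>\<^sub>C real) set set) p. width_partition_by I p \<epsilon> N m)"

text \<open>A function \<open>c\<close> on \<open>X \<times> \<real> / 2 ^ k \<int>\<close> encodes the equivariant map that sends \<open>(x, \<theta>)\<close> to its
  values along the orbit of \<open>(x, \<theta>)\<close>.\<close>

definition admissible :: "real \<Rightarrow> real \<Rightarrow> nat \<Rightarrow> ('b \<Rightarrow> real \<Rightarrow> complex) \<Rightarrow> bool" where
  "admissible a b k c \<longleftrightarrow> continuous_on (X \<times> UNIV) (\<lambda>(x, \<theta>). c x \<theta>) \<and>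
     (\<forall>x\<in>X. \<forall>\<theta>. c x (\<theta> + 2 ^ k) = c x \<theta>) \<and>
     (\<forall>x\<in>X. \<forall>\<theta>. band_limited a b (\<lambda>t. c (\<psi> t x) (\<theta> + t)))"

lemma admissible_zero: "admissible a b 0 (\<lambda>_ _. 0)"
  by (simp add: admissible_def band_limited_zero case_prod_unfold)

text \<open>Periodicity confines the phase to a compact interval, so the modulus of continuity is
  uniform in \<theta>.\<close>

lemma admissible_uniformly_continuous:
  assumes c: "admissible a b k c" and \<eta>: "0 < \<eta>"
  obtains \<epsilon> where "0 < \<epsilon>" "\<And>x y \<theta>. x \<in> X \<Longrightarrow> y \<in> X \<Longrightarrow> dist x y < \<epsilon> \<Longrightarrow> norm (c x \<theta> - c y \<theta>) < \<eta>"
proof -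
  have cc: "continuous_on (X \<times> UNIV) (\<lambda>(x, \<theta>). c x \<theta>)" and per: "\<And>x \<theta>. x \<in> X \<Longrightarrow> c x (\<theta> + 2 ^ k) = c x \<theta>"
    using c by (auto simp: admissible_def)
  have "uniformly_continuous_on (X \<times> {0..2 ^ k}) (\<lambda>(x, \<theta>). c x \<theta>)"
    by (intro compact_uniformly_continuous compact_Times compact_X compact_Icc continuous_on_subset[OF cc]) auto
  then obtain \<epsilon> where "0 < \<epsilon>" and \<epsilon>: "\<And>z z'. z \<in> X \<times> {0..2 ^ k} \<Longrightarrow> z' \<in> X \<times> {0..2 ^ k} \<Longrightarrow> dist z' z < \<epsilon> \<Longrightarrow>
      dist ((\<lambda>(x, \<theta>). c x \<theta>) z') ((\<lambda>(x, \<theta>). c x \<theta>) z) < \<eta>"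
    unfolding uniformly_continuous_on_def using \<eta> by metis
  show thesis
  proof (rule that[OF \<open>0 < \<epsilon>\<close>])
    fix x y and \<theta> :: real assume xy: "x \<in> X" "y \<in> X" "dist x y < \<epsilon>"
    define q where "q = \<lfloor>\<theta> / 2 ^ k\<rfloor>"
    define \<theta>0 where "\<theta>0 = \<theta> + of_int (- q) * 2 ^ k"
    have "c z \<theta>0 = c z \<theta>" if "z \<in> X" for z
      unfolding \<theta>0_def by (rule periodic_int) (rule per[OF that])
    moreover have "of_int q \<le> \<theta> / 2 ^ k" "\<theta> / 2 ^ k \<le> of_int q + 1" unfolding q_def by linarith+
    then have "\<theta>0 \<in> {0..2 ^ k}" by (auto simp: \<theta>0_def field_simps)
    then have "dist (c x \<theta>0) (c y \<theta>0) < \<eta>" using \<epsilon>[of "(y, \<theta>0)" "(x, \<theta>0)"] xy by (auto simp: dist_Pair_Pair)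
    ultimately show "norm (c x \<theta> - c y \<theta>) < \<eta>" using xy by (simp add: dist_norm)
  qed
qed

text \<open>Every orbit is referred to its point at phase 0, and \<open>E n\<close> is the change
  wanted at sample number n: the block is n div m, the position in it n mod m. Interpolating
  \<open>E\<close> in time moves c by at most \<eta>, since the data are small, and at the sample
  times the new map takes the values of G exactly. If x and y are \<epsilon> apart, then the
  starting points of the block containing time 0 are \<epsilon> apart at some time of the window, so
  G separates them; compactness makes this quantitative.\<close>

lemma perturb:
  assumes c: "admissible a b k c" and \<epsilon>: "0 < \<epsilon>" and \<eta>: "0 < \<eta>" and \<rho>0: "0 < \<rho>0" "\<rho>0 < b - a"
    and H: "\<And>\<epsilon>. 0 < \<epsilon> \<Longrightarrow> \<forall>\<^sub>F N in at_top. \<exists>m. width_partition \<epsilon> N m \<and> real m \<le> \<rho>0 * N"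
  shows "\<exists>k' c' \<delta>. k \<le> k' \<and> admissible a b k' c' \<and> 0 < \<delta> \<and> (\<forall>x\<in>X. \<forall>\<theta>. norm (c' x \<theta> - c x \<theta>) \<le> \<eta>) \<and>
    (\<forall>x\<in>X. \<forall>y\<in>X. \<forall>\<theta>. \<epsilon> \<le> dist x y \<longrightarrow> (\<exists>t. \<delta> \<le> norm (c' (\<psi> t x) (\<theta> + t) - c' (\<psi> t y) (\<theta> + t))))"
proof -
  have cc: "continuous_on (X \<times> UNIV) (\<lambda>(x, \<theta>). c x \<theta>)" and per: "\<And>x \<theta>. x \<in> X \<Longrightarrow> c x (\<theta> + 2 ^ k) = c x \<theta>"
    and bl: "\<And>x \<theta>. x \<in> X \<Longrightarrow> band_limited a b (\<lambda>t. c (\<psi> t x) (\<theta> + t))"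
    using c by (auto simp: admissible_def)
  \<comment> \<open>Half of the spare bandwidth b - a - \<rho>0 is reserved for the decay factor of
    the kernel, the other half for rounding the sampling rate up.\<close>
  define \<rho>1 \<sigma> \<omega> where "\<rho>1 = (\<rho>0 + (b - a)) / 2" and "\<sigma> = (b - a - \<rho>0) / 2" and "\<omega> = (a + b) / 2"
  have \<rho>1: "\<rho>0 < \<rho>1" "\<rho>1 + \<sigma> = b - a" and \<sigma>: "0 < \<sigma>" using \<rho>0 by (auto simp: \<rho>1_def \<sigma>_def field_simps)
  \<comment> \<open>\<open>S\<close> bounds the gain of interpolation at every rate up to \<rho>1,
    so \<eta>1 can be fixed before the scale \<open>k'\<close>. The 3 in \<eta>1 is the loss of the
    general position argument.\<close>
  define S where "S = (1 + \<rho>1 / \<sigma>) * lattice_bound"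
  have S: "0 < S" unfolding S_def using \<rho>0 \<rho>1 \<sigma> lattice_bound(1) by (intro mult_pos_pos add_pos_pos) auto
  define \<eta>1 where "\<eta>1 = \<eta> / (3 * S)"
  have \<eta>1: "0 < \<eta>1" "3 * \<eta>1 * S = \<eta>" using \<eta> S by (auto simp: \<eta>1_def)
  obtain \<epsilon>1 where \<epsilon>1: "0 < \<epsilon>1" "\<And>x y \<theta>. x \<in> X \<Longrightarrow> y \<in> X \<Longrightarrow> dist x y < \<epsilon>1 \<Longrightarrow> norm (c x \<theta> - c y \<theta>) < \<eta>1"
    using admissible_uniformly_continuous[OF c \<eta>1(1)] by blast
  define \<epsilon>' where "\<epsilon>' = min \<epsilon> \<epsilon>1"
  have \<epsilon>': "0 < \<epsilon>'" "\<epsilon>' \<le> \<epsilon>" "\<epsilon>' \<le> \<epsilon>1" using \<epsilon> \<epsilon>1 by (auto simp: \<epsilon>'_def)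
  have "filterlim (\<lambda>j. (2::real) ^ j) at_top sequentially" by real_asymp
  then have e1: "\<forall>\<^sub>F j in sequentially. \<exists>m. width_partition \<epsilon>' (2 ^ j) m \<and> real m \<le> \<rho>0 * 2 ^ j"
    using H[OF \<epsilon>'(1)] by (rule eventually_compose_filterlim[rotated])
  have "(\<lambda>j. 1 / (2::real) ^ j) \<longlonglongrightarrow> 0" by real_asymp
  then have e2: "\<forall>\<^sub>F j in sequentially. 1 / (2::real) ^ j < \<rho>1 - \<rho>0"
    by (rule order_tendstoD) (use \<rho>1 in simp)
  have "\<forall>\<^sub>F j in sequentially. k \<le> j \<and> 1 / (2::real) ^ j < \<rho>1 - \<rho>0 \<and> (\<exists>m. width_partition \<epsilon>' (2 ^ j) m \<and> real m \<le> \<rho>0 * 2 ^ j)"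
    using eventually_ge_at_top[of k] e1 e2 by eventually_elim blast
  then obtain k' m0 where k': "k \<le> k'" "1 / (2::real) ^ k' < \<rho>1 - \<rho>0"
    "width_partition \<epsilon>' (2 ^ k') m0" "real m0 \<le> \<rho>0 * 2 ^ k'"
    using eventually_happens'[OF sequentially_bot] by blast
  define L where "L = (2::real) ^ k'"
  have L: "0 < L" by (simp add: L_def)
  \<comment> \<open>Rounding up costs less than one sample per block, that is 1 / L in the rate,
    which is below \<rho>1 - \<rho>0.\<close>
  define m where "m = nat \<lceil>\<rho>0 * L\<rceil>"
  have m: "0 < m" "\<rho>0 * L \<le> real m" "real m < \<rho>0 * L + 1"
    using \<rho>0(1) L unfolding m_def by (auto intro: mult_pos_pos) linarith+
  have m0: "m0 \<le> m" using k'(4) m(2) by (simp add: L_def)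
  define \<rho> where "\<rho> = real m / L"
  have \<rho>: "0 < \<rho>" "\<rho> \<le> \<rho>1" "L = real m / \<rho>"
  proof -
    show "0 < \<rho>" using m L by (simp add: \<rho>_def)
    have "\<rho> < \<rho>0 + 1 / L" using m(3) L by (simp add: \<rho>_def field_simps)
    then show "\<rho> \<le> \<rho>1" using k'(2) by (simp add: L_def)
    show "L = real m / \<rho>" using m L by (simp add: \<rho>_def)
  qed
  obtain I :: "(nat \<Rightarrow>\<^sub>C real) set set" and p where Ip: "width_partition_by I p \<epsilon>' L m0"
    using k'(3) unfolding width_partition_def L_def by blast
  note I = width_partition_byD(1)[OF Ip] and p = width_partition_byD(2-6)[OF Ip]
  \<comment> \<open>The current map sampled along a block that starts in x at phase 0.\<close>
  define F where "F j x = c (\<psi> (real j / \<rho>) x) (real j / \<rho>)" for j x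
  have jL: "real j / \<rho> \<in> {0..L}" if "j < m" for j
    using that \<rho>(1) unfolding \<rho>(3) by (auto intro: divide_right_mono)
  have Fm: "norm (F j x - F j y) \<le> \<eta>1"
    if "i \<in> I" "x \<in> X" "y \<in> X" "p i x \<noteq> 0" "p i y \<noteq> 0" "j < m" for i x y j
    unfolding F_def using p(5)[OF that(1-5) jL[OF that(6)]] \<epsilon>'(3) that
    by (intro less_imp_le \<epsilon>1(2) flow_in) auto
  have pm: "card {i\<in>I. p i x \<noteq> 0} \<le> m" if "x \<in> X" for x using p(4)[OF that] m0 by linarith
  have "\<exists>G :: nat \<Rightarrow> 'b \<Rightarrow> complex. (\<forall>j. continuous_on X (G j)) \<and> (\<forall>j<m. \<forall>x\<in>X. norm (G j x - F j x) \<le> 3 * \<eta>1) \<and>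
    (\<forall>x\<in>X. \<forall>y\<in>X. (\<forall>j<m. G j x = G j y) \<longrightarrow> (\<exists>i\<in>I. p i x \<noteq> 0 \<and> p i y \<noteq> 0))"
    by (rule exists_separating_approximation[where X = X and F = F, OF I \<eta>1(1) p(1-3) pm Fm], assumption+) blast
  then obtain G :: "nat \<Rightarrow> 'b \<Rightarrow> complex" where G0: "(\<forall>j. continuous_on X (G j)) \<and> (\<forall>j<m. \<forall>x\<in>X. norm (G j x - F j x) \<le> 3 * \<eta>1) \<and>
    (\<forall>x\<in>X. \<forall>y\<in>X. (\<forall>j<m. G j x = G j y) \<longrightarrow> (\<exists>i\<in>I. p i x \<noteq> 0 \<and> p i y \<noteq> 0))" ..
  have G: "\<And>j. continuous_on X (G j)"
    "\<And>j x. j < m \<Longrightarrow> x \<in> X \<Longrightarrow> norm (G j x - F j x) \<le> 3 * \<eta>1"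
    "\<And>x y. x \<in> X \<Longrightarrow> y \<in> X \<Longrightarrow> \<forall>j<m. G j x = G j y \<Longrightarrow> \<exists>i\<in>I. p i x \<noteq> 0 \<and> p i y \<noteq> 0"
    using G0 by simp_all
  have Fc: "continuous_on X (F j)" for j
    unfolding F_def by (rule continuous_on_compose2[OF cc, of _ "\<lambda>x. (\<psi> (real j / \<rho>) x, real j / \<rho>)", simplified])
      (auto intro!: continuous_intros flow_in)
  define E where "E n y = G (nat (n mod int m)) (\<psi> (of_int (n div int m) * L) y) - F (nat (n mod int m)) (\<psi> (of_int (n div int m) * L) y)"
    for n y
  have Ec: "continuous_on X (E n)" for n
    unfolding E_def
    by (intro continuous_intros continuous_on_compose2[OF G(1)] continuous_on_compose2[OF Fc]) (auto intro: flow_in)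
  have Eb: "norm (E n y) \<le> 3 * \<eta>1" if "y \<in> X" for n y
    unfolding E_def using m(1) that by (intro G(2) flow_in) (simp add: nat_less_iff)
  have Eshift: "E (n + int m) y = E n (\<psi> L y)" if "y \<in> X" for n y
    using that m(1) by (simp add: E_def flow_plus algebra_simps)
  \<comment> \<open>\<psi> (- \<theta>) x is the point of the orbit at phase 0. It stays the same
    along the orbit of (x, \<theta>), so there only the time argument of the interpolation
    moves.\<close>
  define J where "J x \<theta> = interp \<omega> \<rho> \<sigma> (\<lambda>n. E n (\<psi> (- \<theta>) x)) \<theta>" for x \<theta>
  define c' where "c' x \<theta> = c x \<theta> + J x \<theta>" for x \<theta>
  \<comment> \<open>A period is m lattice steps; the resulting shift of the data by m cancels the
    move of the base point by - L.\<close>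
  have Jper: "J x (\<theta> + L) = J x \<theta>" if x: "x \<in> X" for x \<theta>
  proof -
    have "J x (\<theta> + L) = interp \<omega> \<rho> \<sigma> (\<lambda>n. E n (\<psi> (- (\<theta> + L)) x)) (\<theta> + of_int (int m) / \<rho>)"
      using \<rho>(3) by (simp add: J_def)
    also have "\<dots> = interp \<omega> \<rho> \<sigma> (\<lambda>n. E (n + int m) (\<psi> (- (\<theta> + L)) x)) \<theta>"
      by (rule interp_shift[OF \<rho>(1) \<sigma>])
    also have "\<dots> = J x \<theta>"
      using x by (simp add: J_def Eshift flow_in flow_plus)
    finally show ?thesis .
  qed
  have cper: "c x (\<theta> + L) = c x \<theta>" if x: "x \<in> X" for x \<theta>
  proof -
    have "L = of_int (2 ^ (k' - k)) * 2 ^ k" using k'(1) by (simp add: L_def flip: power_add)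
    then show ?thesis using periodic_int[of "c x" "2 ^ k" \<theta> "2 ^ (k' - k)"] per[OF x] by simp
  qed
  have cperi: "c x (\<theta> + of_int q * L) = c x \<theta>" if x: "x \<in> X" for x \<theta> q
    by (rule periodic_int) (rule cper[OF x])
  have Jorbit: "J (\<psi> t x) (\<theta> + t) = interp \<omega> \<rho> \<sigma> (\<lambda>n. E n (\<psi> (- \<theta>) x)) (t + \<theta>)" if "x \<in> X" for x \<theta> t
    using that by (simp add: J_def flow_plus add.commute)
  have adm: "admissible a b k' c'"
    unfolding admissible_def
  proof (intro conjI ballI allI)
    have "continuous_on (X \<times> UNIV) (\<lambda>z. (\<lambda>(x, t). interp \<omega> \<rho> \<sigma> (\<lambda>n. E n x) t) (\<psi> (- snd z) (fst z), snd z))"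
      by (rule continuous_on_compose2[OF continuous_on_interp[OF \<rho>(1) \<sigma> Ec Eb]])
        (auto intro!: continuous_intros flow_in)
    then show "continuous_on (X \<times> UNIV) (\<lambda>(x, \<theta>). c' x \<theta>)"
      using cc unfolding c'_def J_def case_prod_unfold by (intro continuous_on_add) auto
    show "c' x (\<theta> + 2 ^ k') = c' x \<theta>" if "x \<in> X" for x \<theta>
      using Jper[OF that] cper[OF that] by (simp add: c'_def L_def)
    show "band_limited a b (\<lambda>t. c' (\<psi> t x) (\<theta> + t))" if x: "x \<in> X" for x \<theta>
    proof -
      have "band_limited (\<omega> - \<rho> / 2 - \<sigma> / 2) (\<omega> + \<rho> / 2 + \<sigma> / 2) (\<lambda>t. J (\<psi> t x) (\<theta> + t))"
        unfolding Jorbit[OF x] by (rule band_limited_interp[OF \<rho>(1) \<sigma> Eb]) (rule flow_in[OF x])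
      moreover have "a \<le> \<omega> - \<rho> / 2 - \<sigma> / 2" "\<omega> + \<rho> / 2 + \<sigma> / 2 \<le> b"
        using \<rho>(2) \<rho>1(2) unfolding \<omega>_def by (auto simp: field_simps)
      ultimately have "band_limited a b (\<lambda>t. J (\<psi> t x) (\<theta> + t))" by (rule band_limited_mono)
      then show ?thesis unfolding c'_def by (rule band_limited_add[OF bl[OF x]])
    qed
  qed
  have near: "norm (c' x \<theta> - c x \<theta>) \<le> \<eta>" if x: "x \<in> X" for x \<theta>
  proof -
    have "norm (J x \<theta>) \<le> 3 * \<eta>1 * (1 + \<rho> / \<sigma>) * lattice_bound"
      unfolding J_def by (rule norm_interp_le[OF \<rho>(1) \<sigma> Eb]) (rule flow_in[OF x])
    also have "\<dots> \<le> 3 * \<eta>1 * (1 + \<rho>1 / \<sigma>) * lattice_bound"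
      using \<rho>(2) \<sigma> \<eta>1(1) lattice_bound(1) by (intro mult_right_mono mult_left_mono add_left_mono divide_right_mono) auto
    also have "\<dots> = \<eta>" using \<eta>1(2) by (simp add: S_def mult.assoc)
    finally show ?thesis by (simp add: c'_def)
  qed
  \<comment> \<open>Triples of a time in the window and two starting points that are at least
    \<epsilon> apart at that time. On this compact set the samples of G never all agree, since a
    common weight would make the pair \<epsilon>'-close at that time.\<close>
  define K where "K = ({0..L} \<times> (X \<times> X)) \<inter> (\<lambda>z. dist (\<psi> (fst z) (fst (snd z))) (\<psi> (fst z) (snd (snd z)))) -` {\<epsilon>..}"
  define s where "s z = (\<Sum>j<m. norm (G j (fst (snd z)) - G j (snd (snd z))))" for z :: "real \<times> 'b \<times> 'b"
  have cA: "compact ({0..L} \<times> (X \<times> X))" by (intro compact_Times compact_X compact_Icc)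
  have "continuous_on ({0..L} \<times> (X \<times> X)) (\<lambda>z. dist (\<psi> (fst z) (fst (snd z))) (\<psi> (fst z) (snd (snd z))))"
    by (intro continuous_intros) auto
  then have "closed K"
    unfolding K_def by (intro continuous_closed_preimage compact_imp_closed[OF cA]) auto
  then have cK: "compact K" using compact_Int_closed[OF cA, of K] by (simp add: K_def)
  have sc: "continuous_on K s"
    unfolding s_def by (intro continuous_intros continuous_on_compose2[OF G(1)]) (auto simp: K_def)
  have spos: "0 < s z" if z: "z \<in> K" for z
  proof (rule ccontr)
    assume "\<not> 0 < s z"
    moreover have "0 \<le> s z" unfolding s_def by (intro sum_nonneg) auto
    ultimately have "s z = 0" by simp
    then have "\<forall>j<m. G j (fst (snd z)) = G j (snd (snd z))"
      unfolding s_def by (subst (asm) sum_nonneg_eq_0_iff) auto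
    moreover have "fst (snd z) \<in> X" "snd (snd z) \<in> X" using z by (auto simp: K_def)
    ultimately obtain i where "i \<in> I" "p i (fst (snd z)) \<noteq> 0" "p i (snd (snd z)) \<noteq> 0"
      using G(3) by blast
    then have "dist (\<psi> (fst z) (fst (snd z))) (\<psi> (fst z) (snd (snd z))) < \<epsilon>'"
      using z by (intro p(5)) (auto simp: K_def)
    then show False using z \<epsilon>'(2) by (auto simp: K_def)
  qed
  obtain s0 where s0: "0 < s0" "\<And>z. z \<in> K \<Longrightarrow> s0 \<le> s z"
  proof (cases "K = {}")
    case True
    then show ?thesis using that[of 1] by auto
  next
    case False
    then obtain z where "z \<in> K" "\<And>z'. z' \<in> K \<Longrightarrow> s z \<le> s z'" using continuous_attains_inf[OF cK _ sc] by blast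
    then show ?thesis using that[of "s z"] spos by blast
  qed
  have sep: "\<exists>t. s0 / real m \<le> norm (c' (\<psi> t x) (\<theta> + t) - c' (\<psi> t y) (\<theta> + t))"
    if xy: "x \<in> X" "y \<in> X" "\<epsilon> \<le> dist x y" for x y \<theta>
  proof -
    define q where "q = \<lfloor>\<theta> / L\<rfloor>"
    \<comment> \<open>Start of the block that contains time 0, on the orbit whose phase at time 0 is
      \<theta>.\<close>
    define t0 where "t0 = of_int q * L - \<theta>"
    have q: "of_int q \<le> \<theta> / L" "\<theta> / L \<le> of_int q + 1" unfolding q_def by linarith+
    have t0: "- t0 \<in> {0..L}" using q L by (auto simp: t0_def field_simps)
    have undo: "\<psi> (- t0) (\<psi> t0 z) = z" if "z \<in> X" for z using that by (simp add: flow_plus flow_0)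
    have "(- t0, \<psi> t0 x, \<psi> t0 y) \<in> K" using t0 xy by (auto simp: K_def undo intro: flow_in)
    then have s0le: "s0 \<le> (\<Sum>j<m. norm (G j (\<psi> t0 x) - G j (\<psi> t0 y)))" using s0(2) by (fastforce simp: s_def)
    \<comment> \<open>One of the m samples carries at least the average share of
      \<open>s0\<close>.\<close>
    have "\<exists>j<m. s0 / real m \<le> norm (G j (\<psi> t0 x) - G j (\<psi> t0 y))"
    proof (rule ccontr)
      assume "\<not> ?thesis"
      then have "(\<Sum>j<m. norm (G j (\<psi> t0 x) - G j (\<psi> t0 y))) < (\<Sum>j<m. s0 / real m)"
        using m(1) by (intro sum_strict_mono) auto
      also have "\<dots> = s0" using m(1) by simp
      finally show False using s0le by simp
    qed
    then obtain j where j: "j < m" "s0 / real m \<le> norm (G j (\<psi> t0 x) - G j (\<psi> t0 y))" by blast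
    define t where "t = t0 + real j / \<rho>"
    have val: "c' (\<psi> t z) (\<theta> + t) = G j (\<psi> t0 z)" if z: "z \<in> X" for z
    proof -
      define n where "n = q * int m + int j"
      have nd: "n div int m = q" "nat (n mod int m) = j" using j(1) by (auto simp: n_def)
      have \<theta>t: "\<theta> + t = of_int q * L + real j / \<rho>" by (simp add: t_def t0_def)
      have \<theta>n: "\<theta> + t = of_int n / \<rho>"
        unfolding \<theta>t \<rho>(3) by (simp add: n_def add_divide_distrib)
      have "J (\<psi> t z) (\<theta> + t) = interp \<omega> \<rho> \<sigma> (\<lambda>n. E n (\<psi> (- \<theta>) z)) (of_int n / \<rho>)"
        unfolding Jorbit[OF z] \<theta>n[symmetric] by (simp add: add.commute)
      also have "interp \<omega> \<rho> \<sigma> (\<lambda>n. E n (\<psi> (- \<theta>) z)) (of_int n / \<rho>) = E n (\<psi> (- \<theta>) z)"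
        by (rule interp_lattice[OF \<rho>(1) \<sigma>])
      also have "\<dots> = G j (\<psi> t0 z) - F j (\<psi> t0 z)"
        using z by (simp add: E_def nd flow_plus t0_def)
      finally have J: "J (\<psi> t z) (\<theta> + t) = G j (\<psi> t0 z) - F j (\<psi> t0 z)" .
      have "c (\<psi> t z) (\<theta> + t) = c (\<psi> t z) (real j / \<rho>)"
        unfolding \<theta>t using cperi[OF flow_in[OF z], of t "real j / \<rho>" q] by (simp add: add.commute)
      also have "\<dots> = F j (\<psi> t0 z)" using z by (simp add: F_def flow_plus t_def add.commute)
      finally show ?thesis using J by (simp add: c'_def)
    qed
    show ?thesis using j(2) val[OF xy(1)] val[OF xy(2)] by (intro exI[of _ t]) simp
  qed
  have "0 < s0 / real m" using s0(1) m(1) by simp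
  then show ?thesis using k'(1) adm near sep by blast
qed

end

section \<open>Separating all orbits\<close>

context compact_flow
begin

text \<open>Any lift of \<open>z k\<close> may replace the phase, as \<open>c\<close> has period
  2^k; the phase plus t is a lift of the rotated coordinate.\<close>

lemma admissible_phase:
  assumes c: "admissible a b k c" and x: "x \<in> X" and z: "z \<in> solenoid"
  shows "cis (2 * pi * \<theta> / 2 ^ k) = z k \<Longrightarrow> c x (phase k z) = c x \<theta>"
    and "c x (phase k (rot t z)) = c x (phase k z + t)"
proof -
  have per: "c x (\<theta> + 2 ^ k) = c x \<theta>" for \<theta> using c x by (simp add: admissible_def)
  have *: "c x (phase k z) = c x \<theta>" if "cis (2 * pi * \<theta> / 2 ^ k) = z k" "z \<in> solenoid" for \<theta> z
    by (rule periodic_cis[where c = "c x" and T = "2 ^ k", OF per]) (use that cis_phase in auto)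
  have "cis (2 * pi * (phase k z + t) / 2 ^ k) = cis (2 * pi * t / 2 ^ k) * cis (2 * pi * phase k z / 2 ^ k)"
    by (simp add: cis_mult add_divide_distrib distrib_left add.commute)
  also have "\<dots> = rot t z k" using cis_phase[OF z] by (simp add: rot_def)
  finally show "c x (phase k (rot t z)) = c x (phase k z + t)"
    by (rule *) (rule rot_solenoid[OF z])
  show "cis (2 * pi * \<theta> / 2 ^ k) = z k \<Longrightarrow> c x (phase k z) = c x \<theta>" using * z by blast
qed

text \<open>A state is a scale, a map and a margin. Each correction is at most a quarter of the
  margin, and the margin drops at least to a quarter, so all corrections after stage n add up to at
  most a third of its margin. Points at distance 1 / (n + 1) or more are separated by the margin of
  stage n + 1 at some time, and two deviations of a third each cannot cancel it.\<close>

lemma exists_separating_map: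
  assumes \<rho>0: "0 < \<rho>0" "\<rho>0 < b - a"
    and H: "\<And>\<epsilon>. 0 < \<epsilon> \<Longrightarrow> \<forall>\<^sub>F N in at_top. \<exists>m. width_partition \<epsilon> N m \<and> real m \<le> \<rho>0 * N"
  obtains u where "continuous_on (X \<times> solenoid) (\<lambda>(x, z). u x z)"
    "\<And>x z. x \<in> X \<Longrightarrow> z \<in> solenoid \<Longrightarrow> norm (u x z) \<le> 1 / 2"
    "\<And>x z. x \<in> X \<Longrightarrow> z \<in> solenoid \<Longrightarrow> band_limited a b (\<lambda>t. u (\<psi> t x) (rot t z))"
    "\<And>x y z. x \<in> X \<Longrightarrow> y \<in> X \<Longrightarrow> z \<in> solenoid \<Longrightarrow> \<forall>t. u (\<psi> t x) (rot t z) = u (\<psi> t y) (rot t z) \<Longrightarrow> x = y"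
proof -
  \<comment> \<open>Stage 0 is the zero map with margin 1, which bounds the limit by 1/3.\<close>
  define P where "P n s \<longleftrightarrow> admissible a b (fst s) (fst (snd s)) \<and> 0 < snd (snd s) \<and> (n = 0 \<longrightarrow> s = (0, (\<lambda>_ _. 0), 1))"
    for n :: nat and s :: "nat \<times> ('b \<Rightarrow> real \<Rightarrow> complex) \<times> real"
  define Q where "Q n s s' \<longleftrightarrow> fst s \<le> fst s' \<and> snd (snd s') \<le> snd (snd s) / 4 \<and>
     (\<forall>x\<in>X. \<forall>\<theta>. norm (fst (snd s') x \<theta> - fst (snd s) x \<theta>) \<le> snd (snd s) / 4) \<and>
     (\<forall>x\<in>X. \<forall>y\<in>X. \<forall>\<theta>. 1 / real (Suc n) \<le> dist x y \<longrightarrow>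
        (\<exists>t. snd (snd s') \<le> norm (fst (snd s') (\<psi> t x) (\<theta> + t) - fst (snd s') (\<psi> t y) (\<theta> + t))))"
    for n :: nat and s s' :: "nat \<times> ('b \<Rightarrow> real \<Rightarrow> complex) \<times> real"
  have "\<exists>f. \<forall>n. P n (f n) \<and> Q n (f n) (f (Suc n))"
  proof (rule dependent_nat_choice)
    show "\<exists>s. P 0 s" by (intro exI[of _ "(0, (\<lambda>_ _. 0), 1)"]) (simp add: P_def admissible_zero)
    fix s :: "nat \<times> ('b \<Rightarrow> real \<Rightarrow> complex) \<times> real" and n
    assume s: "P n s"
    obtain k c d where skcd: "s = (k, c, d)" by (cases s)
    have c: "admissible a b k c" "0 < d / 4" "0 < 1 / real (Suc n)" using s by (auto simp: P_def skcd)
    from perturb[OF c(1,3,2) \<rho>0 H] obtain k' c' \<delta> where new: "k \<le> k'" "admissible a b k' c'" "0 < \<delta>"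
      "\<forall>x\<in>X. \<forall>\<theta>. norm (c' x \<theta> - c x \<theta>) \<le> d / 4"
      "\<forall>x\<in>X. \<forall>y\<in>X. \<forall>\<theta>. 1 / real (Suc n) \<le> dist x y \<longrightarrow> (\<exists>t. \<delta> \<le> norm (c' (\<psi> t x) (\<theta> + t) - c' (\<psi> t y) (\<theta> + t)))"
      by blast
    \<comment> \<open>The margin is the separation just obtained, cut down so that the later
      corrections stay small.\<close>
    have "P (Suc n) (k', c', min \<delta> (d / 4))" using new c by (simp add: P_def)
    moreover have "Q n s (k', c', min \<delta> (d / 4))"
      unfolding Q_def skcd using new by (auto simp del: of_nat_Suc) (meson min.coboundedI1)
    ultimately show "\<exists>s'. P (Suc n) s' \<and> Q n s s'" by blast
  qed
  then obtain f where f: "\<And>n. P n (f n)" "\<And>n. Q n (f n) (f (Suc n))" by blast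
  define k c d where "k n = fst (f n)" and "c n = fst (snd (f n))" and "d n = snd (snd (f n))" for n
  have adm: "admissible a b (k n) (c n)" and d0: "0 < d n" and c0: "c 0 = (\<lambda>_ _. 0)" "d 0 = 1" for n
    using f(1)[of n] f(1)[of 0] by (auto simp: P_def k_def c_def d_def)
  have km: "k n \<le> k (Suc n)" and dm: "d (Suc n) \<le> d n / 4"
    and near: "\<And>x \<theta>. x \<in> X \<Longrightarrow> norm (c (Suc n) x \<theta> - c n x \<theta>) \<le> d n / 4"
    and sep: "\<And>x y \<theta>. x \<in> X \<Longrightarrow> y \<in> X \<Longrightarrow> 1 / real (Suc n) \<le> dist x y \<Longrightarrow>
        \<exists>t. d (Suc n) \<le> norm (c (Suc n) (\<psi> t x) (\<theta> + t) - c (Suc n) (\<psi> t y) (\<theta> + t))" for n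
    using f(2)[of n] unfolding Q_def k_def c_def d_def by blast+
  define v where "v n x z = c n x (phase (k n) z)" for n x z
  have vc: "continuous_on (X \<times> solenoid) (\<lambda>p. v n (fst p) (snd p))" for n
    using continuous_on_phase[OF compact_X, of "c n" "k n"] adm[of n] by (simp add: admissible_def v_def case_prod_unfold)
  have vorb: "v n (\<psi> t x) (rot t z) = c n (\<psi> t x) (phase (k n) z + t)" if "x \<in> X" "z \<in> solenoid" for n t x z
    unfolding v_def by (rule admissible_phase(2)[OF adm flow_in that(2)]) (rule that(1))
  have vstep: "norm (v (Suc n) x z - v n x z) \<le> d n / 4" if "x \<in> X" "z \<in> solenoid" for n x z
  proof -
    \<comment> \<open>The phase at the next scale is also a lift at the current one, so both maps
      can be compared at the same phase.\<close>
    have "v n x z = c n x (phase (k (Suc n)) z)"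
      unfolding v_def by (rule admissible_phase(1)[OF adm that]) (rule cis_phase_le[OF that(2) km])
    then show ?thesis using near[OF that(1)] by (simp add: v_def)
  qed
  \<comment> \<open>Telescoping form of the geometric series: keeping the last margin in the bound
    lets the induction close without summation.\<close>
  have quarter: "A / 4 + (D - A) / 3 \<le> (D - B) / 3" if "B \<le> A / 4" for A B D :: real
    using that by (simp add: diff_divide_distrib)
  have vdist: "norm (v (n + i) x z - v n x z) \<le> (d n - d (n + i)) / 3" if "x \<in> X" "z \<in> solenoid" for n i x z
  proof (induction i)
    case (Suc i)
    have "norm (v (n + Suc i) x z - v n x z) \<le> norm (v (Suc (n + i)) x z - v (n + i) x z) + norm (v (n + i) x z - v n x z)"
      using norm_triangle_ineq[of "v (Suc (n + i)) x z - v (n + i) x z" "v (n + i) x z - v n x z"] by simp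
    also have "\<dots> \<le> d (n + i) / 4 + (d n - d (n + i)) / 3" using vstep[OF that, of "n + i"] Suc by linarith
    also have "\<dots> \<le> (d n - d (n + Suc i)) / 3" 
      using quarter[OF dm[of "n + i"]] by simp
    finally show ?case .
  qed simp
  have d4: "d n \<le> (1 / 4) ^ n" for n
  proof (induction n)
    case (Suc n)
    then show ?case using dm[of n] by simp
  qed (simp add: c0)
  have dl: "d \<longlonglongrightarrow> 0"
  proof (rule tendsto_sandwich[of "\<lambda>_. 0" d sequentially "\<lambda>n. (1 / 4) ^ n"])
    show "(\<lambda>n. (1 / 4 :: real) ^ n) \<longlonglongrightarrow> 0" by (rule LIMSEQ_realpow_zero) auto
  qed (use d0 d4 in \<open>auto intro!: always_eventually less_imp_le\<close>)
  have "Cauchy (\<lambda>n. v n x z)" if xz: "x \<in> X" "z \<in> solenoid" for x z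
  proof (rule CauchyI')
    fix e :: real assume "0 < e"
    then obtain M where M: "\<And>n. M \<le> n \<Longrightarrow> d n < e"
      using order_tendstoD(2)[OF dl] by (auto simp: eventually_sequentially)
    show "\<exists>M. \<forall>m\<ge>M. \<forall>n>m. dist (v m x z) (v n x z) < e"
    proof (intro exI[of _ M] allI impI)
      fix m n assume "M \<le> m" "m < n"
      then show "dist (v m x z) (v n x z) < e"
        using vdist[OF xz, of m "n - m"] M[of m] d0[of m] d0[of n] by (simp add: dist_norm norm_minus_commute)
    qed
  qed
  then have conv: "(\<lambda>n. v n x z) \<longlonglongrightarrow> lim (\<lambda>n. v n x z)" if "x \<in> X" "z \<in> solenoid" for x z
    using that Cauchy_convergent convergent_LIMSEQ_iff by blast
  define u where "u x z = lim (\<lambda>n. v n x z)" for x z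
  have ul: "(\<lambda>n. v n x z) \<longlonglongrightarrow> u x z" if "x \<in> X" "z \<in> solenoid" for x z
    using conv[OF that] by (simp add: u_def)
  have ud: "norm (u x z - v n x z) \<le> d n / 3" if "x \<in> X" "z \<in> solenoid" for x z n
  proof (rule LIMSEQ_le_const2)
    show "(\<lambda>i. norm (v (i + n) x z - v n x z)) \<longlonglongrightarrow> norm (u x z - v n x z)"
      by (intro tendsto_intros LIMSEQ_ignore_initial_segment ul that)
    show "\<exists>N. \<forall>i\<ge>N. norm (v (i + n) x z - v n x z) \<le> d n / 3"
    proof (intro exI[of _ 0] allI impI)
      fix i
      show "norm (v (i + n) x z - v n x z) \<le> d n / 3"
        using vdist[OF that, of n i] d0[of "n + i"] by (simp add: add.commute)
    qed
  qed
  have vb: "norm (v n x z) \<le> 1 / 2" if "x \<in> X" "z \<in> solenoid" for n x z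
    using vdist[OF that, of 0 n] d0[of n] c0 by (simp add: v_def)
  show thesis
  proof
    have "uniform_limit (X \<times> solenoid) (\<lambda>n p. v n (fst p) (snd p)) (\<lambda>p. u (fst p) (snd p)) sequentially"
    proof (rule uniform_limitI)
      fix e :: real assume e: "0 < e"
      show "\<forall>\<^sub>F n in sequentially. \<forall>p\<in>X \<times> solenoid. dist (v n (fst p) (snd p)) (u (fst p) (snd p)) < e"
        using order_tendstoD(2)[OF dl e]
      proof eventually_elim
        case (elim n)
        show ?case
        proof
          fix p assume "p \<in> X \<times> solenoid"
          then show "dist (v n (fst p) (snd p)) (u (fst p) (snd p)) < e"
            using ud[of "fst p" "snd p" n] elim d0[of n] by (auto simp: dist_norm norm_minus_commute)
        qed
      qed
    qed
    then have "continuous_on (X \<times> solenoid) (\<lambda>p. u (fst p) (snd p))"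
      by (rule uniform_limit_theorem[rotated]) (auto intro!: always_eventually vc)
    then show "continuous_on (X \<times> solenoid) (\<lambda>(x, z). u x z)" by (simp add: case_prod_unfold)
    show "norm (u x z) \<le> 1 / 2" if "x \<in> X" "z \<in> solenoid" for x z
      using ud[OF that, of 0] c0 by (simp add: v_def)
    show "band_limited a b (\<lambda>t. u (\<psi> t x) (rot t z))" if xz: "x \<in> X" "z \<in> solenoid" for x z
    proof (rule band_limited_limit)
      show "band_limited a b (\<lambda>t. v n (\<psi> t x) (rot t z))" for n
        unfolding vorb[OF xz] using adm[of n] xz(1) by (simp add: admissible_def)
      show "norm (v n (\<psi> t x) (rot t z)) \<le> 1 / 2" for n t
        by (intro vb flow_in rot_solenoid xz)
      show "(\<lambda>n. v n (\<psi> t x) (rot t z)) \<longlonglongrightarrow> u (\<psi> t x) (rot t z)" for t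
        by (intro ul flow_in rot_solenoid xz)
    qed
    show "x = y" if xy: "x \<in> X" "y \<in> X" and z: "z \<in> solenoid"
      and eq: "\<forall>t. u (\<psi> t x) (rot t z) = u (\<psi> t y) (rot t z)" for x y z
    proof (rule ccontr)
      assume "x \<noteq> y"
      then obtain n where n: "1 / real (Suc n) < dist x y" using nat_approx_posE[of "dist x y"] by auto
      obtain t where t: "d (Suc n) \<le> norm (v (Suc n) (\<psi> t x) (rot t z) - v (Suc n) (\<psi> t y) (rot t z))"
        using sep[OF xy less_imp_le[OF n], of "phase (k (Suc n)) z"] unfolding vorb[OF xy(1) z] vorb[OF xy(2) z] by blast
      have "norm (u (\<psi> t x) (rot t z) - v (Suc n) (\<psi> t x) (rot t z)) \<le> d (Suc n) / 3"
        "norm (u (\<psi> t y) (rot t z) - v (Suc n) (\<psi> t y) (rot t z)) \<le> d (Suc n) / 3"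
        by (intro ud flow_in rot_solenoid xy z)+
      then show False
        using t d0[of "Suc n"] eq[rule_format, of t]
          norm_triangle_ineq4[of "u (\<psi> t y) (rot t z) - v (Suc n) (\<psi> t y) (rot t z)" "u (\<psi> t x) (rot t z) - v (Suc n) (\<psi> t x) (rot t z)"]
        by (simp add: norm_minus_commute)
    qed
  qed
qed

end

section \<open>The spectrum of the solenoid\<close>

text \<open>The functions \<open>spectral\<close> put the coordinates \<open>z k\<close> at the isolated frequencies
  \<open>j0 / 2 ^ k0 - 1 / 2 ^ k\<close>, \<open>k \<ge> k0\<close>.\<close>

definition dyadic_char :: "int \<Rightarrow> nat \<Rightarrow> nat \<Rightarrow> (nat \<Rightarrow> complex) \<Rightarrow> complex" where
  "dyadic_char j0 k0 i z = z k0 powi j0 * cnj (z (k0 + i))"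

definition spectral :: "int \<Rightarrow> nat \<Rightarrow> (nat \<Rightarrow> complex) \<Rightarrow> complex" where
  "spectral j0 k0 z = (\<Sum>i. (1/2) ^ (i + 2) * dyadic_char j0 k0 i z)"

definition frequency :: "int \<Rightarrow> nat \<Rightarrow> nat \<Rightarrow> real" where
  "frequency j0 k0 i = of_int j0 / 2 ^ k0 - 1 / 2 ^ (k0 + i)"

lemma norm_dyadic_char: "z \<in> solenoid \<Longrightarrow> norm (dyadic_char j0 k0 i z) = 1"
  by (simp add: dyadic_char_def norm_mult norm_power_int solenoid_def)

lemma dyadic_char_rot: "dyadic_char j0 k0 i (rot t z) = dyadic_char j0 k0 i z * cexp (frequency j0 k0 i) t"
proof -
  have "cis (2 * pi * t / 2 ^ k0) powi j0 * cnj (cis (2 * pi * t / 2 ^ (k0 + i))) = cexp (frequency j0 k0 i) t"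
    by (simp add: cis_power_int cis_cnj cis_mult frequency_def algebra_simps)
  then show ?thesis
    by (simp add: dyadic_char_def rot_def power_int_mult_distrib mult_ac)
qed

text \<open>A character times the conjugate of the next one recovers a coordinate: the factor
  \<open>z k0 powi j0\<close> has norm 1 and cancels, and since \<open>z (k0 + i)\<close> is the
  square of its successor, one conjugate coordinate remains. Arbitrarily late coordinates determine
  the point.\<close>

lemma dyadic_char_determines:
  assumes z: "z \<in> solenoid" "w \<in> solenoid" and eq: "\<And>i. dyadic_char j0 k0 i z = dyadic_char j0 k0 i w"
  shows "z = w"
proof -
  have *: "dyadic_char j0 k0 i z * cnj (dyadic_char j0 k0 (Suc i) z) = cnj (z (k0 + Suc i))" if z: "z \<in> solenoid" for z i
  proof -
    have n: "norm (z k) = 1" for k using z by (simp add: solenoid_def)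
    have u: "x * cnj x = 1" if "norm x = 1" for x :: complex
      using that complex_norm_square[of x] by simp
    have "norm (z k0 powi j0) = 1" by (simp add: norm_power_int n)
    then have 1: "z k0 powi j0 * cnj (z k0 powi j0) = 1" by (rule u)
    have 2: "z (k0 + i) = (z (k0 + Suc i))\<^sup>2" using z by (simp add: solenoid_def)
    have "dyadic_char j0 k0 i z * cnj (dyadic_char j0 k0 (Suc i) z)
        = (z k0 powi j0 * cnj (z k0 powi j0)) * (cnj (z (k0 + i)) * z (k0 + Suc i))"
      by (simp add: dyadic_char_def mult_ac)
    also have "\<dots> = cnj (z (k0 + Suc i)) * (z (k0 + Suc i) * cnj (z (k0 + Suc i)))"
      unfolding 1 2 by (simp add: power2_eq_square mult_ac)
    also have "\<dots> = cnj (z (k0 + Suc i))" unfolding u[OF n] by simp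
    finally show ?thesis .
  qed
  have e: "z (k0 + Suc i) = w (k0 + Suc i)" for i
    using *[OF z(1), of i] *[OF z(2), of i] eq by (metis complex_cnj_cnj)
  show ?thesis
  proof
    fix k
    show "z k = w k" by (rule solenoid_coordinate_eq[OF z e[of k]]) simp
  qed
qed

lemma summable_spectral: "z \<in> solenoid \<Longrightarrow> summable (\<lambda>i. norm ((1/2) ^ (i + 2) * dyadic_char j0 k0 i z))"
  using summable_mult2[OF summable_geometric[of "1/2::real"], of "1/4"]
  by (simp add: norm_mult norm_dyadic_char norm_power norm_divide)

text \<open>The weights add up to less than 1/2, half the radius of the unit ball; the other half is
  left to the code of X.\<close>

lemma spectral_partial_norm:
  assumes "z \<in> solenoid"
  shows "norm (\<Sum>i<n. (1/2) ^ (i + 2) * dyadic_char j0 k0 i z) \<le> 1 / 2"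
proof -
  have "norm (\<Sum>i<n. (1/2) ^ (i + 2) * dyadic_char j0 k0 i z) \<le> (\<Sum>i<n. (1/2) ^ (i + 2))"
    by (rule sum_norm_le) (simp add: norm_mult norm_dyadic_char[OF assms] norm_power norm_divide)
  also have "\<dots> = 1/2 - (1/2) ^ (n + 1)"
    by (induction n) (auto simp: field_simps)
  also have "\<dots> \<le> 1/2" by simp
  finally show ?thesis .
qed

lemma spectral_tendsto:
  assumes "z \<in> solenoid"
  shows "(\<lambda>n. \<Sum>i<n. (1/2) ^ (i + 2) * dyadic_char j0 k0 i z) \<longlonglongrightarrow> spectral j0 k0 z"
  unfolding spectral_def by (rule summable_LIMSEQ[OF summable_norm_cancel[OF summable_spectral[OF assms]]])

lemma norm_spectral: "z \<in> solenoid \<Longrightarrow> norm (spectral j0 k0 z) \<le> 1 / 2"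
  using LIMSEQ_le_const2[OF tendsto_norm[OF spectral_tendsto]] spectral_partial_norm by blast

lemma continuous_on_spectral: "continuous_on solenoid (spectral j0 k0)"
proof -
  have "uniform_limit solenoid (\<lambda>n z. \<Sum>i<n. (1/2) ^ (i + 2) * dyadic_char j0 k0 i z) (\<lambda>z. \<Sum>i. (1/2) ^ (i + 2) * dyadic_char j0 k0 i z) sequentially"
  proof (rule Weierstrass_m_test)
    show "summable (\<lambda>i. (1/2::real) ^ (i + 2))"
      using summable_mult2[OF summable_geometric[of "1/2::real"], of "1/4"] by simp
  qed (simp add: norm_mult norm_dyadic_char norm_power norm_divide)
  then have "continuous_on solenoid (\<lambda>z. \<Sum>i. (1/2) ^ (i + 2) * dyadic_char j0 k0 i z)"
  proof (rule uniform_limit_theorem[rotated])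
    have "z k0 \<noteq> 0" if "z \<in> solenoid" for z using that by (auto simp: solenoid_def dest: spec[of _ k0])
    then show "\<forall>\<^sub>F n in sequentially. continuous_on solenoid (\<lambda>z. \<Sum>i<n. (1/2) ^ (i + 2) * dyadic_char j0 k0 i z)"
      unfolding dyadic_char_def
      by (intro always_eventually allI continuous_intros continuous_on_power_int continuous_on_coordinate) auto
  qed simp
  then show ?thesis by (simp add: spectral_def[abs_def])
qed

text \<open>The frequencies increase with i and their gaps halve: the nearest neighbour of number i
  is number i + 1, at exactly this distance.\<close>

lemma frequency_isolated:
  assumes "i \<noteq> l"
  shows "1 / 2 ^ (k0 + i + 1) \<le> \<bar>frequency j0 k0 l - frequency j0 k0 i\<bar>"
proof -
  have *: "1 / 2 ^ (p + 1) \<le> 1 / 2 ^ p - 1 / (2::real) ^ q" if "p < q" for p q :: nat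
  proof -
    have "(2::real) ^ (p + 1) \<le> 2 ^ q" using that by (intro power_increasing) auto
    then have "1 / (2::real) ^ q \<le> 1 / 2 ^ (p + 1)" by (intro divide_left_mono) auto
    then show ?thesis by simp
  qed
  show ?thesis
  proof (cases "i < l")
    case True
    then show ?thesis using *[of "k0 + i" "k0 + l"] by (simp add: frequency_def)
  next
    case False
    then have "l < i" using assms by simp
    moreover have "1 / (2::real) ^ (k0 + i + 1) \<le> 1 / 2 ^ (k0 + l + 1)"
      using \<open>l < i\<close> by (intro divide_left_mono power_increasing) auto
    ultimately show ?thesis using *[of "k0 + l" "k0 + i"] by (simp add: frequency_def)
  qed
qed

lemma band_limited_spectral:
  assumes "z \<in> solenoid" "\<And>i. frequency j0 k0 i \<in> {a..b}"
  shows "band_limited a b (\<lambda>t. spectral j0 k0 (rot t z))"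
proof (rule band_limited_limit)
  show "band_limited a b (\<lambda>t. \<Sum>i<n. (1/2) ^ (i + 2) * dyadic_char j0 k0 i (rot t z))" for n
    unfolding dyadic_char_rot by (intro band_limited_sum band_limited_cmult band_limited_cexp assms(2))
  show "norm (\<Sum>i<n. (1/2) ^ (i + 2) * dyadic_char j0 k0 i (rot t z)) \<le> 1 / 2" for n t
    by (intro spectral_partial_norm rot_solenoid assms)
  show "(\<lambda>n. \<Sum>i<n. (1/2) ^ (i + 2) * dyadic_char j0 k0 i (rot t z)) \<longlonglongrightarrow> spectral j0 k0 (rot t z)" for t
    by (intro spectral_tendsto rot_solenoid assms)
qed

text \<open>Every other frequency is at least \<delta> away, where the probe gives 0; dominated
  convergence passes from partial sums to the series.\<close>

lemma integral_spectral_probe: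
  fixes j0 :: int
  assumes z: "z \<in> solenoid" and \<delta>: "0 < \<delta>" "\<delta> \<le> 1 / 2 ^ (k0 + i + 1)"
  defines "q \<equiv> probe (frequency j0 k0 i) \<delta>"
  shows "(LINT t|lborel. spectral j0 k0 (rot t z) * q t) =
    (1/2) ^ (i + 2) * dyadic_char j0 k0 i z * (LINT t|lborel. cexp (frequency j0 k0 i) t * q t)"
proof -
  let ?f = "\<lambda>n t. \<Sum>l<n. (1/2) ^ (l + 2) * dyadic_char j0 k0 l (rot t z)"
  let ?\<kappa> = "LINT t|lborel. cexp (frequency j0 k0 i) t * q t"
  have q: "integrable lborel q" unfolding q_def by (rule integrable_probe[OF \<delta>(1)])
  have ic: "integrable lborel (\<lambda>t. cexp \<mu> t * q t)" for \<mu>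
    by (intro integrable_bounded_mult q borel_measurable_continuous_onI continuous_intros) (auto intro: boundedI[where B=1])
  have lim: "(\<lambda>n. LINT t|lborel. ?f n t * q t) \<longlonglongrightarrow> (LINT t|lborel. spectral j0 k0 (rot t z) * q t)"
  proof (rule bounded_pointwise_limit_integral[OF _ _ _ q])
    show "?f n \<in> borel_measurable borel" for n
      unfolding dyadic_char_rot by (intro borel_measurable_continuous_onI continuous_intros)
    show "norm (?f n t) \<le> 1 / 2" for n t by (intro spectral_partial_norm rot_solenoid z)
    show "(\<lambda>n. ?f n t) \<longlonglongrightarrow> spectral j0 k0 (rot t z)" for t by (intro spectral_tendsto rot_solenoid z)
  qed
  have F: "(LINT t|lborel. ?f n t * q t) = (1/2) ^ (i + 2) * dyadic_char j0 k0 i z * ?\<kappa>" if n: "i < n" for n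
  proof -
    have "(LINT t|lborel. ?f n t * q t) = (LINT t|lborel. (\<Sum>l<n. ((1/2) ^ (l + 2) * dyadic_char j0 k0 l z) * (cexp (frequency j0 k0 l) t * q t)))"
      unfolding dyadic_char_rot sum_distrib_right by (simp only: mult.assoc)
    also have "\<dots> = (\<Sum>l<n. (1/2) ^ (l + 2) * dyadic_char j0 k0 l z * (LINT t|lborel. cexp (frequency j0 k0 l) t * q t))"
      using ic by (subst Bochner_Integration.integral_sum) auto
    also have "\<dots> = (\<Sum>l\<in>{i}. (1/2) ^ (l + 2) * dyadic_char j0 k0 l z * (LINT t|lborel. cexp (frequency j0 k0 l) t * q t))"
    proof (rule sum.mono_neutral_right)
      show "\<forall>l\<in>{..<n} - {i}. (1/2) ^ (l + 2) * dyadic_char j0 k0 l z * (LINT t|lborel. cexp (frequency j0 k0 l) t * q t) = 0"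
      proof
        fix l assume "l \<in> {..<n} - {i}"
        then have "\<delta> \<le> \<bar>frequency j0 k0 l - frequency j0 k0 i\<bar>"
          using frequency_isolated[of i l k0 j0] \<delta>(2) by auto
        then show "(1/2) ^ (l + 2) * dyadic_char j0 k0 l z * (LINT t|lborel. cexp (frequency j0 k0 l) t * q t) = 0"
          unfolding q_def using integral_cexp_probe(1)[OF \<delta>(1)] by simp
      qed
    qed (use n in auto)
    finally show ?thesis by simp
  qed
  have "\<forall>\<^sub>F n in sequentially. (LINT t|lborel. ?f n t * q t) = (1/2) ^ (i + 2) * dyadic_char j0 k0 i z * ?\<kappa>"
    by (rule eventually_mono[OF eventually_gt_at_top[of i] F])
  then have "(\<lambda>n. LINT t|lborel. ?f n t * q t) \<longlonglongrightarrow> (1/2) ^ (i + 2) * dyadic_char j0 k0 i z * ?\<kappa>"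
    by (rule tendsto_eventually)
  then show ?thesis using lim LIMSEQ_unique by blast
qed

text \<open>A probe narrow enough to miss both [a, c] and the other frequencies annihilates the
  difference by the band condition, while on each summand it reads off a nonzero multiple of a
  character.\<close>

lemma spectral_separates:
  assumes z: "z \<in> solenoid" "w \<in> solenoid" and c: "c < frequency j0 k0 0"
    and bl: "band_limited a c (\<lambda>t. spectral j0 k0 (rot t z) - spectral j0 k0 (rot t w))"
  shows "z = w"
proof (rule dyadic_char_determines[OF z])
  fix i
  have "frequency j0 k0 0 \<le> frequency j0 k0 i"
    by (simp add: frequency_def divide_left_mono)
  then have ci: "c < frequency j0 k0 i" using c by simp
  define \<delta> where "\<delta> = min (frequency j0 k0 i - c) (1 / 2 ^ (k0 + i + 1))"
  have \<delta>: "0 < \<delta>" "\<delta> \<le> 1 / 2 ^ (k0 + i + 1)" "\<delta> \<le> frequency j0 k0 i - c" using ci by (auto simp: \<delta>_def)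
  let ?q = "probe (frequency j0 k0 i) \<delta>"
  let ?\<kappa> = "LINT t|lborel. cexp (frequency j0 k0 i) t * ?q t"
  have q: "integrable lborel ?q" by (rule integrable_probe[OF \<delta>(1)])
  have "kills a c ?q"
    unfolding kills_def using q \<delta>(3) by (auto intro!: integral_cexp_probe(1)[OF \<delta>(1)])
  then have "0 = (LINT t|lborel. (spectral j0 k0 (rot t z) - spectral j0 k0 (rot t w)) * ?q t)"
    using bl by (simp add: band_limited_def)
  also have "\<dots> = (LINT t|lborel. spectral j0 k0 (rot t z) * ?q t) - (LINT t|lborel. spectral j0 k0 (rot t w) * ?q t)"
  proof -
    have "integrable lborel (\<lambda>t. spectral j0 k0 (rot t x) * ?q t)" if x: "x \<in> solenoid" for x
    proof (rule integrable_bounded_mult[OF _ _ q])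
      have "continuous_on UNIV (\<lambda>t. (\<lambda>(r, z). rot r z) (t, x))"
        by (rule continuous_on_compose2[OF continuous_on_rot[of UNIV]]) (rule continuous_on_Pair continuous_on_id continuous_on_const | simp)+
      then have "continuous_on UNIV (\<lambda>t. rot t x)" by (simp only: prod.case)
      then have "continuous_on UNIV (\<lambda>t. spectral j0 k0 (rot t x))"
        by (rule continuous_on_compose2[OF continuous_on_spectral]) (use rot_solenoid[OF x] in blast)
      then show "(\<lambda>t. spectral j0 k0 (rot t x)) \<in> borel_measurable borel" by (rule borel_measurable_continuous_onI)
      show "bounded (range (\<lambda>t. spectral j0 k0 (rot t x)))"
        unfolding bounded_iff using norm_spectral[OF rot_solenoid[OF x]] by blast
    qed
    then show ?thesis using z by (simp add: left_diff_distrib)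
  qed
  also have "\<dots> = (1/2) ^ (i + 2) * ?\<kappa> * (dyadic_char j0 k0 i z - dyadic_char j0 k0 i w)"
    unfolding integral_spectral_probe[OF z(1) \<delta>(1,2)] integral_spectral_probe[OF z(2) \<delta>(1,2)]
    by (simp add: algebra_simps)
  finally show "dyadic_char j0 k0 i z = dyadic_char j0 k0 i w"
    using integral_cexp_probe(2)[OF \<delta>(1)] by simp
qed

text \<open>\<open>j0\<close> / 2^\<open>k0\<close> is the largest multiple of 2^-\<open>k0\<close>
  not above b. All frequencies lie within one step below it, and 2 / 2^\<open>k0\<close> < b - c
  keeps even the lowest one above c.\<close>

lemma exists_frequencies:
  assumes "c < b"
  obtains j0 k0 where "c < frequency j0 k0 0" "\<And>i. frequency j0 k0 i \<in> {c..b}"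
proof -
  have "(\<lambda>k. 2 / (2::real) ^ k) \<longlonglongrightarrow> 0" by real_asymp
  then obtain k where k: "2 / (2::real) ^ k < b - c"
    using order_tendstoD(2)[of "\<lambda>k. 2 / (2::real) ^ k" 0 sequentially "b - c"] assms
    by (auto simp: eventually_sequentially)
  define j where "j = \<lfloor>b * 2 ^ k\<rfloor>"
  have j: "of_int j \<le> b * 2 ^ k" "b * 2 ^ k < of_int j + 1" unfolding j_def by linarith+
  have "b < (of_int j + 1) / 2 ^ k" using j(2) by (simp add: pos_less_divide_eq)
  then have jb: "of_int j / 2 ^ k \<le> b" "b - 1 / 2 ^ k < of_int j / 2 ^ k"
    using j(1) by (simp_all add: pos_divide_le_eq add_divide_distrib)
  have f0: "c < frequency j k 0" using jb(2) k by (simp add: frequency_def)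
  have "frequency j k i \<in> {c..b}" for i
  proof -
    have "frequency j k 0 \<le> frequency j k i" by (simp add: frequency_def divide_left_mono)
    moreover have "0 \<le> 1 / (2::real) ^ (k + i)" by simp
    then have "frequency j k i \<le> b" using jb(1) unfolding frequency_def by linarith
    ultimately show ?thesis using f0 by simp
  qed
  with f0 show thesis by (rule that)
qed

section \<open>The embedding\<close>

lemma continuous_map_metricI:
  assumes "\<And>x. x \<in> mspace m1 \<Longrightarrow> f x \<in> mspace m2"
    and "\<And>x e. x \<in> mspace m1 \<Longrightarrow> 0 < e \<Longrightarrow> \<exists>\<delta>>0. \<forall>y\<in>mspace m1. mdist m1 x y < \<delta> \<longrightarrow> mdist m2 (f x) (f y) < e"
  shows "continuous_map (mtopology_of m1) (mtopology_of m2) f"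
proof -
  have "f ` mspace m1 \<subseteq> mspace m2" using assms(1) by blast
  moreover have "\<forall>x\<in>mspace m1. \<forall>e>0. \<exists>\<delta>>0. \<forall>y. y \<in> mspace m1 \<and> mdist m1 x y < \<delta> \<longrightarrow> mdist m2 (f x) (f y) < e"
    using assms(2) by blast
  ultimately show ?thesis
    unfolding mtopology_of_def
    by (subst Metric_space.metric_continuous_map[OF Metric_space_mspace_mdist Metric_space_mspace_mdist]) blast
qed

text \<open>By compactness a map with \<epsilon>-small fibres admits a \<delta> such that
  \<delta>-close values force \<epsilon>-close orbits over [0, N]. A \<delta>-fine cover of the
  target with multiplicity at most n + 1 has a partition of unity, which is pulled back.\<close>

lemma width_partition_if_small_width:
  fixes X :: "'a metric" and e :: "'a \<Rightarrow> 'b::metric_space"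
  assumes fl: "flow X \<phi>" and N: "0 \<le> N" and sw: "flow_small_width X \<phi> \<epsilon> N n"
    and iso: "\<And>x y. x \<in> mspace X \<Longrightarrow> y \<in> mspace X \<Longrightarrow> dist (e x) (e y) = mdist X x y"
    and cf: "compact_flow (e ` mspace X) \<psi>" and \<psi>: "\<And>r x. x \<in> mspace X \<Longrightarrow> \<psi> r (e x) = e (\<phi> r x)"
  shows "compact_flow.width_partition (e ` mspace X) \<psi> \<epsilon> N (nat (n + 1))"
proof -
  let ?X = "e ` mspace X"
  interpret compact_flow ?X \<psi> by fact
  obtain C :: "(nat \<Rightarrow>\<^sub>C real) set" and f where C: "compact C" "covering_dim_le (top_of_set C) n"
    "continuous_map (mtopology_of X) (top_of_set C) f"
    "\<And>x y. x \<in> mspace X \<Longrightarrow> y \<in> mspace X \<Longrightarrow> f x = f y \<Longrightarrow> flow_dist X \<phi> N x y < \<epsilon>"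
    using sw unfolding flow_small_width_def small_width_def by auto
  obtain g where g: "homeomorphic_maps (mtopology_of X) (top_of_set ?X) e g"
    using isometry_homeomorphic[OF iso] homeomorphic_map_maps by blast
  then have ge: "\<And>x. x \<in> mspace X \<Longrightarrow> g (e x) = x" and cg: "continuous_map (top_of_set ?X) (mtopology_of X) g"
    by (auto simp: homeomorphic_maps_def)
  define h where "h = f \<circ> g"
  have "continuous_map (top_of_set ?X) (top_of_set C) h" unfolding h_def by (rule continuous_map_compose[OF cg C(3)])
  then have hc: "continuous_on ?X h" and hC: "\<And>x. x \<in> ?X \<Longrightarrow> h x \<in> C"
    by (auto simp: continuous_map_in_subtopology)
  have hsmall: "dist (\<psi> r x) (\<psi> r y) < \<epsilon>" if xy: "x \<in> ?X" "y \<in> ?X" "h x = h y" "r \<in> {0..N}" for x y r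
  proof -
    obtain x' y' where x': "x' \<in> mspace X" "x = e x'" and y': "y' \<in> mspace X" "y = e y'" using xy(1,2) by blast
    have "flow_dist X \<phi> N x' y' < \<epsilon>" using C(4)[OF x'(1) y'(1)] xy(3) x' y' by (simp add: h_def ge)
    moreover have "mdist X (\<phi> r x') (\<phi> r y') \<le> flow_dist X \<phi> N x' y'" by (rule le_flow_dist[OF fl x'(1) y'(1) xy(4)])
    ultimately show ?thesis using x' y' flow_in_mspace[OF fl] by (simp add: \<psi> iso)
  qed
  \<comment> \<open>The bad triples form a compact set, on which the distance of the
    \<open>h\<close> values is positive and so has a positive lower bound \<delta>.\<close>
  define K where "K = ({0..N} \<times> (?X \<times> ?X)) \<inter> (\<lambda>z. dist (\<psi> (fst z) (fst (snd z))) (\<psi> (fst z) (snd (snd z)))) -` {\<epsilon>..}"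
  have cA: "compact ({0..N} \<times> (?X \<times> ?X))" by (intro compact_Times compact_X compact_Icc)
  have "continuous_on ({0..N} \<times> (?X \<times> ?X)) (\<lambda>z. dist (\<psi> (fst z) (fst (snd z))) (\<psi> (fst z) (snd (snd z))))"
    by (intro continuous_intros) auto
  then have "closed K" unfolding K_def by (intro continuous_closed_preimage compact_imp_closed[OF cA]) auto
  then have cK: "compact K" using compact_Int_closed[OF cA, of K] by (simp add: K_def)
  define s where "s z = dist (h (fst (snd z))) (h (snd (snd z)))" for z :: "real \<times> 'b \<times> 'b"
  have sc: "continuous_on K s"
    unfolding s_def by (intro continuous_intros continuous_on_compose2[OF hc]) (auto simp: K_def)
  have spos: "0 < s z" if z: "z \<in> K" for z
  proof (rule ccontr)
    assume "\<not> 0 < s z"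
    then have "h (fst (snd z)) = h (snd (snd z))" by (simp add: s_def)
    moreover have "fst (snd z) \<in> ?X" "snd (snd z) \<in> ?X" "fst z \<in> {0..N}" using z unfolding K_def by auto
    ultimately show False using hsmall[of "fst (snd z)" "snd (snd z)" "fst z"] z by (auto simp: K_def)
  qed
  obtain \<delta> where \<delta>: "0 < \<delta>" "\<And>z. z \<in> K \<Longrightarrow> \<delta> \<le> s z"
  proof (cases "K = {}")
    case True
    then show ?thesis using that[of 1] by auto
  next
    case False
    then obtain z where "z \<in> K" "\<And>z'. z' \<in> K \<Longrightarrow> s z \<le> s z'" using continuous_attains_inf[OF cK _ sc] by blast
    then show ?thesis using that[of "s z"] spos by blast
  qed
  obtain \<V> where "fine_cover C n \<delta> \<V>" by (rule covering_dim_le_refine[OF C(1,2) \<delta>(1)])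
  note \<V> = fine_coverD[OF this]
  obtain p where "unity_partition C \<V> p" by (rule partition_of_unity[OF C(1) \<V>(1-3)])
  note p = unity_partitionD[OF this]
  have pW: "p W (h x) \<noteq> 0 \<longleftrightarrow> h x \<in> W" if "W \<in> \<V>" "x \<in> ?X" for W x
    using p(2,3)[OF that(1) hC[OF that(2)]] by linarith
  have "width_partition_by \<V> (\<lambda>W x. p W (h x)) \<epsilon> N (nat (n + 1))"
    unfolding width_partition_by_def
  proof (intro conjI ballI impI)
    show "finite \<V>" by (rule \<V>(1))
    show "continuous_on ?X (\<lambda>x. p W (h x))" if "W \<in> \<V>" for W
      by (rule continuous_on_compose2[OF p(1)[OF that] hc]) (use hC in blast)
    show "0 \<le> p W (h x)" if "W \<in> \<V>" "x \<in> ?X" for W x using p(2)[OF that(1) hC[OF that(2)]] .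
    show "(\<Sum>W\<in>\<V>. p W (h x)) = 1" if "x \<in> ?X" for x using p(4)[OF hC[OF that]] .
    show "card {W \<in> \<V>. p W (h x) \<noteq> 0} \<le> nat (n + 1)" if "x \<in> ?X" for x
    proof -
      have "{W \<in> \<V>. p W (h x) \<noteq> 0} = {W \<in> \<V>. h x \<in> W}" using pW[OF _ that] by blast
      then show ?thesis using \<V>(5)[OF hC[OF that]] by simp
    qed
    fix W x y r assume *: "W \<in> \<V>" "x \<in> ?X" "y \<in> ?X" "p W (h x) \<noteq> 0" "p W (h y) \<noteq> 0" "r \<in> {0..N}"
    then have "dist (h x) (h y) < \<delta>" using \<V>(4)[OF *(1)] pW by blast
    then have "(r, x, y) \<notin> K" using \<delta>(2)[of "(r, x, y)"] by (auto simp: s_def)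
    then show "dist (\<psi> r x) (\<psi> r y) < \<epsilon>" using * by (auto simp: K_def)
  qed
  then show ?thesis unfolding width_partition_def by blast
qed

text \<open>The first N suprema are at most \<eta>, with total weight at most 1; the remaining ones
  are at most 2, with total weight 2^-N.\<close>

lemma loc_unif_dist_le:
  fixes f g :: "real \<Rightarrow>\<^sub>C complex"
  assumes fg: "norm f \<le> 1" "norm g \<le> 1" and near: "\<And>t. \<bar>t\<bar> \<le> real N \<Longrightarrow> norm (f t - g t) \<le> \<eta>"
  shows "loc_unif_dist f g \<le> \<eta> + 2 * (1/2) ^ N"
proof -
  have 1: "norm (f t - g t) \<le> 2" for t
    using norm_triangle_ineq4[of "f t" "g t"] norm_bounded[of f t] norm_bounded[of g t] fg by linarith
  have s1: "sup_dist_on n f g \<le> 2" for n unfolding sup_dist_on_def by (intro cSUP_least 1) auto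
  have s2: "sup_dist_on n f g \<le> \<eta>" if "n \<le> N" for n
    unfolding sup_dist_on_def using that by (intro cSUP_least near) auto
  have \<eta>: "0 \<le> \<eta>" using near[of 0] norm_ge_zero[of "f 0 - g 0"] by linarith
  have g: "(\<lambda>n. (1/2::real) ^ Suc n) sums 1" by (rule power_half_series)
  have a: "(\<lambda>n. (1/2::real) ^ Suc n * \<eta>) sums \<eta>" using sums_mult2[OF g, of \<eta>] by simp
  have "(\<lambda>n. if n + N < N then 0 else (1/2::real) ^ Suc (n + N)) sums (1/2) ^ N"
    using sums_mult2[OF g, of "(1/2) ^ N"] by (simp add: power_add)
  then have "(\<lambda>n. if n < N then 0 else (1/2::real) ^ Suc n) sums ((1/2) ^ N + (\<Sum>n<N. if n < N then 0 else (1/2) ^ Suc n))"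
    by (subst (asm) sums_iff_shift) simp
  then have "(\<lambda>n. if n < N then 0 else (1/2::real) ^ Suc n) sums (1/2) ^ N" by simp
  from sums_mult[OF this, of 2] have b: "(\<lambda>n. 2 * (if n < N then 0 else (1/2::real) ^ Suc n)) sums (2 * (1/2) ^ N)" .
  have "loc_unif_dist f g \<le> (\<Sum>n. (1/2) ^ Suc n * \<eta> + 2 * (if n < N then 0 else (1/2) ^ Suc n))"
    unfolding loc_unif_dist_def
  proof (rule suminf_le[OF _ summable_loc_unif_dist sums_summable[OF sums_add[OF a b]]])
    fix n
    show "(1/2) ^ Suc n * sup_dist_on (Suc n) f g \<le> (1/2) ^ Suc n * \<eta> + 2 * (if n < N then 0 else (1/2) ^ Suc n)"
    proof (cases "n < N")
      case True
      then show ?thesis using mult_left_mono[OF s2[of "Suc n"], of "(1/2) ^ Suc n"] by simp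
    next
      case False
      have "(1/2) ^ Suc n * sup_dist_on (Suc n) f g \<le> (1/2) ^ Suc n * 2" by (intro mult_left_mono s1) auto
      also have "\<dots> \<le> (1/2) ^ Suc n * \<eta> + (1/2) ^ Suc n * 2" using \<eta> by simp
      finally show ?thesis using False by (simp add: mult.commute)
    qed
  qed
  also have "\<dots> = \<eta> + 2 * (1/2) ^ N" using sums_unique[OF sums_add[OF a b]] by simp
  finally show ?thesis .
qed

section \<open>Adding the two codes\<close>

context compact_flow
begin

lemma continuous_on_product_orbit:
  "continuous_on (UNIV \<times> (X \<times> solenoid)) (\<lambda>q. (\<psi> (fst q) (fst (snd q)), rot (fst q) (snd (snd q))))"
proof (rule continuous_on_Pair)
  show "continuous_on (UNIV \<times> (X \<times> solenoid)) (\<lambda>q. \<psi> (fst q) (fst (snd q)))"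
    by (intro continuous_on_flow continuous_on_fst continuous_on_snd continuous_on_id) auto
  have "continuous_on (UNIV \<times> (X \<times> solenoid)) (\<lambda>q. (\<lambda>(r, z). rot r z) (fst q, snd (snd q)))"
    by (rule continuous_on_compose2[OF continuous_on_rot[of UNIV]])
      (rule continuous_on_Pair continuous_on_fst continuous_on_snd continuous_on_id | simp)+
  then show "continuous_on (UNIV \<times> (X \<times> solenoid)) (\<lambda>q. rot (fst q) (snd (snd q)))" by (simp only: prod.case)
qed

text \<open>\<open>H (x, z)\<close> records \<open>u\<close> plus \<open>spectral\<close> along the
  orbit. If two such functions agree, the difference of the spectral parts is a difference of values
  of \<open>u\<close>, so its band is in [a, c] and z is recovered. The spectral parts then cancel,
  and \<open>u\<close> separates the points over this common z.\<close>

lemma exists_embedding: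
  assumes ac: "a < c" "c < b" and \<rho>0: "0 < \<rho>0" "\<rho>0 < c - a"
    and wp: "\<And>\<epsilon>. 0 < \<epsilon> \<Longrightarrow> \<forall>\<^sub>F N in at_top. \<exists>m. width_partition \<epsilon> N m \<and> real m \<le> \<rho>0 * N"
  obtains H where "inj_on H (X \<times> solenoid)" "\<And>p. p \<in> X \<times> solenoid \<Longrightarrow> H p \<in> B1V a b"
    "\<And>r x z. x \<in> X \<Longrightarrow> z \<in> solenoid \<Longrightarrow> translate r (H (x, z)) = H (\<psi> r x, rot r z)"
    "continuous_map (top_of_set (X \<times> solenoid)) (mtopology_of (B1V_metric a b)) H"
proof -
  obtain u where u: "continuous_on (X \<times> solenoid) (\<lambda>(x, z). u x z)"
    "\<And>x z. x \<in> X \<Longrightarrow> z \<in> solenoid \<Longrightarrow> norm (u x z) \<le> 1 / 2"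
    "\<And>x z. x \<in> X \<Longrightarrow> z \<in> solenoid \<Longrightarrow> band_limited a c (\<lambda>t. u (\<psi> t x) (rot t z))"
    "\<And>x y z. x \<in> X \<Longrightarrow> y \<in> X \<Longrightarrow> z \<in> solenoid \<Longrightarrow> \<forall>t. u (\<psi> t x) (rot t z) = u (\<psi> t y) (rot t z) \<Longrightarrow> x = y"
    using exists_separating_map[OF \<rho>0 wp] by blast
  obtain j0 k0 where fr: "c < frequency j0 k0 0" "\<And>i. frequency j0 k0 i \<in> {c..b}"
    using exists_frequencies[OF ac(2)] by blast
  define w where "w p = u (fst p) (snd p) + spectral j0 k0 (snd p)" for p
  have wc: "continuous_on (X \<times> solenoid) w"
    unfolding w_def using u(1)
    by (intro continuous_intros continuous_on_compose2[OF continuous_on_spectral]) (auto simp: case_prod_unfold)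
  have w1: "norm (w p) \<le> 1" if "p \<in> X \<times> solenoid" for p
    using norm_triangle_ineq[of "u (fst p) (snd p)" "spectral j0 k0 (snd p)"] u(2)[of "fst p" "snd p"]
      norm_spectral[of "snd p" j0 k0] that by (auto simp: w_def)
  define orb where "orb t p = (\<psi> t (fst p), rot t (snd p))" for t p
  have orb_in: "orb t p \<in> X \<times> solenoid" if "p \<in> X \<times> solenoid" for t p
    using that by (auto simp: orb_def intro: flow_in rot_solenoid)
  have orb_c: "continuous_on (UNIV \<times> (X \<times> solenoid)) (\<lambda>q. orb (fst q) (snd q))"
    unfolding orb_def by (rule continuous_on_product_orbit)
  have worb_c: "continuous_on (UNIV \<times> (X \<times> solenoid)) (\<lambda>q. w (orb (fst q) (snd q)))"
    by (rule continuous_on_compose2[OF wc orb_c], rule image_subsetI, rule orb_in) auto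
  define H where "H p = Bcontfun (\<lambda>t. w (orb t p))" for p
  have H: "apply_bcontfun (H p) t = w (orb t p)" if p: "p \<in> X \<times> solenoid" for p t
  proof -
    have "continuous_on UNIV (\<lambda>t. (\<lambda>q. w (orb (fst q) (snd q))) (t, p))"
      by (rule continuous_on_compose2[OF worb_c]) (use p in \<open>auto intro!: continuous_intros\<close>)
    then have "(\<lambda>t. w (orb t p)) \<in> bcontfun"
      using w1[OF orb_in[OF p]] by (auto simp: bcontfun_def intro!: boundedI[where B=1])
    then show ?thesis by (simp add: H_def Bcontfun_inverse)
  qed
  have H1: "norm (H p) \<le> 1" if p: "p \<in> X \<times> solenoid" for p
    by (rule norm_bound) (simp add: H[OF p] w1 orb_in p)
  have bl: "band_limited a b (\<lambda>t. w (orb t p))" if p: "p \<in> X \<times> solenoid" for p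
    unfolding w_def orb_def fst_conv snd_conv
  proof (rule band_limited_add)
    show "band_limited a b (\<lambda>t. u (\<psi> t (fst p)) (rot t (snd p)))"
      by (rule band_limited_mono[OF u(3)]) (use p ac in auto)
    show "band_limited a b (\<lambda>t. spectral j0 k0 (rot t (snd p)))"
      by (rule band_limited_mono[OF band_limited_spectral[OF _ fr(2)]]) (use p ac in auto)
  qed
  have HB: "H p \<in> B1V a b" if p: "p \<in> X \<times> solenoid" for p
  proof -
    have "apply_bcontfun (H p) = (\<lambda>t. w (orb t p))" using H[OF p] by blast
    then have "H p \<in> V a b" using bl[OF p] by (intro band_limited_imp_V) simp
    then show ?thesis using H1[OF p] by (simp add: B1V_def)
  qed
  show thesis
  proof
    show "H p \<in> B1V a b" if "p \<in> X \<times> solenoid" for p by (rule HB[OF that])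
    show "translate r (H (x, z)) = H (\<psi> r x, rot r z)" if "x \<in> X" "z \<in> solenoid" for r x z
    proof (rule bcontfun_eqI)
      fix t
      have p: "(x, z) \<in> X \<times> solenoid" "(\<psi> r x, rot r z) \<in> X \<times> solenoid" using that by (auto intro: flow_in rot_solenoid)
      show "apply_bcontfun (translate r (H (x, z))) t = apply_bcontfun (H (\<psi> r x, rot r z)) t"
        unfolding apply_translate H[OF p(1)] H[OF p(2)] by (simp add: orb_def flow_plus that rot_rot)
    qed
    show "inj_on H (X \<times> solenoid)"
    proof (rule inj_onI)
      fix p q assume pq: "p \<in> X \<times> solenoid" "q \<in> X \<times> solenoid" "H p = H q"
      then have "w (orb t p) = w (orb t q)" for t using H by metis
      then have eq: "u (\<psi> t (fst p)) (rot t (snd p)) + spectral j0 k0 (rot t (snd p)) =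
        u (\<psi> t (fst q)) (rot t (snd q)) + spectral j0 k0 (rot t (snd q))" for t
        by (simp add: w_def orb_def)
      have in': "fst p \<in> X" "fst q \<in> X" "snd p \<in> solenoid" "snd q \<in> solenoid" using pq by auto
      have "band_limited a c (\<lambda>t. u (\<psi> t (fst q)) (rot t (snd q)) + (- 1) * u (\<psi> t (fst p)) (rot t (snd p)))"
        by (intro band_limited_add band_limited_cmult u(3) in')
      also have "(\<lambda>t. u (\<psi> t (fst q)) (rot t (snd q)) + (- 1) * u (\<psi> t (fst p)) (rot t (snd p)))
        = (\<lambda>t. spectral j0 k0 (rot t (snd p)) - spectral j0 k0 (rot t (snd q)))"
        using eq by (auto simp: algebra_simps)
      finally have z: "snd p = snd q" by (rule spectral_separates[OF in'(3,4) fr(1)])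
      have "fst p = fst q" by (rule u(4)[OF in'(1,2,3)]) (use eq z in auto)
      with z show "p = q" by (simp add: prod_eq_iff)
    qed
    let ?m = "submetric euclidean_metric (X \<times> solenoid)"
    have "continuous_map (mtopology_of ?m) (mtopology_of (B1V_metric a b)) H"
    proof (rule continuous_map_metricI)
      show "H p \<in> mspace (B1V_metric a b)" if "p \<in> mspace ?m" for p using HB that by simp
      fix p and e :: real assume p: "p \<in> mspace ?m" and e: "0 < e"
      \<comment> \<open>The tail of the metric beyond [-N, N] contributes less than e / 2, and
        uniform continuity on [-N, N] another e / 4.\<close>
      obtain N where N: "(1/2::real) ^ N < e / 4" using real_arch_pow_inv[of "e / 4" "1/2"] e by auto
      have "uniformly_continuous_on ({- real N..real N} \<times> (X \<times> solenoid)) (\<lambda>q. w (orb (fst q) (snd q)))"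
        by (intro compact_uniformly_continuous compact_Times compact_X compact_solenoid compact_Icc continuous_on_subset[OF worb_c]) auto
      then obtain \<delta> where \<delta>: "0 < \<delta>" "\<And>q q'. q \<in> {- real N..real N} \<times> (X \<times> solenoid) \<Longrightarrow> q' \<in> {- real N..real N} \<times> (X \<times> solenoid) \<Longrightarrow>
        dist q' q < \<delta> \<Longrightarrow> dist (w (orb (fst q') (snd q'))) (w (orb (fst q) (snd q))) < e / 4"
        unfolding uniformly_continuous_on_def using e by (metis zero_less_divide_iff zero_less_numeral)
      show "\<exists>\<delta>>0. \<forall>p'\<in>mspace ?m. mdist ?m p p' < \<delta> \<longrightarrow> mdist (B1V_metric a b) (H p) (H p') < e"
      proof (intro exI[of _ \<delta>] conjI ballI impI \<delta>(1))
        fix p' assume p': "p' \<in> mspace ?m" "mdist ?m p p' < \<delta>"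
        have in': "p \<in> X \<times> solenoid" "p' \<in> X \<times> solenoid" using p p'(1) by auto
        have "loc_unif_dist (H p) (H p') \<le> e / 4 + 2 * (1/2) ^ N"
        proof (rule loc_unif_dist_le[OF H1[OF in'(1)] H1[OF in'(2)]])
          fix t assume t: "\<bar>t\<bar> \<le> real N"
          have "dist (t, p) (t, p') < \<delta>" using p'(2) by (simp add: dist_Pair_Pair)
          then have "dist (w (orb t p)) (w (orb t p')) < e / 4"
            using \<delta>(2)[of "(t, p')" "(t, p)"] in' t by (auto simp: abs_le_iff)
          then show "norm (apply_bcontfun (H p) t - apply_bcontfun (H p') t) \<le> e / 4"
            unfolding H[OF in'(1)] H[OF in'(2)] by (simp add: dist_norm)
        qed
        then show "mdist (B1V_metric a b) (H p) (H p') < e" using N e by simp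
      qed
    qed
    then show "continuous_map (top_of_set (X \<times> solenoid)) (mtopology_of (B1V_metric a b)) H"
      by (simp add: mtopology_of_submetric)
  qed
qed

end

section \<open>The extension\<close>

lemma small_width_empty:
  assumes "topspace T = {}"
  shows "small_width T D \<epsilon> = (\<lambda>n. \<exists>C :: (nat \<Rightarrow>\<^sub>C real) set. compact C \<and> covering_dim_le (top_of_set C) n)"
  using assms by (auto simp: small_width_def continuous_map_def fun_eq_iff)

text \<open>Over empty carriers every condition on points is vacuous, so both sides are the same
  formal expression in the dimensions of arbitrary compact sets.\<close>

lemma mdim_empty:
  fixes X :: "'a metric" and Y :: "'b metric"
  assumes "mspace X = {}" "mspace Y = {}"
  shows "mdim X \<phi> = mdim Y \<eta>"
proof -
  have X: "Metric_space (mspace X) (flow_dist X \<phi> N)" and Y: "Metric_space (mspace Y) (flow_dist Y \<eta> N)" for N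
    using assms by (auto simp: flow_dist_def intro!: Metric_space.intro)
  have "flow_Widim X \<phi> \<epsilon> N = flow_Widim Y \<eta> \<epsilon> N" for \<epsilon> N
  proof -
    have "topspace (Metric_space.mtopology (mspace X) (flow_dist X \<phi> N)) = {}"
      "topspace (Metric_space.mtopology (mspace Y) (flow_dist Y \<eta> N)) = {}"
      using assms Metric_space.topspace_mtopology[OF X] Metric_space.topspace_mtopology[OF Y] by simp_all
    then show ?thesis unfolding Widim_eq_INF[OF X] Widim_eq_INF[OF Y] by (simp only: small_width_empty)
  qed
  then show ?thesis by (simp add: mdim_def)
qed

text \<open>The extension is the product with the dyadic solenoid, carried by the image of its embedding
  but metrized so that the solenoid acts by isometries.\<close>

lemma extension_of_embedding:
  fixes X :: "'a metric" and e :: "'a \<Rightarrow> 'b::metric_space"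
  assumes fl: "flow X \<phi>" and ne: "mspace X \<noteq> {}"
    and iso: "\<And>x y. x \<in> mspace X \<Longrightarrow> y \<in> mspace X \<Longrightarrow> dist (e x) (e y) = mdist X x y"
    and cf: "compact_flow (e ` mspace X) \<psi>" and \<psi>: "\<And>r x. x \<in> mspace X \<Longrightarrow> \<psi> r (e x) = e (\<phi> r x)"
    and inj: "inj_on H (e ` mspace X \<times> solenoid)"
    and HB: "\<And>p. p \<in> e ` mspace X \<times> solenoid \<Longrightarrow> H p \<in> B1V a b"
    and Htr: "\<And>r x z. x \<in> e ` mspace X \<Longrightarrow> z \<in> solenoid \<Longrightarrow> translate r (H (x, z)) = H (\<psi> r x, rot r z)"
    and Hc: "continuous_map (top_of_set (e ` mspace X \<times> solenoid)) (mtopology_of (B1V_metric a b)) H"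
  shows "\<exists>(Y :: (real \<Rightarrow>\<^sub>C complex) metric). flow Y translate \<and> flow_extension Y translate X \<phi> \<and>
    mdim Y translate = mdim X \<phi> \<and> flow_embeds Y translate (B1V_metric a b) translate"
proof -
  let ?X = "e ` mspace X" and ?P = "e ` mspace X \<times> solenoid"
  interpret compact_flow ?X \<psi> by fact
  define M where "M = H ` ?P"
  define g where "g = inv_into ?P H"
  have gH: "g (H p) = p" if "p \<in> ?P" for p unfolding g_def using inj that by simp
  have Hg: "H (g v) = v" and gP: "g v \<in> ?P" if "v \<in> M" for v
    using that gH by (auto simp: M_def)
  \<comment> \<open>The maximum keeps the two contributions apart: along a pair of orbits the second
    one is constant.\<close>
  define D where "D v w = max (dist (fst (g v)) (fst (g w))) (dist (snd (g v)) (snd (g w)))" for v w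
  interpret Y: Metric_space M D
  proof
    show "0 \<le> D v w" for v w by (simp add: D_def le_max_iff_disj)
    show "D v w = D w v" for v w by (simp add: D_def dist_commute)
    show "D v w = 0 \<longleftrightarrow> v = w" if vw: "v \<in> M" "w \<in> M" for v w
    proof
      assume "D v w = 0"
      then have "dist (fst (g v)) (fst (g w)) \<le> 0" "dist (snd (g v)) (snd (g w)) \<le> 0"
        unfolding D_def by (metis max.cobounded1, metis max.cobounded2)
      then have "g v = g w" by (simp add: prod_eq_iff)
      then show "v = w" using Hg vw by metis
    qed (simp add: D_def)
    show "D u w \<le> D u v + D v w" for u v w
      unfolding D_def
      using dist_triangle[of "fst (g u)" "fst (g w)" "fst (g v)"] dist_triangle[of "snd (g u)" "snd (g w)" "snd (g v)"]
      by (auto simp: max_def)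
  qed
  define Y where "Y = metric (M, D)"
  have Y: "mspace Y = M" "mdist Y = D" by (simp_all add: Y_def Y.mspace_metric Y.mdist_metric)
  have HM: "H p \<in> M" if "p \<in> ?P" for p using that by (simp add: M_def)
  have orb: "(\<psi> r (fst p), rot r (snd p)) \<in> ?P" if "p \<in> ?P" for r p
    using that by (auto intro: flow_in rot_solenoid)
  have tr: "translate r v = H (\<psi> r (fst (g v)), rot r (snd (g v)))" if v: "v \<in> M" for r v
  proof -
    have "translate r (H (fst (g v), snd (g v))) = H (\<psi> r (fst (g v)), rot r (snd (g v)))"
      using gP[OF v] by (intro Htr) (auto simp: mem_Times_iff)
    then show ?thesis using Hg[OF v] by simp
  qed
  have trM: "translate r v \<in> M" if "v \<in> M" for r v
    unfolding tr[OF that] by (rule HM[OF orb[OF gP[OF that]]])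
  have gtr: "g (translate r v) = (\<psi> r (fst (g v)), rot r (snd (g v)))" if "v \<in> M" for r v
    unfolding tr[OF that] by (rule gH[OF orb[OF gP[OF that]]])
  let ?m = "submetric euclidean_metric ?P"
  have mt: "mtopology_of ?m = top_of_set ?P" by (simp add: mtopology_of_submetric)
  have Yc: "continuous_map (top_of_set ?P) (mtopology_of Y) H"
    unfolding mt[symmetric]
  proof (rule continuous_map_metricI)
    show "H p \<in> mspace Y" if "p \<in> mspace ?m" for p using HM that by (simp add: Y)
    fix p and r :: real assume p: "p \<in> mspace ?m" and r: "0 < r"
    have "D (H p) (H q) \<le> dist p q" if "q \<in> ?P" for q
      using gH[OF that] gH[of p] p dist_fst_le[of p q] dist_snd_le[of p q] by (simp add: D_def)
    then show "\<exists>\<delta>>0. \<forall>q\<in>mspace ?m. mdist ?m p q < \<delta> \<longrightarrow> mdist Y (H p) (H q) < r"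
      using r by (intro exI[of _ r]) (auto simp: Y intro: le_less_trans)
  qed
  have gc: "continuous_map (mtopology_of Y) (top_of_set ?P) g"
    unfolding mt[symmetric]
  proof (rule continuous_map_metricI)
    show "g v \<in> mspace ?m" if "v \<in> mspace Y" for v using gP that by (simp add: Y)
    fix v and r :: real assume v: "v \<in> mspace Y" and r: "0 < r"
    have "dist (g v) (g w) \<le> 2 * D v w" for w
    proof -
      have "dist (g v) (g w) \<le> dist (fst (g v)) (fst (g w)) + dist (snd (g v)) (snd (g w))"
        by (simp add: dist_prod_def sqrt_sum_squares_le_sum)
      then show ?thesis by (simp add: D_def max_def split: if_splits)
    qed
    then show "\<exists>\<delta>>0. \<forall>w\<in>mspace Y. mdist Y v w < \<delta> \<longrightarrow> mdist ?m (g v) (g w) < r"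
      using r by (intro exI[of _ "r / 2"]) (force simp: Y intro: le_less_trans)
  qed
  have cP: "compact ?P" using compact_X compact_solenoid by (rule compact_Times)
  have compY: "compact_space (mtopology_of Y)"
  proof -
    have "compactin (mtopology_of Y) (H ` ?P)"
      by (rule image_compactin[OF _ Yc]) (use cP in \<open>simp add: compactin_subtopology\<close>)
    then show ?thesis by (simp add: compact_space_def Y M_def)
  qed
  have flY: "flow Y translate"
    unfolding flow_def
  proof (intro conjI ballI allI compY)
    have "continuous_map (prod_topology euclideanreal (mtopology_of Y)) (prod_topology euclideanreal (top_of_set ?P)) (\<lambda>q. (fst q, g (snd q)))"
      unfolding continuous_map_pairwise o_def
      using continuous_map_compose[OF continuous_map_snd gc] by (simp add: o_def continuous_map_fst)
    moreover have "continuous_on (UNIV \<times> ?P) (\<lambda>q. (\<psi> (fst q) (fst (snd q)), rot (fst q) (snd (snd q))))"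
      by (rule continuous_on_product_orbit)
    then have "continuous_map (top_of_set (UNIV \<times> ?P)) (top_of_set ?P) (\<lambda>q. (\<psi> (fst q) (fst (snd q)), rot (fst q) (snd (snd q))))"
      by (auto simp: continuous_map_in_subtopology intro: flow_in rot_solenoid)
    then have "continuous_map (prod_topology euclideanreal (top_of_set ?P)) (top_of_set ?P) (\<lambda>q. (\<psi> (fst q) (fst (snd q)), rot (fst q) (snd (snd q))))"
      using prod_topology_subtopology_eu[of "UNIV :: real set" ?P] by simp
    ultimately have "continuous_map (prod_topology euclideanreal (mtopology_of Y)) (mtopology_of Y)
      (H \<circ> ((\<lambda>q. (\<psi> (fst q) (fst (snd q)), rot (fst q) (snd (snd q)))) \<circ> (\<lambda>q. (fst q, g (snd q)))))"
      by (rule continuous_map_compose[OF continuous_map_compose Yc])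
    then show "continuous_map (prod_topology euclideanreal (mtopology_of Y)) (mtopology_of Y) (\<lambda>(r, v). translate r v)"
      by (rule continuous_map_eq) (auto simp: Y tr)
    show "translate 0 v = v" for v by (rule bcontfun_eqI) simp
    show "translate r (translate s v) = translate (r + s) v" for r s v
      by (rule bcontfun_eqI) (simp add: add_ac)
  qed
  obtain ie where "homeomorphic_maps (mtopology_of X) (top_of_set ?X) e ie"
    using isometry_homeomorphic[OF iso] homeomorphic_map_maps by blast
  then have ie: "\<And>x. x \<in> mspace X \<Longrightarrow> ie (e x) = x" and iec: "continuous_map (top_of_set ?X) (mtopology_of X) ie"
    and ec: "continuous_map (mtopology_of X) (top_of_set ?X) e"
    by (auto simp: homeomorphic_maps_def)
  have fstc: "continuous_map (top_of_set ?P) (top_of_set ?X) fst"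
    by (auto simp: continuous_map_in_subtopology intro!: continuous_intros)
  define p where "p = ie \<circ> (fst \<circ> g)"
  have pc: "continuous_map (mtopology_of Y) (mtopology_of X) p"
    unfolding p_def by (intro continuous_map_compose[OF _ iec] continuous_map_compose[OF gc fstc])
  have ep: "e (p v) = fst (g v)" "p v \<in> mspace X" if "v \<in> M" for v
    using gP[OF that] by (auto simp: p_def ie)
  have ptr: "p (translate r v) = \<phi> r (p v)" if v: "v \<in> M" for r v
  proof -
    have "fst (g (translate r v)) = e (\<phi> r (p v))" using ep[OF v] by (simp add: gtr[OF v] flip: \<psi>)
    then show ?thesis using flow_in_mspace[OF fl ep(2)[OF v]] by (simp add: p_def ie)
  qed
  \<comment> \<open>The slice over one point of the solenoid is a copy of X. It is not invariant
    under the flow, which is harmless because only orbit distances are compared.\<close>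
  define z0 :: "nat \<Rightarrow> complex" where "z0 = (\<lambda>_. 1)"
  define j where "j x = H (e x, z0)" for x
  have jP: "(e x, z0) \<in> ?P" if "x \<in> mspace X" for x using that one_solenoid by (simp add: z0_def)
  have pj: "p (j x) = x" if "x \<in> mspace X" for x
    using gH[OF jP[OF that]] ie[OF that] by (simp add: p_def j_def)
  have jc: "continuous_map (mtopology_of X) (mtopology_of Y) j"
  proof -
    have "continuous_map (mtopology_of X) (prod_topology (top_of_set ?X) (top_of_set solenoid)) (\<lambda>x. (e x, z0))"
      unfolding continuous_map_pairwise o_def using ec one_solenoid by (simp add: z0_def)
    then have "continuous_map (mtopology_of X) (top_of_set ?P) (\<lambda>x. (e x, z0))"
      unfolding prod_topology_subtopology_eu .
    from continuous_map_compose[OF this Yc] show ?thesis by (simp add: o_def j_def[abs_def])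
  qed
  have dY: "mdist Y (translate r v) (translate r w) = max (mdist X (\<phi> r (p v)) (\<phi> r (p w))) (dist (snd (g v)) (snd (g w)))"
    if vw: "v \<in> M" "w \<in> M" for r v w
  proof -
    have "dist (fst (g (translate r v))) (fst (g (translate r w))) = mdist X (\<phi> r (p v)) (\<phi> r (p w))"
      using ep(1)[OF trM[OF vw(1)], of r] ep(1)[OF trM[OF vw(2)], of r] vw
      by (metis ptr iso ep(2) trM)
    then show ?thesis by (simp add: Y D_def gtr[OF vw(1)] gtr[OF vw(2)] dist_rot)
  qed
  have "flow_extension Y translate X \<phi>"
    unfolding flow_extension_def
  proof (intro exI[of _ p] conjI pc)
    show "p ` mspace Y = mspace X"
    proof
      show "p ` mspace Y \<subseteq> mspace X" using ep(2) by (auto simp: Y)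
      show "mspace X \<subseteq> p ` mspace Y"
      proof
        fix x assume x: "x \<in> mspace X"
        have "j x \<in> mspace Y" using HM[OF jP[OF x]] by (simp add: Y j_def)
        then show "x \<in> p ` mspace Y" using pj[OF x] by (metis imageI)
      qed
    qed
    show "equivariant Y translate \<phi> p" by (simp add: equivariant_def Y ptr)
  qed
  moreover have "mdim Y translate = mdim X \<phi>"
  proof (rule mdim_extension_eq[OF fl flY ne jc _ pc])
    fix N :: real and x y assume *: "0 \<le> N" "x \<in> mspace X" "y \<in> mspace X"
    have jM: "j x \<in> M" "j y \<in> M" using HM jP * by (auto simp: j_def)
    show "flow_dist X \<phi> N x y \<le> flow_dist Y translate N (j x) (j y)"
    proof (rule flow_dist_le[OF *])
      fix r assume r: "r \<in> {0..N}"
      have "mdist X (\<phi> r x) (\<phi> r y) \<le> mdist Y (translate r (j x)) (translate r (j y))"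
        unfolding dY[OF jM] using pj * by simp
      also have "\<dots> \<le> flow_dist Y translate N (j x) (j y)"
        by (rule le_flow_dist[OF flY _ _ r]) (use jM in \<open>auto simp: Y\<close>)
      finally show "mdist X (\<phi> r x) (\<phi> r y) \<le> flow_dist Y translate N (j x) (j y)" .
    qed
  next
    fix \<epsilon> :: real assume \<epsilon>: "0 < \<epsilon>"
    obtain k where k: "\<And>z w. z \<in> solenoid \<Longrightarrow> w \<in> solenoid \<Longrightarrow> z k = w k \<Longrightarrow> dist z w < \<epsilon>"
      using solenoid_close[OF \<epsilon>] by blast
    let ?I = "{-1..1::real}"
    \<comment> \<open>The real and imaginary part of one solenoid coordinate are the two extra
      dimensions.\<close>
    define q where "q v = (Re (snd v k), Im (snd v k))" for v :: "'b \<times> (nat \<Rightarrow> complex)"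
    have "continuous_on ?P q"
      unfolding q_def by (intro continuous_intros continuous_on_compose2[OF continuous_on_coordinate[of UNIV]]) auto
    moreover have "q v \<in> ?I \<times> ?I" if "v \<in> ?P" for v
    proof -
      have "norm (snd v k) = 1" using that by (auto simp: solenoid_def)
      then show ?thesis using abs_Re_le_cmod[of "snd v k"] abs_Im_le_cmod[of "snd v k"] by (auto simp: q_def abs_le_iff)
    qed
    ultimately have "continuous_map (top_of_set ?P) (top_of_set (?I \<times> ?I)) q"
      by (auto simp: continuous_map_in_subtopology simp del: mem_Times_iff)
    then have qc: "continuous_map (mtopology_of Y) (top_of_set (?I \<times> ?I)) (q \<circ> g)" by (rule continuous_map_compose[OF gc])
    show "\<exists>q. continuous_map (mtopology_of Y) (top_of_set (?I \<times> ?I)) q \<and>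
      (\<forall>N\<ge>0. \<forall>v\<in>mspace Y. \<forall>w\<in>mspace Y. q v = q w \<longrightarrow> flow_dist X \<phi> N (p v) (p w) < \<epsilon> \<longrightarrow> flow_dist Y translate N v w < \<epsilon>)"
    proof (intro exI[of _ "q \<circ> g"] conjI qc allI ballI impI)
      fix N :: real and v w
      assume *: "0 \<le> N" "v \<in> mspace Y" "w \<in> mspace Y" "(q \<circ> g) v = (q \<circ> g) w" "flow_dist X \<phi> N (p v) (p w) < \<epsilon>"
      then have vw: "v \<in> M" "w \<in> M" by (auto simp: Y)
      have "snd (g v) k = snd (g w) k" using *(4) by (simp add: q_def complex_eq_iff)
      then have "dist (snd (g v)) (snd (g w)) < \<epsilon>" using gP vw by (intro k) (auto simp: mem_Times_iff)
      moreover have "flow_dist Y translate N v w \<le> max (flow_dist X \<phi> N (p v) (p w)) (dist (snd (g v)) (snd (g w)))"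
      proof (rule flow_dist_le[OF *(1-3)])
        fix r assume r: "r \<in> {0..N}"
        have "mdist X (\<phi> r (p v)) (\<phi> r (p w)) \<le> flow_dist X \<phi> N (p v) (p w)"
          by (rule le_flow_dist[OF fl ep(2)[OF vw(1)] ep(2)[OF vw(2)] r])
        then show "mdist Y (translate r v) (translate r w) \<le> max (flow_dist X \<phi> N (p v) (p w)) (dist (snd (g v)) (snd (g w)))"
          unfolding dY[OF vw] by (rule max.mono) simp
      qed
      ultimately show "flow_dist Y translate N v w < \<epsilon>" using *(5) by simp
    qed
  qed
  moreover have "flow_embeds Y translate (B1V_metric a b) translate"
    unfolding flow_embeds_def
  proof (intro exI conjI)
    have "continuous_map (mtopology_of Y) (mtopology_of (B1V_metric a b)) (H \<circ> g)"
      by (rule continuous_map_compose[OF gc Hc])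
    \<comment> \<open>Y lies inside the function space, so the embedding is the inclusion. The
      metric of Y differs, but a continuous injection of a compact space into a Hausdorff space is a
      homeomorphism onto its image.\<close>
    then have c: "continuous_map (mtopology_of Y) (mtopology_of (B1V_metric a b)) (\<lambda>v. v)"
      by (rule continuous_map_eq) (simp add: Y Hg)
    have "Hausdorff_space (mtopology_of (B1V_metric a b))"
      unfolding mtopology_of_def by (rule Metric_space.Hausdorff_space_mtopology) (simp add: Metric_space_B1V)
    then have "closed_map (mtopology_of Y) (mtopology_of (B1V_metric a b)) (\<lambda>v. v)"
      using continuous_imp_closed_map[OF c compY] by blast
    then show "embedding_map (mtopology_of Y) (mtopology_of (B1V_metric a b)) (\<lambda>v. v)"
      by (rule injective_closed_imp_embedding_map[OF c]) simp
    show "equivariant Y translate translate (\<lambda>v. v)" by (simp add: equivariant_def)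
  qed
  ultimately show ?thesis using flY by blast
qed

theorem theorem5p3:
  fixes a b :: real and X :: "'a metric" and \<phi> :: "real \<Rightarrow> 'a \<Rightarrow> 'a"
  assumes "a < b"
    and "flow X \<phi>"
    and "mdim X \<phi> < ereal (b - a)"
  shows "\<exists>(Y :: (real \<Rightarrow>\<^sub>C complex) metric) \<eta>.
           flow Y \<eta> \<and>
           flow_extension Y \<eta> X \<phi> \<and>
           mdim Y \<eta> = mdim X \<phi> \<and>
           flow_embeds Y \<eta> (B1V_metric a b) translate"
proof (cases "mspace X = {}")
  case True
  \<comment> \<open>The empty flow serves as Y. The subadditivity arguments concern nonempty spaces,
    whose dimensions are nonnegative.\<close>
  define Y :: "(real \<Rightarrow>\<^sub>C complex) metric" where "Y = submetric euclidean_metric {}"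
  have Y: "mspace Y = {}" by (simp add: Y_def)
  have t: "topspace (mtopology_of Y) = {}" by (simp add: Y)
  have "flow Y translate"
    using t by (simp add: flow_def Y compact_space_def continuous_map_def)
  moreover have "flow_extension Y translate X \<phi>"
    using True by (auto simp: flow_extension_def equivariant_def Y continuous_map_def)
  moreover have "mdim Y translate = mdim X \<phi>" using Y True by (rule mdim_empty)
  moreover have "flow_embeds Y translate (B1V_metric a b) translate"
  proof -
    have "embedding_map (mtopology_of Y) (mtopology_of (B1V_metric a b)) id"
      by (rule injective_closed_imp_embedding_map)
        (auto simp: continuous_map_def closed_map_def Y dest: closedin_subset)
    then show ?thesis by (auto simp: flow_embeds_def equivariant_def Y)
  qed
  ultimately show ?thesis by blast
next
  case False
  obtain r where r: "mdim X \<phi> < ereal r" "ereal r < ereal (b - a)" using ereal_dense2[OF assms(3)] by blast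
  \<comment> \<open>The second entry keeps \<rho> positive.\<close>
  define \<rho> where "\<rho> = max r ((b - a) / 2)"
  have \<rho>: "mdim X \<phi> < ereal \<rho>" "0 < \<rho>" "\<rho> < b - a"
    using r assms(1) by (auto simp: \<rho>_def less_max_iff_disj intro: less_le_trans)
  \<comment> \<open>\<rho> < \<rho>0 < c - a < b - a are equally spaced. The three gaps absorb the
    passage from dimension n to n + 1 weights, the rounding and decay in the interpolation, and the
    frequencies of the solenoid.\<close>
  define \<rho>0 c where "\<rho>0 = (2 * \<rho> + (b - a)) / 3" and "c = a + (\<rho> + 2 * (b - a)) / 3"
  have c: "0 < \<rho>0" "\<rho> < \<rho>0" "\<rho>0 < c - a" "a < c" "c < b"
    using \<rho> by (auto simp: \<rho>0_def c_def field_simps)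
  obtain e :: "'a \<Rightarrow> nat \<Rightarrow>\<^sub>C real" and \<psi>
    where iso: "\<And>x y. x \<in> mspace X \<Longrightarrow> y \<in> mspace X \<Longrightarrow> dist (e x) (e y) = mdist X x y"
    and e: "compact (e ` mspace X)" "continuous_on (UNIV \<times> e ` mspace X) (\<lambda>(r, x). \<psi> r x)"
    and \<psi>: "\<And>r x. x \<in> mspace X \<Longrightarrow> \<psi> r (e x) = e (\<phi> r x)"
    using flow_model[OF assms(2)] by blast
  have cf: "compact_flow (e ` mspace X) \<psi>"
    using e flow_in_mspace[OF assms(2)] flow_zero[OF assms(2)] flow_add[OF assms(2)]
    by unfold_locales (auto simp: \<psi>)
  then interpret compact_flow "e ` mspace X" \<psi> .
  have wp: "\<forall>\<^sub>F N in at_top. \<exists>m. width_partition \<epsilon> N m \<and> real m \<le> \<rho>0 * N" if "0 < \<epsilon>" for \<epsilon>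
    using mdim_less_imp_small_width[OF assms(2) False \<rho>(1) that] eventually_ge_at_top[of "max 0 (1 / (\<rho>0 - \<rho>))"]
  proof eventually_elim
    case (elim N)
    then obtain n where n: "flow_small_width X \<phi> \<epsilon> N n" "of_int n < \<rho> * N" and N: "0 \<le> N" "1 / (\<rho>0 - \<rho>) \<le> N" by auto
    have "0 \<le> n" using flow_small_width_nonneg[OF n(1) False] .
    then have "real (nat (n + 1)) = of_int n + 1" by simp
    \<comment> \<open>From this N on, the one additional weight fits between \<rho> N and \<rho>0
      N.\<close>
    moreover have "1 \<le> (\<rho>0 - \<rho>) * N" using N(2) c(2) by (simp add: pos_divide_le_eq mult.commute)
    then have "1 \<le> \<rho>0 * N - \<rho> * N" unfolding left_diff_distrib .
    ultimately have "real (nat (n + 1)) \<le> \<rho>0 * N" using n(2) by linarith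
    moreover have "width_partition \<epsilon> N (nat (n + 1))"
      using assms(2) N(1) n(1) iso cf \<psi> by (rule width_partition_if_small_width[where X = X and \<phi> = \<phi> and e = e])
    ultimately show ?case by (intro exI conjI)
  qed
  show ?thesis
  proof (rule exists_embedding[OF c(4,5,1,3) wp])
    fix H assume H: "inj_on H (e ` mspace X \<times> solenoid)" "\<And>p. p \<in> e ` mspace X \<times> solenoid \<Longrightarrow> H p \<in> B1V a b"
      "\<And>r x z. x \<in> e ` mspace X \<Longrightarrow> z \<in> solenoid \<Longrightarrow> translate r (H (x, z)) = H (\<psi> r x, rot r z)"
      "continuous_map (top_of_set (e ` mspace X \<times> solenoid)) (mtopology_of (B1V_metric a b)) H"
    have "\<exists>Y :: (real \<Rightarrow>\<^sub>C complex) metric. flow Y translate \<and> flow_extension Y translate X \<phi> \<and>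
        mdim Y translate = mdim X \<phi> \<and> flow_embeds Y translate (B1V_metric a b) translate"
      using assms(2) False iso cf \<psi> H by (rule extension_of_embedding[where e = e])
    then show ?thesis by blast
  qed auto
qed

end
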